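(* Assume Conditions A, B and C stated in the context, for a given $\beta>1/2$. Assume there exist a sequence of positive numbers $m_n\uparrow\infty$ and constants $C_2\ge C_1>0$ such that $$C_1 m_n^{1+2\beta}\;\le\;\sum_{j=1}^n|\overline{\varphi}_{j,n}(m_n)|^2\;\le\; C_2 m_n^{1+2\beta}\qquad\text{for all } n .$$ Then: (a) when selecting $\omega_n=c_2^{-1}m_n$ (with $c_2$ the constant in Condition (C.5)), the estimator $\widehat f_n$ satisfies $$\sup_{f_X\in\mathcal{F}_{\beta,C}}\mathrm{E}\|\widehat f_n-f_X\|_{L_2(\mathbb{R})}^2=O(m_n^{-2\beta})\qquad (n\to\infty);$$ (b) if $C$ is large enough, then for an arbitrary estimator $\check f_n$ of $f_X$ based on $Y_1,\dots,Y_n$, $$\sup_{f_X\in\mathcal{F}_{\beta,C}}\mathrm{E}\|\check f_n-f_X\|_{L_2(\mathbb{R})}^2\ge \mathrm{const.}\cdot m_n^{-2\beta},$$ with a positive constant that does not depend on $n$ or on the estimator.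
   Context: Model: for each sample size $n$ one observes $Y_j=X_j+\varepsilon_j$, $j=1,\dots,n$, where $X_1,\dots,X_n$ are i.i.d. with unknown density $f_X$ on $\mathbb{R}$, the errors $\varepsilon_1,\dots,\varepsilon_n$ are independent of each other and of the $X_j$'s, and $\varepsilon_j$ has known density $f_{\varepsilon_j}$, which may depend on both $j$ and $n$. For a function $g$, $g^{\mathrm{ft}}(t)=\int e^{\mathrm{i}tx}g(x)\,\mathrm{d}x$ denotes its Fourier transform. Estimator: for a square-integrable kernel $K$ and a smoothing parameter $\omega_n>0$, $$\widehat f_n(x)=\frac1{2\pi}\int e^{-\mathrm{i}tx}K^{\mathrm{ft}}(t/\omega_n)\Psi_n(t)\,\mathrm{d}t,\qquad \Psi_n(t)=\frac{\sum_{j=1}^n f_{\varepsilon_j}^{\mathrm{ft}}(-t)\,e^{\mathrm{i}tY_j}}{\sum_{k=1}^n|f_{\varepsilon_k}^{\mathrm{ft}}(t)|^2}.$$ Class: for $\beta>1/2$ and $C>0$, $\mathcal{F}_{\beta,C}$ is the set of probability densities $f$ on $\mathbb{R}$ with $\int|f^{\mathrm{ft}}(t)|^2(1+t^2)^\beta\,\mathrm{d}t\le C$. Condition A: (A.1) there exists some $j$ such that $|f_{\varepsilon_j}^{\mathrm{ft}}(t)|\ne0$ for all $t\in\mathbb{R}$; (A.2) $K^{\mathrm{ft}}$ is bounded, continuous at $t=0$ and $K^{\mathrm{ft}}(0)=1$; (A.3) $f_{\varepsilon_j}^{\mathrm{ft}}(t\omega_n)K^{\mathrm{ft}}(t)/\big(\sum_{k=1}^n|f_{\varepsilon_k}^{\mathrm{ft}}(t\omega_n)|^2\big)\in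 L_2(\mathbb{R})$, as a function of $t$, for $j=1,\dots,n$. Condition B: $|K^{\mathrm{ft}}(t)|\le1$ for all $t$, $K^{\mathrm{ft}}$ is supported on $[-1,1]$, and $|K^{\mathrm{ft}}(t)-1|=o(|t|^\beta)$ as $t\to0$, with the same $\beta$ as in $\mathcal{F}_{\beta,C}$. Condition C: there exist constants $\alpha>0$, $C_0>0$, $T\ge0$, $c_1>0$, $c_2\ge1$, all independent of $j$ and $n$, and positive monotone decreasing functions $\overline{\varphi}_{j,n}(t)$ and $\underline{\varphi}_{j,n}(t)$, $t>0$, such that for all $j,n$: (C.1) $P(|\varepsilon_j|\le\alpha)\ge C_0$; (C.2) $|f_{\varepsilon_j}^{\mathrm{ft}}(t)|\ge\underline{\varphi}_{j,n}(T)$ for all $|t|\le T$; (C.3) $\underline{\varphi}_{j,n}(t)\le|f_{\varepsilon_j}^{\mathrm{ft}}(t)|\le\overline{\varphi}_{j,n}(t)$ for all $t>T$; (C.4) $|(f_{\varepsilon_j}^{\mathrm{ft}})'(t)|\le\overline{\varphi}_{j,n}(t)$ for all $t>T$; (C.5) $\underline{\varphi}_{j,n}(t)\ge c_1\,\overline{\varphi}_{j,n}(c_2t)$ for all $t>0$. *)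

theory Defs
  imports "HOL-Probability.Probability" "HOL-Library.Landau_Symbols"
begin

definition prob_density :: "(real \<Rightarrow> real) \<Rightarrow> bool" where
  "prob_density f \<longleftrightarrow>
     f \<in> borel_measurable borel \<and> (\<forall>x. 0 \<le> f x) \<and> has_bochner_integral lborel f 1"

definition square_integrable :: "(real \<Rightarrow> 'a::{real_normed_vector, second_countable_topology}) \<Rightarrow> bool"
  where "square_integrable h \<longleftrightarrow>
     h \<in> borel_measurable borel \<and> integrable lborel (\<lambda>x. (norm (h x))\<^sup>2)"

definition ft :: "(real \<Rightarrow> real) \<Rightarrow> real \<Rightarrow> complex" where
  "ft g t = (CLINT x|lborel. iexp (t * x) * complex_of_real (g x))"

text \<open>A square-integrable kernel need not be integrable (the sinc kernel, with transform
  the indicator of \<open>[-1,1]\<close>, is the standard example), so its Fourier transform is the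
  Fourier--Plancherel transform: the \<open>L\<^sub>2\<close> limit of the transforms of the truncated kernels. It is
  determined only almost everywhere; \<open>L2_ft K G\<close> says that \<open>G\<close> is a version of it. If \<open>K\<close>
  is also integrable, then \<open>ft K\<close> is such a version.\<close>

definition L2_ft :: "(real \<Rightarrow> real) \<Rightarrow> (real \<Rightarrow> complex) \<Rightarrow> bool" where
  "L2_ft K G \<longleftrightarrow> square_integrable K \<and> square_integrable G \<and>
     ((\<lambda>R. \<integral>\<^sup>+t. ennreal ((cmod (ft (\<lambda>x. indicator {-R..R} x * K x) t - G t))\<^sup>2) \<partial>lborel)
        \<longlongrightarrow> 0) at_top"

definition density_class :: "real \<Rightarrow> real \<Rightarrow> (real \<Rightarrow> real) set" where
  "density_class \<beta> C = {f. prob_density f \<and>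
     (\<integral>\<^sup>+t. ennreal ((cmod (ft f t))\<^sup>2 * (1 + t\<^sup>2) powr \<beta>) \<partial>lborel) \<le> ennreal C}"

text \<open>In the following definitions \<open>fe j\<close> is the density of the \<open>j\<close>-th error in a sample of fixed
  size \<open>n\<close>, \<open>y\<close> is the vector of observations (indexed by \<open>{1..n}\<close>), \<open>Kft\<close> is a version of the
  Fourier transform of the kernel and \<open>w\<close> is the smoothing parameter.\<close>

definition Psi :: "nat \<Rightarrow> (nat \<Rightarrow> real \<Rightarrow> real) \<Rightarrow> (nat \<Rightarrow> real) \<Rightarrow> real \<Rightarrow> complex" where
  "Psi n fe y t = (\<Sum>j=1..n. ft (fe j) (-t) * iexp (t * y j))
     / complex_of_real (\<Sum>k=1..n. (cmod (ft (fe k) t))\<^sup>2)"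

definition fhat :: "nat \<Rightarrow> (nat \<Rightarrow> real \<Rightarrow> real) \<Rightarrow> (real \<Rightarrow> complex) \<Rightarrow> real
    \<Rightarrow> (nat \<Rightarrow> real) \<Rightarrow> real \<Rightarrow> complex" where
  "fhat n fe Kft w y x =
     1 / (2 * pi) * (CLINT t|lborel. iexp (- (t * x)) * Kft (t / w) * Psi n fe y t)"

text \<open>The model \<open>Y\<^sub>j = X\<^sub>j + \<epsilon>\<^sub>j\<close> on its canonical probability space: the coordinates of the first
  factor are the i.i.d. \<open>X\<^sub>j\<close>, those of the second the independent errors.\<close>

definition model :: "nat \<Rightarrow> (nat \<Rightarrow> real \<Rightarrow> real) \<Rightarrow> (real \<Rightarrow> real)
    \<Rightarrow> ((nat \<Rightarrow> real) \<times> (nat \<Rightarrow> real)) measure" where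
  "model n fe f = (\<Pi>\<^sub>M j\<in>{1..n}. density lborel f) \<Otimes>\<^sub>M (\<Pi>\<^sub>M j\<in>{1..n}. density lborel (fe j))"

definition obs :: "nat \<Rightarrow> (nat \<Rightarrow> real) \<times> (nat \<Rightarrow> real) \<Rightarrow> nat \<Rightarrow> real" where
  "obs n s = (\<lambda>j\<in>{1..n}. fst s j + snd s j)"

text \<open>Estimators are jointly measurable functions of the data in \<open>\<real>\<^sup>n\<close> and of the point \<open>x\<close>. They
  are allowed to be complex-valued, so that \<open>fhat\<close> is covered directly by the same notions.\<close>

definition estimators :: "nat \<Rightarrow> ((nat \<Rightarrow> real) \<Rightarrow> real \<Rightarrow> complex) set" where
  "estimators n = {g. case_prod g \<in> borel_measurable ((\<Pi>\<^sub>M j\<in>{1..n}. borel) \<Otimes>\<^sub>M borel)}"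

definition risk :: "nat \<Rightarrow> (nat \<Rightarrow> real \<Rightarrow> real) \<Rightarrow> (real \<Rightarrow> real)
    \<Rightarrow> ((nat \<Rightarrow> real) \<Rightarrow> real \<Rightarrow> complex) \<Rightarrow> ennreal" where
  "risk n fe f g =
     (\<integral>\<^sup>+s. (\<integral>\<^sup>+x. ennreal ((cmod (g (obs n s) x - complex_of_real (f x)))\<^sup>2) \<partial>lborel)
        \<partial>model n fe f)"

text \<open>Below, \<open>fe n j\<close> is the density of the \<open>j\<close>-th error in the sample of size \<open>n\<close>, where
  \<open>1 \<le> j \<le> n\<close>; values at other indices are irrelevant.\<close>

definition condition_A :: "(nat \<Rightarrow> nat \<Rightarrow> real \<Rightarrow> real) \<Rightarrow> (real \<Rightarrow> complex) \<Rightarrow> (nat \<Rightarrow> real) \<Rightarrow> bool"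
  where "condition_A fe Kft w \<longleftrightarrow>
     (\<forall>n\<ge>1. \<exists>j\<in>{1..n}. \<forall>t. cmod (ft (fe n j) t) \<noteq> 0) \<and>
     (bounded (range Kft) \<and> isCont Kft 0 \<and> Kft 0 = 1) \<and>
     (\<forall>n\<ge>1. \<forall>j\<in>{1..n}. square_integrable (\<lambda>t.
        ft (fe n j) (t * w n) * Kft t
          / complex_of_real (\<Sum>k=1..n. (cmod (ft (fe n k) (t * w n)))\<^sup>2)))"

definition condition_B :: "real \<Rightarrow> (real \<Rightarrow> complex) \<Rightarrow> bool" where
  "condition_B \<beta> Kft \<longleftrightarrow>
     (\<forall>t. cmod (Kft t) \<le> 1) \<and>
     (\<forall>t. t \<notin> {-1..1} \<longrightarrow> Kft t = 0) \<and>
     (\<lambda>t. cmod (Kft t - 1)) \<in> o[at 0](\<lambda>t. \<bar>t\<bar> powr \<beta>)"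

text \<open>The functions \<open>\<phi>u\<close> (upper) and \<open>\<phi>l\<close> (lower) are functions of \<open>t > 0\<close>. For \<open>T = 0\<close> the bound for
  \<open>\<bar>t\<bar> \<le> T\<close> mentions \<open>\<phi>l n j 0\<close>, a value unconstrained by the other clauses, and then only says that
  this value is at most \<open>1\<close>.\<close>

definition condition_C :: "(nat \<Rightarrow> nat \<Rightarrow> real \<Rightarrow> real) \<Rightarrow> real \<Rightarrow> real \<Rightarrow> real \<Rightarrow> real \<Rightarrow> real
    \<Rightarrow> (nat \<Rightarrow> nat \<Rightarrow> real \<Rightarrow> real) \<Rightarrow> (nat \<Rightarrow> nat \<Rightarrow> real \<Rightarrow> real) \<Rightarrow> bool" where
  "condition_C fe \<alpha> C0 T c1 c2 \<phi>u \<phi>l \<longleftrightarrow>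
     \<alpha> > 0 \<and> C0 > 0 \<and> T \<ge> 0 \<and> c1 > 0 \<and> c2 \<ge> 1 \<and>
     (\<forall>n\<ge>1. \<forall>j\<in>{1..n}.
        (\<forall>t>0. \<phi>u n j t > 0 \<and> \<phi>l n j t > 0) \<and>
        antimono_on {0<..} (\<phi>u n j) \<and> antimono_on {0<..} (\<phi>l n j) \<and>
        measure (density lborel (fe n j)) {e. \<bar>e\<bar> \<le> \<alpha>} \<ge> C0 \<and>
        (\<forall>t. \<bar>t\<bar> \<le> T \<longrightarrow> \<phi>l n j T \<le> cmod (ft (fe n j) t)) \<and>
        (\<forall>t>T. \<phi>l n j t \<le> cmod (ft (fe n j) t) \<and> cmod (ft (fe n j) t) \<le> \<phi>u n j t) \<and>
        (\<forall>t>T. ft (fe n j) differentiable at t \<and>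
               cmod (vector_derivative (ft (fe n j)) (at t)) \<le> \<phi>u n j t) \<and>
        (\<forall>t>0. \<phi>l n j t \<ge> c1 * \<phi>u n j (c2 * t)))"

end

theory Submission
  imports Defs
begin

text \<open>
  Both parts are computations on the Fourier side.

  \<^emph>\<open>Upper bound.\<close> Since \<open>\<beta> > 1/2\<close>, the transform of a density in the class is integrable, so the
  density is recovered from it by inversion (\<open>inv_ft_ft_AE\<close>), and \<open>fhat - f\<close> is almost everywhere the
  inverse transform of \<open>Kft (t / w) * Psi t - ft f t\<close>. The inequality half of Plancherel's identity
  (\<open>plancherel_le\<close>) turns the loss into the integral of the squared modulus of that function.
  Here \<open>Psi t\<close> is an unbiased estimate of \<open>ft f t\<close> with mean square error of order \<open>1 / S t\<close>, where
  \<open>S t\<close> is the sum of the \<open>\<bar>ft (fe k) t\<bar>\<^sup>2\<close>. The conditions on the errors give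
  \<open>S t \<ge> c1\<^sup>2 * (\<Sum>k. \<phi>u k m ^ 2) \<ge> const * m powr (1 + 2\<beta>)\<close> on the whole band \<open>0 < \<bar>t\<bar> \<le> m / c2\<close>, whence
  a variance of order \<open>m * m powr (- 1 - 2\<beta>)\<close>. The integrated squared bias is of order \<open>w powr (- 2\<beta>)\<close> because
  \<open>\<bar>Kft t - 1\<bar> \<le> B * \<bar>t\<bar> powr \<beta>\<close> holds globally. Both are of order \<open>m powr (- 2\<beta>)\<close>.

  \<^emph>\<open>Lower bound.\<close> This is Assouad's method on the hypercube of densities
  \<open>base_density x + a * (\<Sum>j\<in>S. cos (2 j x) * fejer x)\<close> with \<open>S \<subseteq> {K..<2K}\<close>, where \<open>K\<close> is comparable to \<open>m\<close> and
  \<open>a\<close> to \<open>K powr (- \<beta> - 1/2)\<close>. The transform of the Fejer kernel is the triangle function on \<open>[-1,1]\<close>,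
  so the \<open>j\<close>-th perturbation lives in the frequency bands \<open>[2j-1, 2j+1]\<close> and \<open>[-2j-1, -2j+1]\<close>. Three
  things follow from this. The perturbations are orthogonal, so Bessel's inequality splits the loss
  into one term for each bit (\<open>loss_ge_coef\<close>). The smoothness norm of the perturbation is of order
  \<open>K * a\<^sup>2 * K powr (2\<beta>)\<close>, a constant. And after convolution with an error density only
  values of the error transform at frequencies beyond \<open>m\<close> enter, where \<open>\<phi>u\<close> at \<open>m\<close> bounds the transform and
  its derivative. Positivity of the densities needs \<open>a * K\<close> to be small, which is where \<open>\<beta> > 1/2\<close> is used.

  The base density decays like \<open>1 / (1 + x\<^sup>2)\<close>, and so does its convolution with an error density that
  puts mass near zero. The chi-square distance between the laws of one observation under two
  neighbouring hypotheses is therefore at most a constant times the integral of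
  \<open>(1 + y\<^sup>2) * \<bar>perturbation * error\<bar>\<^sup>2\<close>; in frequency, that integral is the squared norm of the
  transform and of its derivative (\<open>band_energy\<close>), hence of order \<open>a\<^sup>2 * \<phi>u(m)\<^sup>2\<close>. Summed over the sample it
  stays bounded, so no bit can be recovered reliably (\<open>product_two_point_bound\<close>). Each of the \<open>K\<close> bits
  costs a constant times \<open>a\<^sup>2\<close>, in total \<open>K powr (- 2\<beta>)\<close>.
\<close>

section \<open>The inequality half of Plancherel's identity\<close>

text \<open>Inverse transform, normalised so that it inverts \<open>ft\<close>.\<close>

definition inv_ft :: "(real \<Rightarrow> complex) \<Rightarrow> real \<Rightarrow> complex" where
  "inv_ft G x = 1 / (2 * pi) * (CLINT t|lborel. iexp (- (t * x)) * G t)"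

text \<open>Fatou's lemma in the form used below to remove a regularisation.\<close>

lemma nn_integral_le_of_tendsto:
  fixes u :: "nat \<Rightarrow> 'a \<Rightarrow> ennreal"
  assumes [measurable]: "\<And>n. u n \<in> borel_measurable M"
    and lim: "\<And>x. x \<in> space M \<Longrightarrow> (\<lambda>n. u n x) \<longlonglongrightarrow> v x"
    and le: "\<And>n. (\<integral>\<^sup>+x. u n x \<partial>M) \<le> B"
  shows "(\<integral>\<^sup>+x. v x \<partial>M) \<le> B"
proof -
  have "(\<integral>\<^sup>+x. v x \<partial>M) = (\<integral>\<^sup>+x. liminf (\<lambda>n. u n x) \<partial>M)"
    by (intro nn_integral_cong) (simp add: lim_imp_Liminf[OF _ lim])
  also have "\<dots> \<le> liminf (\<lambda>n. \<integral>\<^sup>+x. u n x \<partial>M)"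
    by (intro nn_integral_liminf) auto
  also have "\<dots> \<le> B"
    using le by (intro Liminf_le) auto
  finally show ?thesis .
qed

text \<open>Fubini for two integrable functions coupled by a bounded kernel. The kernel is an exponential in
  all applications; this is the multiplication formula of Fourier analysis.\<close>

lemma integral_kernel_swap:
  fixes F H :: "real \<Rightarrow> complex" and k :: "real \<Rightarrow> real \<Rightarrow> complex"
  assumes F: "integrable lborel F" and H: "integrable lborel H"
    and k[measurable]: "case_prod k \<in> borel_measurable (borel \<Otimes>\<^sub>M borel)"
    and bound: "\<And>x t. cmod (k x t) \<le> B"
  shows "(CLINT x|lborel. F x * (CLINT t|lborel. k x t * H t))
       = (CLINT t|lborel. H t * (CLINT x|lborel. k x t * F x))"
proof -
  have [measurable]: "F \<in> borel_measurable borel" "H \<in> borel_measurable borel"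
    using F H by auto
  have B: "0 \<le> B" using bound[of 0 0] norm_ge_zero order_trans by blast
  have int: "integrable (lborel \<Otimes>\<^sub>M lborel) (\<lambda>(x, t). F x * (k x t * H t))"
  proof (rule integrableI_bounded)
    show "(\<lambda>(x, t). F x * (k x t * H t)) \<in> borel_measurable (lborel \<Otimes>\<^sub>M lborel)" by measurable
    have "(\<integral>\<^sup>+z. norm (case z of (x, t) \<Rightarrow> F x * (k x t * H t)) \<partial>(lborel \<Otimes>\<^sub>M lborel))
        = (\<integral>\<^sup>+x. \<integral>\<^sup>+t. norm (F x * (k x t * H t)) \<partial>lborel \<partial>lborel)"
      by (subst lborel.nn_integral_fst[symmetric]) auto
    also have "\<dots> \<le> (\<integral>\<^sup>+x. \<integral>\<^sup>+t. ennreal (B * norm (F x)) * ennreal (norm (H t)) \<partial>lborel \<partial>lborel)"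
    proof (intro nn_integral_mono)
      fix x t
      have "cmod (F x * (k x t * H t)) = cmod (k x t) * (cmod (F x) * cmod (H t))"
        by (simp add: norm_mult)
      also have "\<dots> \<le> B * (cmod (F x) * cmod (H t))"
        by (intro mult_right_mono bound) auto
      finally show "ennreal (cmod (F x * (k x t * H t))) \<le> ennreal (B * norm (F x)) * ennreal (norm (H t))"
        using B by (simp add: ennreal_mult[symmetric] mult_ac)
    qed
    also have "\<dots> = (\<integral>\<^sup>+x. ennreal (B * norm (F x)) \<partial>lborel) * (\<integral>\<^sup>+t. ennreal (norm (H t)) \<partial>lborel)"
      by (simp add: nn_integral_cmult nn_integral_multc)
    also have "\<dots> < \<infinity>"
    proof -
have "(\<integral>\<^sup>+x. ennreal (B * norm (F x)) \<partial>lborel) < \<infinity>"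
        using B F by (simp add: integrable_iff_bounded ennreal_mult nn_integral_cmult ennreal_mult_less_top)
      moreover have "(\<integral>\<^sup>+t. ennreal (norm (H t)) \<partial>lborel) < \<infinity>"
        using H by (simp add: integrable_iff_bounded)
      ultimately show ?thesis by (simp add: ennreal_mult_less_top)
    qed
    finally show "(\<integral>\<^sup>+z. norm (case z of (x, t) \<Rightarrow> F x * (k x t * H t)) \<partial>(lborel \<Otimes>\<^sub>M lborel)) < \<infinity>" .
  qed
  have "(CLINT x|lborel. F x * (CLINT t|lborel. k x t * H t))
      = (CLINT x|lborel. CLINT t|lborel. F x * (k x t * H t))"
    by simp
  also have "\<dots> = (CLINT t|lborel. CLINT x|lborel. F x * (k x t * H t))"
    using lborel_pair.Fubini_integral[OF int] by simp
  also have "\<dots> = (CLINT t|lborel. H t * (CLINT x|lborel. k x t * F x))"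
    by (intro Bochner_Integration.integral_cong refl)
      (simp flip: integral_mult_right_zero add: mult_ac)
  finally show ?thesis .
qed

lemma norm_exp_imag [simp]: "cmod (exp (\<i> * complex_of_real a)) = 1"
  by (simp add: norm_exp_eq_Re)

lemma integrable_iexp_mult:
  assumes "integrable lborel G" and [measurable]: "h \<in> borel_measurable borel"
  shows "integrable lborel (\<lambda>t. iexp (h t) * G t)"
proof -
  have [measurable]: "G \<in> borel_measurable borel" using assms by auto
  show ?thesis by (rule Bochner_Integration.integrable_bound[OF assms(1)]) (auto simp: norm_mult)
qed

lemma nn_integral_normal_density: "0 < \<sigma> \<Longrightarrow> (\<integral>\<^sup>+x. ennreal (normal_density \<mu> \<sigma> x) \<partial>lborel) = 1"
  by (subst nn_integral_eq_integral) (auto simp: integral_normal_density)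

lemma ft_normal_density:
  assumes "0 < \<sigma>"
  shows "(CLINT x|lborel. iexp (u * x) * complex_of_real (normal_density 0 \<sigma> x))
    = complex_of_real (exp (- (\<sigma> * u)\<^sup>2 / 2))"
proof -
  have "complex_of_real (exp (- (\<sigma> * u)\<^sup>2 / 2)) = char std_normal_distribution (\<sigma> * u)"
    by (simp add: char_std_normal_distribution)
  also have "\<dots> = (CLINT x|lborel. std_normal_density x *\<^sub>R iexp (\<sigma> * u * x))"
    unfolding char_def by (subst integral_density) auto
  also have "\<dots> = (CLINT x|lborel. (1/\<sigma>) *\<^sub>R (std_normal_density (x/\<sigma>) *\<^sub>R iexp (u * x)))"
    using lborel_integral_real_affine[of "1/\<sigma>" "\<lambda>x. std_normal_density x *\<^sub>R iexp (\<sigma> * u * x)" 0] assms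
    by (simp add: scaleR_conv_of_real)
  also have "\<dots> = (CLINT x|lborel. iexp (u * x) * complex_of_real (normal_density 0 \<sigma> x))"
    using assms
    by (intro Bochner_Integration.integral_cong refl)
     (auto simp: normal_density_def scaleR_conv_of_real real_sqrt_mult power_divide mult_ac)
  finally show ?thesis by simp
qed

lemma nn_integral_lborel_shift:
  fixes f :: "real \<Rightarrow> ennreal"
  assumes [measurable]: "f \<in> borel_measurable borel"
  shows "(\<integral>\<^sup>+x. f (x - a) \<partial>lborel) = (\<integral>\<^sup>+x. f x \<partial>lborel)"
  using nn_integral_real_affine[of f 1 "-a"] by (simp add: algebra_simps)

lemma ennreal_mult_assoc:
  "0 \<le> a \<Longrightarrow> 0 \<le> b \<Longrightarrow> ennreal a * (ennreal b * X) = ennreal (a * b) * X"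
  by (simp add: ennreal_mult mult.assoc)

text \<open>With a Gaussian weight, \<open>\<bar>I\<bar>\<^sup>2\<close> integrates to the quadratic form \<open>\<integral>\<integral> G(t) cnj(G(s)) k(s-t)\<close> whose
  kernel is again Gaussian, of total mass \<open>2 \<pi>\<close> independently of \<open>N\<close>. Bounding
  \<open>\<bar>G(t) G(s)\<bar>\<close> by \<open>(\<bar>G(t)\<bar>\<^sup>2 + \<bar>G(s)\<bar>\<^sup>2) / 2\<close> (Schur's test) finishes the proof. The weight makes the
  triple integral absolutely convergent.\<close>

lemma gaussian_plancherel_bound:
  fixes G :: "real \<Rightarrow> complex"
  assumes G: "integrable lborel G" and N: "0 < N"
  defines "I \<equiv> \<lambda>x. CLINT t|lborel. iexp (- (t * x)) * G t"
  shows "(\<integral>\<^sup>+x. ennreal ((cmod (I x))\<^sup>2 * exp (- (x / N)\<^sup>2 / 2)) \<partial>lborel)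
     \<le> ennreal (2 * pi) * (\<integral>\<^sup>+t. ennreal ((cmod (G t))\<^sup>2) \<partial>lborel)"
proof -
  let ?Q = "\<integral>\<^sup>+t. ennreal ((cmod (G t))\<^sup>2) \<partial>lborel"
  let ?q = "\<lambda>s t. exp (- (N * (s - t))\<^sup>2 / 2)"
  let ?J = "\<lambda>t. CLINT s|lborel. cnj (G s) * complex_of_real (exp (- (N * (s - t))\<^sup>2 / 2))"
  let ?n = "normal_density 0 N"
  let ?k = "\<lambda>u. normal_density 0 (1 / N) u"
  have [measurable]: "G \<in> borel_measurable borel" using G by auto
  have [measurable]: "I \<in> borel_measurable borel"
    unfolding I_def by measurable
  have [measurable]: "(\<lambda>x. cnj (I x)) \<in> borel_measurable borel"
    by (rule borel_measurable_continuous_on[OF continuous_on_cnj]) (auto intro: continuous_intros)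
  have bI: "cmod (I x) \<le> (LINT t|lborel. cmod (G t))" for x
  proof -
    have "cmod (I x) \<le> (LINT t|lborel. cmod (iexp (- (t * x)) * G t))"
      unfolding I_def by (rule integral_norm_bound)
    then show ?thesis by (simp add: norm_mult)
  qed
  have int_n: "integrable lborel (\<lambda>x. complex_of_real (?n x))"
    using N by simp
  have int_cI: "integrable lborel (\<lambda>x. cnj (I x) * complex_of_real (?n x))"
  proof (rule Bochner_Integration.integrable_bound)
    show "integrable lborel (\<lambda>x. (LINT t|lborel. cmod (G t)) * ?n x)"
      using N by simp
    have "(LINT t|lborel. cmod (G t)) \<ge> 0" by simp
    then show "AE x in lborel. cmod (cnj (I x) * complex_of_real (?n x)) \<le> norm ((LINT t|lborel. cmod (G t)) * ?n x)"
      using bI by (auto simp: norm_mult intro!: mult_right_mono)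
  qed auto
  have G': "integrable lborel (\<lambda>t. cnj (G t))" using G by simp
  have cnjI: "cnj (I x) = (CLINT s|lborel. iexp (s * x) * cnj (G s))" for x
  proof -
    have "cnj (I x) = (CLINT t|lborel. cnj (iexp (- (t * x)) * G t))"
      unfolding I_def by (rule Bochner_Integration.integral_cnj[symmetric])
    also have "\<dots> = (CLINT s|lborel. iexp (s * x) * cnj (G s))"
      by (intro Bochner_Integration.integral_cong refl) (simp add: exp_cnj)
    finally show ?thesis .
  qed
  have inner: "(CLINT x|lborel. iexp (- (t * x)) * (cnj (I x) * complex_of_real (?n x)))
     = ?J t" for t
  proof -
    have "(CLINT x|lborel. iexp (- (t * x)) * (cnj (I x) * complex_of_real (?n x)))
       = (CLINT x|lborel. complex_of_real (?n x) * (CLINT s|lborel. iexp ((s - t) * x) * cnj (G s)))"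
    proof (intro Bochner_Integration.integral_cong refl)
      fix x
      have "iexp (- (t * x)) * cnj (I x) = (CLINT s|lborel. iexp ((s - t) * x) * cnj (G s))"
        unfolding cnjI
        by (simp flip: integral_mult_right_zero mult_exp_exp exp_add add: algebra_simps)
      then show "iexp (- (t * x)) * (cnj (I x) * complex_of_real (?n x))
        = complex_of_real (?n x) * (CLINT s|lborel. iexp ((s - t) * x) * cnj (G s))"
        by (metis (no_types, lifting) mult.assoc mult.commute)
    qed
    also have "\<dots> = (CLINT s|lborel. cnj (G s) * (CLINT x|lborel. iexp ((s - t) * x) * complex_of_real (?n x)))"
      by (rule integral_kernel_swap[OF int_n G', where B=1]) auto
    finally show ?thesis unfolding ft_normal_density[OF N] .
  qed
  have eq: "(CLINT x|lborel. cnj (I x) * complex_of_real (?n x) * I x)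
     = (CLINT t|lborel. G t * ?J t)"
  proof -
    have Ix: "(CLINT t|lborel. iexp (- (t * x)) * G t) = I x" for x by (simp only: I_def)
    have "(CLINT x|lborel. cnj (I x) * complex_of_real (?n x) * (CLINT t|lborel. iexp (- (t * x)) * G t))
      = (CLINT t|lborel. G t * (CLINT x|lborel. iexp (- (t * x)) * (cnj (I x) * complex_of_real (?n x))))"
      by (rule integral_kernel_swap[OF int_cI G, where B=1]) auto
    then show ?thesis unfolding Ix inner .
  qed
  have intI2: "integrable lborel (\<lambda>x. (cmod (I x))\<^sup>2 * ?n x)"
  proof (rule Bochner_Integration.integrable_bound)
    show "integrable lborel (\<lambda>x. (LINT t|lborel. cmod (G t))\<^sup>2 * ?n x)"
      using N by simp
    show "AE x in lborel. norm ((cmod (I x))\<^sup>2 * ?n x) \<le> norm ((LINT t|lborel. cmod (G t))\<^sup>2 * ?n x)"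
      using bI by (auto intro!: mult_right_mono power_mono)
  qed measurable
  have nrm: "ennreal (cmod (CLINT t|lborel. f t)) \<le> (\<integral>\<^sup>+t. ennreal (cmod (f t)) \<partial>lborel)"
    for f :: "real \<Rightarrow> complex"
  proof (cases "integrable lborel f")
    case True
    have "ennreal (cmod (CLINT t|lborel. f t)) \<le> ennreal (LINT t|lborel. cmod (f t))"
      by (intro ennreal_leI integral_norm_bound)
    also have "\<dots> = (\<integral>\<^sup>+t. ennreal (cmod (f t)) \<partial>lborel)"
      using True by (subst nn_integral_eq_integral) auto
    finally show ?thesis .
  qed (simp add: not_integrable_integral_eq)
  have k: "?q s t = sqrt (2 * pi) / N * ?k (s - t)" for s t
    using N by (simp add: normal_density_def real_sqrt_divide real_sqrt_mult power_divide power_mult_distrib mult_ac)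
  have "(\<integral>\<^sup>+x. ennreal ((cmod (I x))\<^sup>2 * ?n x) \<partial>lborel) = ennreal (LINT x|lborel. (cmod (I x))\<^sup>2 * ?n x)"
    using intI2 by (subst nn_integral_eq_integral) auto
  also have "(LINT x|lborel. (cmod (I x))\<^sup>2 * ?n x)
     = cmod (complex_of_real (LINT x|lborel. (cmod (I x))\<^sup>2 * ?n x))"
    by (subst norm_of_real, rule abs_of_nonneg[symmetric], rule integral_nonneg_AE) auto
  also have "complex_of_real (LINT x|lborel. (cmod (I x))\<^sup>2 * ?n x)
     = (CLINT x|lborel. cnj (I x) * complex_of_real (?n x) * I x)"
    unfolding integral_complex_of_real[symmetric]
    by (intro Bochner_Integration.integral_cong refl)
      (unfold of_real_mult complex_norm_square, simp only: mult_ac)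
  also have "ennreal (cmod \<dots>) \<le> (\<integral>\<^sup>+t. ennreal (cmod (G t * ?J t)) \<partial>lborel)"
    unfolding eq by (rule nrm)
  also have "\<dots> \<le> (\<integral>\<^sup>+t. \<integral>\<^sup>+s. ennreal (cmod (G t)) * ennreal (cmod (G s) * ?q s t) \<partial>lborel \<partial>lborel)"
  proof (intro nn_integral_mono)
    fix t
    have "ennreal (cmod (G t * ?J t))
      \<le> ennreal (cmod (G t)) * (\<integral>\<^sup>+s. ennreal (cmod (cnj (G s) * complex_of_real (?q s t))) \<partial>lborel)"
      by (simp only: norm_mult[of "G t"] ennreal_mult''[OF norm_ge_zero]) (rule mult_left_mono[OF nrm], simp)
    also have "\<dots> = (\<integral>\<^sup>+s. ennreal (cmod (G t)) * ennreal (cmod (G s) * ?q s t) \<partial>lborel)"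
      by (simp add: nn_integral_cmult norm_mult)
    finally show "ennreal (cmod (G t * ?J t))
      \<le> (\<integral>\<^sup>+s. ennreal (cmod (G t)) * ennreal (cmod (G s) * ?q s t) \<partial>lborel)" .
  qed
  also have "\<dots> \<le> (\<integral>\<^sup>+t. \<integral>\<^sup>+s. ennreal (sqrt (2 * pi) / N / 2) * (ennreal ((cmod (G t))\<^sup>2) * ennreal (?k (s - t))
        + ennreal ((cmod (G s))\<^sup>2) * ennreal (?k (s - t))) \<partial>lborel \<partial>lborel)"
  proof (intro nn_integral_mono)
    fix t s
    have ag: "cmod (G t) * cmod (G s) \<le> ((cmod (G t))\<^sup>2 + (cmod (G s))\<^sup>2) / 2"
      using sum_squares_bound[of "cmod (G t)" "cmod (G s)"] by simp
    have c0: "0 \<le> sqrt (2 * pi) / N * ?k (s - t)" using N by simp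
    have "cmod (G t) * (cmod (G s) * ?q s t)
       = (sqrt (2 * pi) / N * ?k (s - t)) * (cmod (G t) * cmod (G s))"
      unfolding k by (simp add: mult_ac)
    also have "\<dots> \<le> (sqrt (2 * pi) / N * ?k (s - t)) * (((cmod (G t))\<^sup>2 + (cmod (G s))\<^sup>2) / 2)"
      by (rule mult_left_mono[OF ag c0])
    also have "\<dots> = (sqrt (2 * pi) / N / 2) * ((cmod (G t))\<^sup>2 * ?k (s - t) + (cmod (G s))\<^sup>2 * ?k (s - t))"
      by (simp add: algebra_simps add_divide_distrib)
    finally have *: "ennreal (cmod (G t) * (cmod (G s) * ?q s t))
      \<le> ennreal ((sqrt (2 * pi) / N / 2) * ((cmod (G t))\<^sup>2 * ?k (s - t) + (cmod (G s))\<^sup>2 * ?k (s - t)))"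
      by (rule ennreal_leI)
    have L: "ennreal X * ennreal Y = ennreal (X * Y)" if "0 \<le> X" "0 \<le> Y" for X Y
      using that by (simp add: ennreal_mult)
    have E: "ennreal c * (ennreal A * ennreal K + ennreal B * ennreal K) = ennreal (c * (A * K + B * K))"
      if "0 \<le> c" "0 \<le> A" "0 \<le> B" "0 \<le> K" for c A B K
      using that by (simp add: ennreal_mult)
    have p: "0 \<le> cmod (G s) * ?q s t" "0 \<le> sqrt (2 * pi) / N / 2" using N by simp_all
    show "ennreal (cmod (G t)) * ennreal (cmod (G s) * ?q s t)
      \<le> ennreal (sqrt (2 * pi) / N / 2) * (ennreal ((cmod (G t))\<^sup>2) * ennreal (?k (s - t))
        + ennreal ((cmod (G s))\<^sup>2) * ennreal (?k (s - t)))"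
      unfolding L[OF norm_ge_zero p(1)] E[OF p(2) zero_le_power2 zero_le_power2 normal_density_nonneg]
      by (rule *)
  qed
  also have "\<dots> = ennreal (sqrt (2 * pi) / N / 2) *
      ((\<integral>\<^sup>+t. \<integral>\<^sup>+s. ennreal ((cmod (G t))\<^sup>2) * ennreal (?k (s - t)) \<partial>lborel \<partial>lborel)
      + (\<integral>\<^sup>+t. \<integral>\<^sup>+s. ennreal ((cmod (G s))\<^sup>2) * ennreal (?k (s - t)) \<partial>lborel \<partial>lborel))"
    by (simp add: nn_integral_cmult nn_integral_add)
  also have "(\<integral>\<^sup>+t. \<integral>\<^sup>+s. ennreal ((cmod (G t))\<^sup>2) * ennreal (?k (s - t)) \<partial>lborel \<partial>lborel)
     = ?Q"
    using N by (simp add: nn_integral_cmult nn_integral_lborel_shift[where f="\<lambda>u. ennreal (?k u)"] nn_integral_normal_density)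
  also have "(\<integral>\<^sup>+t. \<integral>\<^sup>+s. ennreal ((cmod (G s))\<^sup>2) * ennreal (?k (s - t)) \<partial>lborel \<partial>lborel)
     = (\<integral>\<^sup>+s. \<integral>\<^sup>+t. ennreal ((cmod (G s))\<^sup>2) * ennreal (?k (s - t)) \<partial>lborel \<partial>lborel)"
    by (rule lborel_pair.Fubini') measurable
  also have "\<dots> = (\<integral>\<^sup>+s. \<integral>\<^sup>+t. ennreal ((cmod (G s))\<^sup>2) * ennreal (?k (t - s)) \<partial>lborel \<partial>lborel)"
    by (simp add: normal_density_def power2_commute)
  also have "\<dots> = ?Q"
    using N by (simp add: nn_integral_cmult nn_integral_lborel_shift[where f="\<lambda>u. ennreal (?k u)"] nn_integral_normal_density)
  also have "ennreal (sqrt (2 * pi) / N / 2) * (?Q + ?Q)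
     = ennreal (sqrt (2 * pi) / N) * ?Q" (is "_ * (?A + ?A) = _")
  proof -
    have "?A + ?A = ennreal 2 * ?A" by (simp add: mult_2)
    then show ?thesis using N
      by (simp only:) (subst ennreal_mult_assoc, auto)
  qed
  finally have main: "(\<integral>\<^sup>+x. ennreal ((cmod (I x))\<^sup>2 * ?n x) \<partial>lborel)
    \<le> ennreal (sqrt (2 * pi) / N) * ?Q" .
  have "(\<integral>\<^sup>+x. ennreal ((cmod (I x))\<^sup>2 * exp (- (x / N)\<^sup>2 / 2)) \<partial>lborel)
     = (\<integral>\<^sup>+x. ennreal (sqrt (2 * pi) * N) * ennreal ((cmod (I x))\<^sup>2 * ?n x) \<partial>lborel)"
    using N by (intro nn_integral_cong)
      (simp add: ennreal_mult[symmetric] normal_density_def real_sqrt_mult power_divide)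
  also have "\<dots> = ennreal (sqrt (2 * pi) * N) * (\<integral>\<^sup>+x. ennreal ((cmod (I x))\<^sup>2 * ?n x) \<partial>lborel)"
    by (rule nn_integral_cmult) measurable
  also have "\<dots> \<le> ennreal (sqrt (2 * pi) * N) * (ennreal (sqrt (2 * pi) / N) * ?Q)"
    by (intro mult_left_mono main) auto
  also have "\<dots> = ennreal (2 * pi) * ?Q"
    using N by (subst ennreal_mult_assoc) auto
  finally show ?thesis .
qed

text \<open>Let the width \<open>N\<close> of the Gaussian weight tend to infinity.\<close>

lemma plancherel_le:
  assumes G: "integrable lborel G"
  shows "(\<integral>\<^sup>+x. ennreal ((cmod (inv_ft G x))\<^sup>2) \<partial>lborel)
    \<le> ennreal (1 / (2 * pi)) * (\<integral>\<^sup>+t. ennreal ((cmod (G t))\<^sup>2) \<partial>lborel)"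
proof -
  let ?I = "\<lambda>x. CLINT t|lborel. iexp (- (t * x)) * G t"
  have [measurable]: "G \<in> borel_measurable borel" using G by auto
  have [measurable]: "?I \<in> borel_measurable borel" by measurable
  have "(\<integral>\<^sup>+x. ennreal ((cmod (?I x))\<^sup>2) \<partial>lborel) \<le> ennreal (2 * pi) * (\<integral>\<^sup>+t. ennreal ((cmod (G t))\<^sup>2) \<partial>lborel)"
  proof (rule nn_integral_le_of_tendsto[where u="\<lambda>n x. ennreal ((cmod (?I x))\<^sup>2 * exp (- (x / real (Suc n))\<^sup>2 / 2))"])
    fix x :: real
    have "(\<lambda>n. x / real (Suc n)) \<longlonglongrightarrow> 0"
      using tendsto_mult[OF tendsto_const LIMSEQ_inverse_real_of_nat, of x] by (simp add: divide_inverse)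
    then have "(\<lambda>n. (cmod (?I x))\<^sup>2 * exp (- (x / real (Suc n))\<^sup>2 / 2)) \<longlonglongrightarrow> (cmod (?I x))\<^sup>2 * exp (- 0\<^sup>2 / 2)"
      by (intro tendsto_intros) auto
    then show "(\<lambda>n. ennreal ((cmod (?I x))\<^sup>2 * exp (- (x / real (Suc n))\<^sup>2 / 2))) \<longlonglongrightarrow> ennreal ((cmod (?I x))\<^sup>2)"
      by (intro tendsto_ennrealI) simp
  qed (use gaussian_plancherel_bound[OF G] in auto)
  then have "ennreal (1 / (2 * pi)^2) * (\<integral>\<^sup>+x. ennreal ((cmod (?I x))\<^sup>2) \<partial>lborel)
     \<le> ennreal (1 / (2 * pi)^2) * (ennreal (2 * pi) * (\<integral>\<^sup>+t. ennreal ((cmod (G t))\<^sup>2) \<partial>lborel))"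
    by (rule mult_left_mono) simp
  also have "\<dots> = ennreal (1 / (2 * pi)) * (\<integral>\<^sup>+t. ennreal ((cmod (G t))\<^sup>2) \<partial>lborel)"
    by (subst ennreal_mult_assoc) (auto simp: power2_eq_square)
  also have "ennreal (1 / (2 * pi)^2) * (\<integral>\<^sup>+x. ennreal ((cmod (?I x))\<^sup>2) \<partial>lborel)
     = (\<integral>\<^sup>+x. ennreal ((cmod (inv_ft G x))\<^sup>2) \<partial>lborel)"
    by (subst nn_integral_cmult[symmetric])
      (auto simp: inv_ft_def norm_mult norm_divide power_mult_distrib power_divide ennreal_mult[symmetric] intro!: nn_integral_cong)
  finally show ?thesis .
qed

section \<open>Fourier inversion for densities\<close>

lemma continuous_inv_ft:
  assumes G: "integrable lborel G"
  shows "continuous_on UNIV (inv_ft G)"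
proof -
  have [measurable]: "G \<in> borel_measurable borel" using G by auto
  have "(\<lambda>n. inv_ft G (u n)) \<longlonglongrightarrow> inv_ft G x" if u: "u \<longlonglongrightarrow> x" for u x
    unfolding inv_ft_def
  proof (intro tendsto_mult tendsto_const integral_dominated_convergence)
    show "integrable lborel (\<lambda>t. cmod (G t))" using G by simp
    show "AE t in lborel. (\<lambda>n. iexp (- (t * u n)) * G t) \<longlonglongrightarrow> iexp (- (t * x)) * G t"
      by (intro AE_I2 tendsto_intros u)
  qed (auto simp: norm_mult)
  then show ?thesis
    unfolding continuous_on_sequentially by (auto simp: comp_def)
qed

lemma ft_measurable [measurable]:
  assumes [measurable]: "g \<in> borel_measurable borel"
  shows "ft g \<in> borel_measurable borel"
  unfolding ft_def[abs_def] by measurable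

lemma prob_densityD:
  assumes "prob_density f"
  shows "f \<in> borel_measurable borel" "\<And>x. 0 \<le> f x" "integrable lborel f" "(LINT x|lborel. f x) = 1"
    "(\<integral>\<^sup>+x. ennreal (f x) \<partial>lborel) = 1"
  using assms by (auto simp: prob_density_def has_bochner_integral_iff nn_integral_eq_integral)

lemma real_distribution_density:
  assumes "prob_density f"
  shows "real_distribution (density lborel f)"
proof -
  note f = prob_densityD[OF assms]
  have [measurable]: "f \<in> borel_measurable borel" by (rule f)
  have "prob_space (density lborel f)"
    by (rule prob_spaceI) (simp add: emeasure_density f(5))
  then show ?thesis
    by (intro real_distribution.intro real_distribution_axioms.intro) simp_all
qed

lemma char_density:
  assumes "prob_density f"
  shows "char (density lborel f) t = ft f t"
proof -
  note f = prob_densityD[OF assms]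
  have [measurable]: "f \<in> borel_measurable borel" by (rule f)
  show ?thesis unfolding char_def ft_def
    by (subst integral_density) (auto simp: f scaleR_conv_of_real mult.commute)
qed

lemma continuous_nonneg_of_integral_Icc_nonneg:
  fixes h :: "real \<Rightarrow> real"
  assumes cont: "continuous_on UNIV h"
    and nonneg: "\<And>a b. a < b \<Longrightarrow> 0 \<le> (LINT x|lborel. indicator {a..b} x * h x)"
  shows "0 \<le> h x"
proof (rule ccontr)
  assume "\<not> 0 \<le> h x"
  then have "h x < 0" by simp
  moreover have "isCont h x" using cont by (simp add: continuous_on_eq_continuous_at)
  ultimately obtain d where d: "d > 0" "\<And>y. \<bar>y - x\<bar> < d \<Longrightarrow> \<bar>h y - h x\<bar> < - h x / 2"
    unfolding continuous_at_eps_delta dist_real_def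
    by (metis half_gt_zero neg_0_less_iff_less)
  let ?a = "x" let ?b = "x + d / 2"
  have "(LINT y|lborel. indicator {?a..?b} y * h y) \<le> (LINT y|lborel. indicator {?a..?b} y * (h x / 2))"
  proof (rule integral_mono)
    show "integrable lborel (\<lambda>y. indicator {?a..?b} y * h y)"
      using borel_integrable_atLeastAtMost'[of ?a ?b h] continuous_on_subset[OF cont]
      by (auto simp: set_integrable_def)
    show "indicator {?a..?b} y * h y \<le> indicator {?a..?b} y * (h x / 2)" for y
    proof (cases "y \<in> {?a..?b}")
      case True
      then have "\<bar>y - x\<bar> < d" using d(1) by (auto simp: abs_if)
      from d(2)[OF this] have "h y - h x < - h x / 2" by linarith
      with True show ?thesis by simp
    qed simp
    show "integrable lborel (\<lambda>y. indicator {?a..?b} y * (h x / 2))"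
      by (intro integrable_mult_left integrable_real_indicator) (auto simp: emeasure_lborel_Icc_eq)
  qed
  also have "\<dots> = (d / 2) * (h x / 2)" using d by simp
  also have "\<dots> < 0" using d \<open>h x < 0\<close> by (simp add: mult_pos_neg)
  finally show False using nonneg[of ?a ?b] d by simp
qed

text \<open>Levy's inversion formula for the mass of an interval. Since the transform is integrable, the
  principal value is an absolutely convergent integral, and the quotient in Levy's formula is the
  integral of an exponential over the interval, so that Fubini gives the integral of \<open>inv_ft\<close>.\<close>

lemma measure_Icc_inv_ft:
  assumes f: "prob_density f" and int: "integrable lborel (ft f)" and ab: "a < b"
  shows "(CLINT x|lborel. indicator {a..b} x * inv_ft (ft f) x)
    = complex_of_real (measure (density lborel f) {a<..b})"
proof -
  note fD = prob_densityD[OF f]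
  have [measurable]: "f \<in> borel_measurable borel" by (rule fD)
  interpret M: real_distribution "density lborel f" by (rule real_distribution_density[OF f])
  let ?\<phi> = "ft f"
  let ?F = "\<lambda>t. (iexp (-(t * a)) - iexp (-(t * b))) / (\<i> * t)"
  have null: "measure (density lborel f) {c} = 0" for c
  proof -
    have "{c} \<in> null_sets (density lborel f)"
    proof -
      have "AE x in lborel. x \<in> {c} \<longrightarrow> ennreal (f x) = 0"
        using AE_lborel_singleton[of c] by eventually_elim simp
      then show ?thesis by (simp add: null_sets_density_iff)
    qed
    then show ?thesis by (simp add: measure_def null_setsD1)
  qed
  have charf: "char (density lborel f) = ?\<phi>" using char_density[OF f] by auto
  have inner: "(CLINT x|lborel. iexp (- (t * x)) * indicator {a..b} x) = ?F t" if "t \<noteq> 0" for t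
  proof -
    have "(CLINT x|lborel. indicator {a..b} x *\<^sub>R iexp (- (t * x)))
       = \<i> * iexp (- (t * b)) / t - \<i> * iexp (- (t * a)) / t"
    proof (rule integral_FTC_Icc[where F="\<lambda>x. \<i> * iexp (- (t * x)) / t"])
      fix x :: real
      have "((\<lambda>z. \<i> * exp (\<i> * (- (t * z))) / t) has_field_derivative exp (\<i> * (- (t * of_real x)))) (at (of_real x))"
        using that by (auto intro!: derivative_eq_intros simp: field_simps)
      from has_vector_derivative_real_field[OF this]
      show "((\<lambda>x. \<i> * iexp (- (t * x)) / t) has_vector_derivative iexp (- (t * x))) (at x within {a..b})"
        by simp
    qed (use ab in \<open>auto intro!: continuous_intros\<close>)
    also have "\<dots> = ?F t"
    proof -
      have "X / (\<i> * t) = - \<i> * X / t" for X using that by (simp add: field_simps)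
      then show ?thesis by (simp add: diff_divide_distrib right_diff_distrib)
    qed
    finally show ?thesis
      by (simp add: scaleR_conv_of_real of_real_indicator mult.commute)
  qed
  have Fb: "cmod (?F t) \<le> b - a" for t
    using Levy_Inversion_aux2[of "-b" "-a" t] ab
    by (cases "t = 0") auto
  have L1: "(\<lambda>T. 1 / (2 * pi) * (CLBINT t=- real T..real T. ?F t * ?\<phi> t)) \<longlonglongrightarrow> measure (density lborel f) {a<..b}"
    using M.Levy_Inversion[of a b] ab null charf by simp
  have L2: "(\<lambda>T. 1 / (2 * pi) * (CLBINT t=- real T..real T. ?F t * ?\<phi> t)) \<longlonglongrightarrow> 1 / (2 * pi) * (CLINT t|lborel. ?F t * ?\<phi> t)"
  proof (intro tendsto_mult tendsto_const)
    have "(\<lambda>T. CLINT t|lborel. indicator {- real T..real T} t *\<^sub>R (?F t * ?\<phi> t)) \<longlonglongrightarrow> (CLINT t|lborel. ?F t * ?\<phi> t)"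
    proof (rule integral_dominated_convergence)
      show "integrable lborel (\<lambda>t. (b - a) * cmod (?\<phi> t))" using int by simp
      show "AE t in lborel. (\<lambda>T. indicator {- real T..real T} t *\<^sub>R (?F t * ?\<phi> t)) \<longlonglongrightarrow> ?F t * ?\<phi> t"
      proof (intro AE_I2 tendsto_eventually)
        fix t :: real
        show "\<forall>\<^sub>F T in sequentially. indicator {- real T..real T} t *\<^sub>R (?F t * ?\<phi> t) = ?F t * ?\<phi> t"
          using eventually_ge_at_top[of "nat \<lceil>\<bar>t\<bar>\<rceil>"]
          by eventually_elim (auto simp: indicator_def abs_le_iff nat_le_iff ceiling_le_iff)
      qed
      show "AE t in lborel. cmod (indicator {- real T..real T} t *\<^sub>R (?F t * ?\<phi> t)) \<le> (b - a) * cmod (?\<phi> t)" for T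
      proof (intro AE_I2)
        fix t
        have "cmod (indicator {- real T..real T} t *\<^sub>R (?F t * ?\<phi> t)) \<le> cmod (?F t) * cmod (?\<phi> t)"
          unfolding norm_scaleR norm_mult by (cases "t \<in> {- real T..real T}") auto
        also have "\<dots> \<le> (b - a) * cmod (?\<phi> t)"
          by (intro mult_right_mono Fb) auto
        finally show "cmod (indicator {- real T..real T} t *\<^sub>R (?F t * ?\<phi> t)) \<le> (b - a) * cmod (?\<phi> t)" .
      qed
    qed auto
    then show "(\<lambda>T. CLBINT t=- real T..real T. ?F t * ?\<phi> t) \<longlonglongrightarrow> (CLINT t|lborel. ?F t * ?\<phi> t)"
      by (subst interval_integral_Icc) (auto simp: set_lebesgue_integral_def)
  qed
  have int_ind: "integrable lborel (\<lambda>x. indicator {a..b} x :: complex)"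
    using integrable_of_real[where 'a=complex, of lborel "indicator {a..b} :: real \<Rightarrow> real"]
    by (simp add: of_real_indicator emeasure_lborel_Icc_eq)
  have "(CLINT x|lborel. indicator {a..b} x * (CLINT t|lborel. iexp (- (t * x)) * ?\<phi> t))
     = (CLINT t|lborel. ?\<phi> t * (CLINT x|lborel. iexp (- (t * x)) * indicator {a..b} x))"
    by (rule integral_kernel_swap[OF int_ind int, where B=1]) auto
  also have "\<dots> = (CLINT t|lborel. ?F t * ?\<phi> t)"
  proof (rule integral_cong_AE)
    show "AE t in lborel. ?\<phi> t * (CLINT x|lborel. iexp (- (t * x)) * indicator {a..b} x) = ?F t * ?\<phi> t"
      using AE_lborel_singleton[of 0]
    proof eventually_elim
      case (elim t)
      show ?case by (simp only: inner[OF elim]) (rule mult.commute)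
    qed
  qed auto
  finally have "(CLINT x|lborel. indicator {a..b} x * inv_ft ?\<phi> x) = 1 / (2 * pi) * (CLINT t|lborel. ?F t * ?\<phi> t)"
    by (simp only: inv_ft_def mult.left_commute[of "indicator _ _"] integral_mult_right_zero)
  also have "\<dots> = measure (density lborel f) {a<..b}"
    using LIMSEQ_unique[OF L2 L1] by simp
  finally show ?thesis .
qed

text \<open>By continuity, the inverse transform inherits nonnegativity from the masses of intervals; the
  same argument applied to both signs of the imaginary part shows that it is real.\<close>

lemma inv_ft_ft_nonneg:
  assumes f: "prob_density f" and int: "integrable lborel (ft f)"
  shows "0 \<le> Re (inv_ft (ft f) x)" "Im (inv_ft (ft f) x) = 0"
proof -
  let ?g = "inv_ft (ft f)"
  have cont: "continuous_on UNIV ?g" by (rule continuous_inv_ft[OF int])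
  have I: "integrable lborel (\<lambda>x. indicator {a..b} x * ?g x)" for a b
    using borel_integrable_atLeastAtMost'[of a b ?g] continuous_on_subset[OF cont]
    by (auto simp: set_integrable_def scaleR_conv_of_real of_real_indicator)
  have re: "(LINT x|lborel. indicator {a..b} x * Re (?g x)) = measure (density lborel f) {a<..b}"
    and im: "(LINT x|lborel. indicator {a..b} x * Im (?g x)) = 0" if "a < b" for a b
  proof -
    have "Re (indicator {a..b} x * ?g x) = indicator {a..b} x * Re (?g x)"
      "Im (indicator {a..b} x * ?g x) = indicator {a..b} x * Im (?g x)" for x
      by (auto simp: indicator_def)
    note * = this[symmetric]
    show "(LINT x|lborel. indicator {a..b} x * Re (?g x)) = measure (density lborel f) {a<..b}"
      "(LINT x|lborel. indicator {a..b} x * Im (?g x)) = 0"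
      unfolding * integral_Re[OF I] integral_Im[OF I] measure_Icc_inv_ft[OF f int that] by simp_all
  qed
  show "0 \<le> Re (?g x)"
    by (rule continuous_nonneg_of_integral_Icc_nonneg[of "\<lambda>x. Re (?g x)"])
      (simp_all add: re continuous_on_Re[OF cont])
  have "0 \<le> Im (?g x)"
    by (rule continuous_nonneg_of_integral_Icc_nonneg[of "\<lambda>x. Im (?g x)"])
      (simp_all add: im continuous_on_Im[OF cont] continuous_on_minus)
  moreover have "0 \<le> - Im (?g x)"
    by (rule continuous_nonneg_of_integral_Icc_nonneg[of "\<lambda>x. - Im (?g x)"])
      (simp_all add: im continuous_on_Im[OF cont] continuous_on_minus)
  ultimately show "Im (?g x) = 0" by simp
qed

text \<open>The density and its inverted transform define the same measure, because they give the same
  mass to every interval.\<close>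

lemma inv_ft_ft_AE:
  assumes f: "prob_density f" and int: "integrable lborel (ft f)"
  shows "AE x in lborel. inv_ft (ft f) x = complex_of_real (f x)"
proof -
  note fD = prob_densityD[OF f]
  have [measurable]: "f \<in> borel_measurable borel" by (rule fD)
  let ?g = "inv_ft (ft f)"
  let ?h = "\<lambda>x. Re (?g x)"
  interpret M: real_distribution "density lborel f" by (rule real_distribution_density[OF f])
  have cont: "continuous_on UNIV ?g" by (rule continuous_inv_ft[OF int])
  have conth: "continuous_on UNIV ?h" by (intro continuous_intros cont)
  have [measurable]: "?h \<in> borel_measurable borel"
    by (rule borel_measurable_continuous_onI[OF conth])
  have h0: "0 \<le> ?h x" for x using inv_ft_ft_nonneg[OF f int] by simp
  have geq: "?g x = complex_of_real (?h x)" for x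
    using inv_ft_ft_nonneg(2)[OF f int] by (simp add: complex_eq_iff)
  have Ioc: "emeasure (density lborel ?h) {a<..b} = emeasure (density lborel f) {a<..b}" if ab: "a < b" for a b
  proof -
    have I: "integrable lborel (\<lambda>x. indicator {a..b} x * ?h x)"
      using borel_integrable_atLeastAtMost'[of a b ?h] continuous_on_subset[OF conth]
      by (auto simp: set_integrable_def)
    have "emeasure (density lborel ?h) {a<..b} = (\<integral>\<^sup>+x. ennreal (?h x) * indicator {a<..b} x \<partial>lborel)"
      by (simp add: emeasure_density)
    also have "\<dots> = (\<integral>\<^sup>+x. ennreal (indicator {a..b} x * ?h x) \<partial>lborel)"
      proof (rule nn_integral_cong_AE)
        show "AE x in lborel. ennreal (?h x) * indicator {a<..b} x = ennreal (indicator {a..b} x * ?h x)"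
          using AE_lborel_singleton[of a] by eventually_elim (simp add: indicator_def)
      qed
    also have "\<dots> = ennreal (LINT x|lborel. indicator {a..b} x * ?h x)"
      by (rule nn_integral_eq_integral[OF I]) (auto simp: h0)
    also have "(LINT x|lborel. indicator {a..b} x * ?h x) = measure (density lborel f) {a<..b}"
    proof -
      have "complex_of_real (LINT x|lborel. indicator {a..b} x * ?h x)
        = (CLINT x|lborel. indicator {a..b} x * ?g x)"
        unfolding integral_complex_of_real[symmetric]
        by (intro Bochner_Integration.integral_cong refl) (subst (2) geq, simp add: of_real_indicator)
      then show ?thesis using measure_Icc_inv_ft[OF f int ab] by simp
    qed
    finally show ?thesis by (simp add: M.emeasure_eq_measure)
  qed
  have "density lborel f = density lborel ?h"
  proof (rule measure_eqI_lessThan)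
    fix x :: real
    show "emeasure (density lborel f) {x<..} < \<infinity>" by (simp add: M.emeasure_eq_measure)
    have un: "{x<..} = (\<Union>n::nat. {x<..x + real (Suc n)})"
    proof (intro equalityI subsetI)
      fix y assume "y \<in> {x<..}"
      moreover obtain n :: nat where "y - x \<le> real n" using real_arch_simple by blast
      ultimately have "y \<in> {x<..x + real (Suc n)}" by simp
      then show "y \<in> (\<Union>n::nat. {x<..x + real (Suc n)})" by blast
    qed auto
    have inc: "incseq (\<lambda>n. {x<..x + real (Suc n)})" by (auto simp: incseq_def)
    show "emeasure (density lborel f) {x<..} = emeasure (density lborel ?h) {x<..}"

    proof -
      have "emeasure N {x<..} = (SUP n. emeasure N {x<..x + real (Suc n)})"
        if N: "sets N = sets borel" for N :: "real measure"
      proof -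
        have "(SUP n. emeasure N {x<..x + real (Suc n)}) = emeasure N (\<Union>n. {x<..x + real (Suc n)})"
          by (rule SUP_emeasure_incseq[OF _ inc]) (simp add: N image_subset_iff)
        then show ?thesis using un by metis
      qed
      note * = this[of "density lborel f", simplified sets_density sets_lborel, OF refl]
        this[of "density lborel ?h", simplified sets_density sets_lborel, OF refl]
      show ?thesis unfolding * by (intro SUP_cong refl Ioc[symmetric]) simp
    qed
  qed auto
  then have "AE x in lborel. ennreal (f x) = ennreal (?h x)"
    by (intro sigma_finite_measure.density_unique[OF lborel.sigma_finite_measure_axioms]) auto
  then show ?thesis
  proof eventually_elim
    case (elim x)
    then have "?h x = f x" using h0[of x] fD(2)[of x] by (simp add: ennreal_inj)
    with geq[of x] show ?case by simp
  qed
qed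

section \<open>The Fejer kernel and its modulations\<close>

definition triangle :: "real \<Rightarrow> real" where "triangle t = max 0 (1 - \<bar>t\<bar>)"

text \<open>The Fejer kernel \<open>(1 - cos x) / (\<pi> x\<^sup>2)\<close>, the inverse transform of the triangle function. The
  removable singularity at \<open>0\<close> is taken care of by \<open>sinc\<close>.\<close>

definition fejer :: "real \<Rightarrow> real" where "fejer x = (sinc (x / 2))\<^sup>2 / (2 * pi)"

text \<open>Modulation shifts the transform of the Fejer kernel to the bands around \<open>c\<close> and \<open>- c\<close>.\<close>

definition wave :: "real \<Rightarrow> real \<Rightarrow> real" where "wave c x = cos (c * x) * fejer x"

text \<open>The Fejer kernel vanishes at the nonzero multiples of \<open>2 \<pi>\<close>. Shifting by \<open>\<pi>\<close> exchanges the
  sine in its numerator with the cosine, so the average of the two is bounded below by a multiple of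
  \<open>1 / (1 + x\<^sup>2)\<close> while the support of the transform stays \<open>[-1,1]\<close>.\<close>

definition base_density :: "real \<Rightarrow> real" where "base_density x = (fejer x + fejer (x - pi)) / 2"

lemma tri_simps: "0 \<le> triangle t" "triangle t \<le> 1" "triangle (- t) = triangle t" "triangle 0 = 1"
  by (auto simp: triangle_def)

lemma tri_eq_0: "1 \<le> \<bar>t\<bar> \<Longrightarrow> triangle t = 0"
  by (auto simp: triangle_def)

lemma tri_lipschitz: "\<bar>triangle s - triangle t\<bar> \<le> \<bar>s - t\<bar>"
  by (auto simp: triangle_def)

lemma continuous_tri: "continuous_on UNIV triangle"
  unfolding triangle_def[abs_def] by (intro continuous_intros)

lemma tri_measurable [measurable]: "triangle \<in> borel_measurable borel"
  by (rule borel_measurable_continuous_onI[OF continuous_tri])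

text \<open>The point \<open>0\<close> belongs to both intervals, hence the exception; it is a null set.\<close>

lemma tri_split:
  assumes "x \<noteq> 0"
  shows "complex_of_real (triangle x) * z = indicator {-1..0} x *\<^sub>R ((1 + of_real x) * z) + indicator {0..1} x *\<^sub>R ((1 - of_real x) * z)"
  using assms by (auto simp: triangle_def indicator_def max_def abs_if)

lemma has_integral_tri_iexp:
  assumes "t \<noteq> 0"
  shows "has_bochner_integral lborel (\<lambda>x. complex_of_real (triangle x) * iexp (t * x)) ((2 - iexp t - iexp (- t)) / t\<^sup>2)"
proof -
  have 1: "has_bochner_integral lborel (\<lambda>x. indicator {0..1} x *\<^sub>R ((1 - of_real x) * iexp (t * x)))
     (((1 - of_real 1) * iexp (t * 1) / (\<i> * t) - iexp (t * 1) / t\<^sup>2) - ((1 - of_real 0) * iexp (t * 0) / (\<i> * t) - iexp (t * 0) / t\<^sup>2))"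
  proof (rule has_bochner_integral_FTC_Icc[where F="\<lambda>x. (1 - of_real x) * iexp (t * x) / (\<i> * t) - iexp (t * x) / t\<^sup>2"])
    fix x :: real
    have "((\<lambda>z. (1 - z) * exp (\<i> * (t * z)) / (\<i> * t) - exp (\<i> * (t * z)) / t\<^sup>2) has_field_derivative (1 - of_real x) * exp (\<i> * (t * of_real x))) (at (of_real x))"
      using assms by (auto intro!: derivative_eq_intros simp: field_simps power2_eq_square)
    from has_vector_derivative_real_field[OF this]
    show "((\<lambda>x. (1 - of_real x) * iexp (t * x) / (\<i> * t) - iexp (t * x) / t\<^sup>2) has_vector_derivative ((1 - of_real x) * iexp (t * x))) (at x within {0..1})"
      by simp
  qed (auto intro!: continuous_intros)
  have 2: "has_bochner_integral lborel (\<lambda>x. indicator {-1..0} x *\<^sub>R ((1 + of_real x) * iexp (t * x)))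
     (((1 + of_real 0) * iexp (t * 0) / (\<i> * t) + iexp (t * 0) / t\<^sup>2) - ((1 + of_real (-1)) * iexp (t * (-1)) / (\<i> * t) + iexp (t * (-1)) / t\<^sup>2))"
  proof (rule has_bochner_integral_FTC_Icc[where F="\<lambda>x. (1 + of_real x) * iexp (t * x) / (\<i> * t) + iexp (t * x) / t\<^sup>2"])
    fix x :: real
    have "((\<lambda>z. (1 + z) * exp (\<i> * (t * z)) / (\<i> * t) + exp (\<i> * (t * z)) / t\<^sup>2) has_field_derivative (1 + of_real x) * exp (\<i> * (t * of_real x))) (at (of_real x))"
      using assms by (auto intro!: derivative_eq_intros simp: field_simps power2_eq_square)
    from has_vector_derivative_real_field[OF this]
    show "((\<lambda>x. (1 + of_real x) * iexp (t * x) / (\<i> * t) + iexp (t * x) / t\<^sup>2) has_vector_derivative ((1 + of_real x) * iexp (t * x))) (at x within {-1..0})"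
      by simp
  qed (auto intro!: continuous_intros)
  have "has_bochner_integral lborel (\<lambda>x. complex_of_real (triangle x) * iexp (t * x))
     ((((1 + of_real 0) * iexp (t * 0) / (\<i> * t) + iexp (t * 0) / t\<^sup>2) - ((1 + of_real (-1)) * iexp (t * (-1)) / (\<i> * t) + iexp (t * (-1)) / t\<^sup>2))
      + (((1 - of_real 1) * iexp (t * 1) / (\<i> * t) - iexp (t * 1) / t\<^sup>2) - ((1 - of_real 0) * iexp (t * 0) / (\<i> * t) - iexp (t * 0) / t\<^sup>2)))"
  proof (rule has_bochner_integral_cong_AE[THEN iffD1, OF _ _ _ has_bochner_integral_add[OF 2 1]])
    show "AE x in lborel. indicator {- 1..0} x *\<^sub>R ((1 + of_real x) * iexp (t * x)) +
         indicator {0..1} x *\<^sub>R ((1 - of_real x) * iexp (t * x)) = complex_of_real (triangle x) * iexp (t * x)"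
      using AE_lborel_singleton[of 0] by eventually_elim (rule tri_split[symmetric])
  qed auto
  also have "((((1 + of_real 0) * iexp (t * 0) / (\<i> * t) + iexp (t * 0) / t\<^sup>2) - ((1 + of_real (-1)) * iexp (t * (-1)) / (\<i> * t) + iexp (t * (-1)) / t\<^sup>2))
      + (((1 - of_real 1) * iexp (t * 1) / (\<i> * t) - iexp (t * 1) / t\<^sup>2) - ((1 - of_real 0) * iexp (t * 0) / (\<i> * t) - iexp (t * 0) / t\<^sup>2)))
     = (2 - iexp t - iexp (- t)) / t\<^sup>2"
    by (simp add: diff_divide_distrib)
  finally show ?thesis .
qed

lemma has_integral_tri: "has_bochner_integral lborel triangle 1"
proof -
  have 1: "has_bochner_integral lborel (\<lambda>x. indicator {0..1} x *\<^sub>R (1 - x)) ((1 - 1\<^sup>2 / 2) - (0 - 0\<^sup>2 / 2) :: real)"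
    by (rule has_bochner_integral_FTC_Icc[where F="\<lambda>x. x - x\<^sup>2 / 2"])
      (auto intro!: derivative_eq_intros continuous_intros simp flip: has_real_derivative_iff_has_vector_derivative)
  have 2: "has_bochner_integral lborel (\<lambda>x. indicator {-1..0} x *\<^sub>R (1 + x)) ((0 + 0\<^sup>2 / 2) - ((-1) + (-1)\<^sup>2 / 2) :: real)"
    by (rule has_bochner_integral_FTC_Icc[where F="\<lambda>x. x + x\<^sup>2 / 2"])
      (auto intro!: derivative_eq_intros continuous_intros simp flip: has_real_derivative_iff_has_vector_derivative)
  have "has_bochner_integral lborel triangle (((0 + 0\<^sup>2 / 2) - ((-1) + (-1)\<^sup>2 / 2)) + ((1 - 1\<^sup>2 / 2) - (0 - 0\<^sup>2 / 2)) :: real)"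
  proof (rule has_bochner_integral_cong_AE[THEN iffD1, OF _ _ _ has_bochner_integral_add[OF 2 1]])
    show "AE x in lborel. indicator {- 1..0} x *\<^sub>R (1 + x) + indicator {0..1} x *\<^sub>R (1 - x) = triangle x"
      using AE_lborel_singleton[of 0] by eventually_elim (auto simp: triangle_def indicator_def)
  qed auto
  then show ?thesis by simp
qed

lemma prob_density_tri: "prob_density triangle"
  by (simp add: prob_density_def tri_simps has_integral_tri)

lemma integrable_tri: "integrable lborel triangle"
  using has_integral_tri by (simp add: has_bochner_integral_iff)

lemma ft_tri: "ft triangle t = complex_of_real (2 * pi * fejer t)"
proof (cases "t = 0")
  case True
  then show ?thesis
    using has_integral_tri by (simp add: ft_def fejer_def has_bochner_integral_iff)
next
  case False
  have "ft triangle t = (2 - iexp t - iexp (- t)) / t\<^sup>2"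
    using has_integral_tri_iexp[OF False] by (simp add: ft_def has_bochner_integral_iff mult.commute)
  also have "2 - iexp t - iexp (- t) = complex_of_real (4 * (sin (t / 2))\<^sup>2)"
    using cos_double_sin[of "t / 2"] by (simp add: complex_eq_iff Re_exp Im_exp)
  also have "\<dots> / t\<^sup>2 = complex_of_real (2 * pi * fejer t)"
    using False by (simp add: fejer_def power_divide flip: of_real_power of_real_divide of_real_mult)
  finally show ?thesis .
qed

lemma fejer_nonneg: "0 \<le> fejer x"
  by (simp add: fejer_def)

lemma fejer_minus: "fejer (- x) = fejer x"
  by (simp add: fejer_def)

lemma continuous_fejer: "continuous_on UNIV fejer"
  unfolding fejer_def[abs_def] by (intro continuous_intros) auto

lemma fejer_measurable [measurable]: "fejer \<in> borel_measurable borel"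
  by (rule borel_measurable_continuous_onI[OF continuous_fejer])

lemma sinc_sq_upper: "(sinc u)\<^sup>2 * (1 + u\<^sup>2) \<le> 2"
proof (cases "u = 0")
  case False
  have "(sin u)\<^sup>2 \<le> u\<^sup>2" using abs_sin_x_le_abs_x[of u] by (simp add: abs_le_square_iff)
  moreover have "(sin u)\<^sup>2 \<le> 1" by (simp add: abs_square_le_1)
  ultimately show ?thesis using False
    by (simp add: power_divide field_simps) (smt (verit) mult_left_le zero_le_power2)
qed simp

lemma sinc_sq_lower: "(sin u)\<^sup>2 \<le> (sinc u)\<^sup>2 * (1 + u\<^sup>2)"
  by (cases "u = 0") (auto simp: power_divide field_simps)

lemma fejer_le: "fejer x \<le> 4 * inverse (1 + x\<^sup>2)"
proof -
  have p: "0 < 1 + x\<^sup>2" by (simp add: add_pos_nonneg)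
  define s where "s = (sinc (x / 2))\<^sup>2"
  have s: "s * (1 + (x/2)\<^sup>2) \<le> 2" "0 \<le> s"
    unfolding s_def by (rule sinc_sq_upper, rule zero_le_power2)
  have "s * (1 + x\<^sup>2) \<le> s * (4 * (1 + (x/2)\<^sup>2))"
    by (intro mult_left_mono s) (auto simp: power_divide)
  also have "\<dots> = 4 * (s * (1 + (x/2)\<^sup>2))" by (simp only: mult.left_commute)
  also have "\<dots> \<le> 8" using s(1) by linarith
  finally have "s \<le> 8 * inverse (1 + x\<^sup>2)"
    using p by (simp add: field_simps)
  moreover have "fejer x \<le> s / 2"
    unfolding fejer_def s_def using pi_gt3 by (intro divide_left_mono) auto
  ultimately show ?thesis by simp
qed

lemma integrable_inverse_1_plus_square_UNIV: "integrable lborel (\<lambda>x::real. inverse (1 + x\<^sup>2))"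
  using integrable_inverse_1_plus_square by (simp add: set_integrable_def einterval_def)

lemma integrable_fejer: "integrable lborel fejer"
  by (rule Bochner_Integration.integrable_bound[where f="\<lambda>x. 4 * inverse (1 + x\<^sup>2)"])
    (auto simp: integrable_inverse_1_plus_square_UNIV fejer_nonneg fejer_le)

lemma continuous_AE_eq:
  fixes f g :: "real \<Rightarrow> complex"
  assumes "continuous_on UNIV f" "continuous_on UNIV g" "AE x in lborel. f x = g x"
  shows "f x = g x"
proof (rule ccontr)
  assume ne: "f x \<noteq> g x"
  let ?U = "{y. f y \<noteq> g y}"
  have "open ?U" by (rule open_Collect_neq[OF assms(1,2)])
  moreover have "?U \<in> null_sets lborel"
  proof -
    have "?U \<in> sets lborel" using \<open>open ?U\<close> by simp
    then show ?thesis by (subst AE_iff_null_sets) (use assms(3) in auto)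
  qed
  ultimately show False using ne open_not_negligible[of ?U]
    by (auto simp: negligible_iff_null_sets null_sets_completionI)
qed

text \<open>Obtained from \<open>ft_tri\<close> by Fourier inversion of the triangle density, not by integration.
  Inversion holds almost everywhere; continuity of both sides extends it to every point, including
  \<open>t = 0\<close>, which gives the total mass of the Fejer kernel.\<close>

lemma ft_fejer: "ft fejer t = complex_of_real (triangle t)"
proof -
  have int: "integrable lborel (ft triangle)"
    unfolding ft_tri using integrable_fejer by simp
  have "inv_ft (ft triangle) (- t) = complex_of_real (triangle (- t))"
    by (rule continuous_AE_eq[OF continuous_inv_ft[OF int] _ inv_ft_ft_AE[OF prob_density_tri int]])
      (intro continuous_intros continuous_tri)
  moreover have "inv_ft (ft triangle) (- t) = ft fejer t"
    unfolding inv_ft_def ft_def[of fejer] ft_tri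
    by (simp add: mult_ac flip: integral_mult_right_zero)
  ultimately show ?thesis by (simp add: tri_simps)
qed

lemma prob_density_fejer: "prob_density fejer"
proof -
  have "complex_of_real (LINT x|lborel. fejer x) = ft fejer 0"
    by (simp add: ft_def)
  also have "\<dots> = 1" by (simp add: ft_fejer tri_simps)
  finally have "(LINT x|lborel. fejer x) = 1" by simp
  then show ?thesis
    by (simp add: prob_density_def fejer_nonneg has_bochner_integral_iff integrable_fejer)
qed

lemma fejer_eq_inv_ft: "complex_of_real (fejer x) = inv_ft (\<lambda>t. complex_of_real (triangle t)) x"
proof -
  have "inv_ft (\<lambda>t. complex_of_real (triangle t)) x = 1 / (2 * pi) * ft triangle (- x)"
    by (simp add: inv_ft_def ft_def mult_ac)
  then show ?thesis by (simp add: ft_tri fejer_minus)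
qed

lemma iexp_cos: "complex_of_real (cos a) = (iexp a + iexp (- a)) / 2"
  by (simp add: complex_eq_iff Re_exp Im_exp)

lemma ft_wave: "ft (wave c) t = complex_of_real ((triangle (t + c) + triangle (t - c)) / 2)"
proof -
  have i: "integrable lborel (\<lambda>x. iexp (s * x) * complex_of_real (fejer x))" for s
    by (rule integrable_iexp_mult) (use integrable_fejer in auto)
  have "ft (wave c) t = (CLINT x|lborel. (1/2) * (iexp ((t + c) * x) * complex_of_real (fejer x)) + (1/2) * (iexp ((t - c) * x) * complex_of_real (fejer x)))"
    unfolding ft_def wave_def of_real_mult iexp_cos
    by (intro Bochner_Integration.integral_cong refl)
      (simp add: field_simps flip: exp_add)
  also have "\<dots> = (1/2) * ft fejer (t + c) + (1/2) * ft fejer (t - c)"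
    unfolding ft_def
    by (subst Bochner_Integration.integral_add[OF integrable_mult_right[OF i] integrable_mult_right[OF i]])
      (simp only: integral_mult_right_zero)
  finally show ?thesis by (simp add: ft_fejer add_divide_distrib)
qed

lemma wave_measurable [measurable]: "wave c \<in> borel_measurable borel"
  unfolding wave_def[abs_def] by measurable

lemma abs_wave_le: "\<bar>wave c x\<bar> \<le> fejer x"
  by (simp add: wave_def abs_mult fejer_nonneg mult_left_le_one_le)

lemma integrable_wave: "integrable lborel (wave c)"
  by (rule Bochner_Integration.integrable_bound[OF integrable_fejer])
    (use abs_wave_le fejer_nonneg in auto)

lemma fejer_le_4: "fejer x \<le> 4"
proof -
  have "inverse (1 + x\<^sup>2) \<le> 1" by (simp add: inverse_le_1_iff)
  then show ?thesis using fejer_le[of x] by linarith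
qed

lemma integrable_mult_fejer:
  assumes [measurable]: "h \<in> borel_measurable borel" and "\<And>x. \<bar>h x\<bar> \<le> B"
  shows "integrable lborel (\<lambda>x. h x * fejer x)"
proof (rule Bochner_Integration.integrable_bound)
  show "integrable lborel (\<lambda>x. B * fejer x)" using integrable_fejer by simp
  show "AE x in lborel. norm (h x * fejer x) \<le> norm (B * fejer x)"
    using assms(2) fejer_nonneg
    by (auto simp: abs_mult intro!: mult_right_mono order_trans[OF assms(2) abs_ge_self])
qed measurable

text \<open>The transform of \<open>fejer\<^sup>2\<close> is a multiple of the convolution of the triangle with itself, which
  vanishes outside \<open>(-2,2)\<close>. The multiplication formula shows this without computing that
  convolution: the integrand becomes a product of triangles with disjoint supports.\<close>

lemma integral_cos_fejer_sq:
  assumes "2 \<le> \<bar>c\<bar>"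
  shows "(LINT x|lborel. cos (c * x) * fejer x * fejer x) = 0"
proof -
  have "complex_of_real (LINT x|lborel. cos (c * x) * fejer x * fejer x)
    = (CLINT x|lborel. complex_of_real (wave c x) * complex_of_real (fejer x))"
    by (simp flip: integral_complex_of_real add: wave_def)
  also have "\<dots> = (CLINT x|lborel. (1 / (2 * pi)) * (complex_of_real (wave c x) * (CLINT t|lborel. iexp (- (t * x)) * complex_of_real (triangle t))))"
    unfolding fejer_eq_inv_ft inv_ft_def by (intro Bochner_Integration.integral_cong refl) (simp only: mult.left_commute)
  also have "\<dots> = (1 / (2 * pi)) * (CLINT x|lborel. complex_of_real (wave c x) * (CLINT t|lborel. iexp (- (t * x)) * complex_of_real (triangle t)))"
    by (rule integral_mult_right_zero)
  also have "(CLINT x|lborel. complex_of_real (wave c x) * (CLINT t|lborel. iexp (- (t * x)) * complex_of_real (triangle t)))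
    = (CLINT t|lborel. complex_of_real (triangle t) * (CLINT x|lborel. iexp (- (t * x)) * complex_of_real (wave c x)))"
    by (rule integral_kernel_swap[where B=1]) (use integrable_wave integrable_tri in auto)
  also have "\<dots> = 0"
  proof -
    have "complex_of_real (triangle t) * (CLINT x|lborel. iexp (- (t * x)) * complex_of_real (wave c x)) = 0" for t
    proof -
    have "(CLINT x|lborel. iexp (- (t * x)) * complex_of_real (wave c x)) = ft (wave c) (- t)"
      by (simp add: ft_def)
    also have "complex_of_real (triangle t) * \<dots> = complex_of_real (triangle t * ((triangle (- t + c) + triangle (- t - c)) / 2))"
      by (simp only: ft_wave of_real_mult)
    also have "triangle t * ((triangle (- t + c) + triangle (- t - c)) / 2) = 0"
      using assms by (auto simp: triangle_def max_def abs_if split: if_splits)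
    finally show ?thesis by simp
    qed
    then show ?thesis by (simp only: Bochner_Integration.integral_zero)
  qed
  finally show ?thesis by simp
qed

text \<open>The common squared \<open>L\<^sub>2\<close> norm of the functions \<open>wave (2 j)\<close>, \<open>j \<ge> 1\<close>.\<close>

definition wave_sq :: real where "wave_sq = (LINT x|lborel. fejer x * fejer x) / 2"

lemma wave_sq_pos: "0 < wave_sq"
proof -
  have i: "integrable lborel (\<lambda>x. fejer x * fejer x)"
    by (rule integrable_mult_fejer[where B=4]) (auto simp: fejer_nonneg fejer_le_4)
  have "(LINT x|lborel. fejer x * fejer x) \<noteq> 0"
  proof
    assume "(LINT x|lborel. fejer x * fejer x) = 0"
    then have "AE x in lborel. fejer x * fejer x = 0"
      by (subst (asm) integral_nonneg_eq_0_iff_AE[OF i]) auto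
    then have "AE x in lborel. fejer x = 0" by eventually_elim simp
    then have "(LINT x|lborel. fejer x) = 0"
      by (subst integral_cong_AE[where g="\<lambda>_. 0"]) auto
    then show False using prob_densityD(4)[OF prob_density_fejer] by simp
  qed
  moreover have "0 \<le> (LINT x|lborel. fejer x * fejer x)" by (rule integral_nonneg_AE) auto
  ultimately show ?thesis unfolding wave_sq_def by linarith
qed

lemma integrable_wave_mult: "integrable lborel (\<lambda>x. wave a x * wave b x)"
proof -
  have "\<bar>wave a x * cos (b * x)\<bar> \<le> 4" for x
  proof -
    have "\<bar>wave a x * cos (b * x)\<bar> \<le> \<bar>wave a x\<bar>"
      unfolding abs_mult by (rule mult_left_le[OF abs_cos_le_one abs_ge_zero])
    then show ?thesis using abs_wave_le[of a x] fejer_le_4[of x] by linarith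
  qed
  from integrable_mult_fejer[OF _ this] show ?thesis
    by (simp add: wave_def[of b] mult.assoc)
qed

lemma integral_wave_mult:
  assumes "1 \<le> j" "1 \<le> k"
  shows "(LINT x|lborel. wave (2 * real j) x * wave (2 * real k) x) = (if j = k then wave_sq else 0)"
proof -
  have i: "integrable lborel (\<lambda>x. cos (c * x) * fejer x * fejer x)" for c
    by (rule integrable_mult_fejer[where B=4])
      (use order_trans[OF abs_wave_le[unfolded wave_def] fejer_le_4] in auto)
  have "(LINT x|lborel. wave (2 * real j) x * wave (2 * real k) x)
    = (LINT x|lborel. (cos ((2 * real j - 2 * real k) * x) * fejer x * fejer x) / 2 + (cos ((2 * real j + 2 * real k) * x) * fejer x * fejer x) / 2)"
    by (intro Bochner_Integration.integral_cong refl)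
      (simp add: wave_def cos_add cos_diff left_diff_distrib distrib_right, simp add: field_simps)
  also have "\<dots> = (LINT x|lborel. (cos ((2 * real j - 2 * real k) * x) * fejer x * fejer x)) / 2 + (LINT x|lborel. (cos ((2 * real j + 2 * real k) * x) * fejer x * fejer x)) / 2"
    using i by (subst Bochner_Integration.integral_add) auto
  also have "(LINT x|lborel. (cos ((2 * real j + 2 * real k) * x) * fejer x * fejer x)) = 0"
    using assms by (intro integral_cos_fejer_sq) auto
  also have "(LINT x|lborel. (cos ((2 * real j - 2 * real k) * x) * fejer x * fejer x)) = (if j = k then 2 * wave_sq else 0)"
  proof (cases "j = k")
    case False
    then have "2 \<le> \<bar>2 * real j - 2 * real k\<bar>" by (cases "j < k") auto
    then show ?thesis using False by (simp add: integral_cos_fejer_sq)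
  qed (simp add: wave_sq_def)
  finally show ?thesis by (cases "j = k") simp_all
qed

lemma base_ge_fejer: "fejer x / 2 \<le> base_density x"
  using fejer_nonneg[of "x - pi"] by (simp add: base_density_def)

lemma base_measurable [measurable]: "base_density \<in> borel_measurable borel"
  unfolding base_density_def[abs_def] by measurable

lemma base_nonneg: "0 \<le> base_density x"
  by (simp add: base_density_def fejer_nonneg)

lemma integrable_base: "integrable lborel base_density"
  and integral_base: "(LINT x|lborel. base_density x) = 1"
proof -
  have 1: "has_bochner_integral lborel fejer 1"
    using prob_density_fejer by (simp add: prob_density_def)
  have 2: "has_bochner_integral lborel (\<lambda>x. fejer (x - pi)) 1"
    using lborel_has_bochner_integral_real_affine_iff[of 1 fejer 1 "-pi"] 1 by simp
  have "has_bochner_integral lborel (\<lambda>x. (fejer x + fejer (x - pi)) / 2) ((1 + 1) / 2)"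
    by (intro has_bochner_integral_divide has_bochner_integral_add 1 2)
  then show "integrable lborel base_density" "(LINT x|lborel. base_density x) = 1"
    by (simp_all add: base_density_def[abs_def] has_bochner_integral_iff)
qed

lemma ft_base_le: "cmod (ft base_density t) \<le> triangle t"
proof -
  have i: "integrable lborel (\<lambda>x. iexp (t * x) * complex_of_real (fejer x))"
    by (rule integrable_iexp_mult) (use integrable_fejer in auto)
  have sh: "(CLINT x|lborel. iexp (t * x) * complex_of_real (fejer (x - pi))) = iexp (t * pi) * ft fejer t"
    "integrable lborel (\<lambda>x. iexp (t * x) * complex_of_real (fejer (x - pi)))"
  proof -
    have "(CLINT x|lborel. iexp (t * x) * complex_of_real (fejer (x - pi)))
      = (CLINT x|lborel. iexp (t * (pi + 1 * x)) * complex_of_real (fejer (pi + 1 * x - pi)))"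
      by (subst lborel_integral_real_affine[where c=1 and t=pi]) auto
    also have "\<dots> = iexp (t * pi) * ft fejer t"
      unfolding ft_def by (simp add: distrib_left exp_add mult.assoc)
    finally show "(CLINT x|lborel. iexp (t * x) * complex_of_real (fejer (x - pi))) = iexp (t * pi) * ft fejer t" .
    have "integrable lborel (\<lambda>x. fejer (x - pi))"
      using lborel_integrable_real_affine[OF integrable_fejer, of 1 "-pi"] by simp
    then show "integrable lborel (\<lambda>x. iexp (t * x) * complex_of_real (fejer (x - pi)))"
      by (intro integrable_iexp_mult) auto
  qed
  have "ft base_density t = (CLINT x|lborel. (1/2) * (iexp (t * x) * complex_of_real (fejer x)) + (1/2) * (iexp (t * x) * complex_of_real (fejer (x - pi))))"
    unfolding ft_def base_density_def by (intro Bochner_Integration.integral_cong refl) (simp add: field_simps)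
  also have "\<dots> = (1/2) * ft fejer t + (1/2) * (iexp (t * pi) * ft fejer t)"
    using i sh by (subst Bochner_Integration.integral_add) (auto simp: ft_def)
  also have "cmod \<dots> \<le> cmod ((1/2) * ft fejer t) + cmod ((1/2) * (iexp (t * pi) * ft fejer t))"
    by (rule norm_triangle_ineq)
  also have "\<dots> = triangle t"
    unfolding norm_mult ft_fejer norm_exp_imag norm_of_real using tri_simps(1)[of t] by simp
  finally show ?thesis .
qed

text \<open>With \<open>u = x / 2\<close> and \<open>v = u - \<pi> / 2\<close> one has \<open>(sin u)\<^sup>2 + (sin v)\<^sup>2 = 1\<close>, while both \<open>1 + u\<^sup>2\<close> and
  \<open>1 + v\<^sup>2\<close> are at most \<open>9 * (1 + x\<^sup>2)\<close>.\<close>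

lemma base_lower: "1 / (36 * pi) * inverse (1 + x\<^sup>2) \<le> base_density x"
proof -
  let ?u = "x / 2" and ?v = "(x - pi) / 2"
  have p: "0 < 1 + x\<^sup>2" by (simp add: add_pos_nonneg)
  have pi4: "pi\<^sup>2 \<le> 16" using pi_less_4 power_mono[of pi 4 2] by simp
  have u: "1 + ?u\<^sup>2 \<le> 9 * (1 + x\<^sup>2)" by (simp add: power_divide)
  have le: "(x - pi)\<^sup>2 \<le> 2 * x\<^sup>2 + 2 * pi\<^sup>2"
    using zero_le_power2[of "x + pi"] by (simp add: power2_sum power2_diff)
  then have v: "1 + ?v\<^sup>2 \<le> 9 * (1 + x\<^sup>2)"
  proof -
    have sq: "4 * ?v\<^sup>2 = (x - pi)\<^sup>2" by (simp add: power_divide)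
    have arith: "1 + a \<le> 9 * (1 + X)" if "4 * a = b" "b \<le> 2 * X + 2 * P" "P \<le> 16" "0 \<le> X"
      for a b X P :: real
      using that by argo
    show ?thesis by (rule arith[OF sq le pi4 zero_le_power2])
  qed
  have "(sin ?v)\<^sup>2 = (cos ?u)\<^sup>2"
    by (simp add: diff_divide_distrib sin_diff)
  then have "1 = (sin ?u)\<^sup>2 + (sin ?v)\<^sup>2" by simp
  also have "\<dots> \<le> (sinc ?u)\<^sup>2 * (1 + ?u\<^sup>2) + (sinc ?v)\<^sup>2 * (1 + ?v\<^sup>2)"
    by (intro add_mono sinc_sq_lower)
  also have "\<dots> \<le> (sinc ?u)\<^sup>2 * (9 * (1 + x\<^sup>2)) + (sinc ?v)\<^sup>2 * (9 * (1 + x\<^sup>2))"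
    by (intro add_mono mult_left_mono u v) auto
  also have "\<dots> = 36 * pi * (1 + x\<^sup>2) * base_density x"
  proof -
    have "s * Q + r * Q = 4 * pi * Q * ((s / (2 * pi) + r / (2 * pi)) / 2)" for s r Q :: real
      by (simp add: field_simps)
    from this[of "(sinc ?u)\<^sup>2" "9 * (1 + x\<^sup>2)" "(sinc ?v)\<^sup>2"] show ?thesis
      unfolding base_density_def fejer_def by (simp only: mult_ac) (simp add: mult_ac)
  qed
  finally have "1 \<le> 36 * pi * (1 + x\<^sup>2) * base_density x" .
  moreover have "0 < 36 * pi * (1 + x\<^sup>2)" using p by simp
  ultimately have "1 / (36 * pi * (1 + x\<^sup>2)) \<le> base_density x"
    by (subst pos_divide_le_eq) (simp_all add: mult.commute)
  moreover have "1 / (36 * pi) * inverse (1 + x\<^sup>2) = 1 / (36 * pi * (1 + x\<^sup>2))"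
    by (simp only: divide_inverse inverse_mult_distrib mult_1_left mult.assoc)
  ultimately show ?thesis by (simp only:)
qed

section \<open>The law of the observations\<close>

lemma prob_space_density_lborel: "prob_density f \<Longrightarrow> prob_space (density lborel f)"
  using real_distribution_density real_distribution.axioms(1) by blast

lemma obs_measurable [measurable]:
  assumes f: "prob_density f" and e: "\<And>j. prob_density (e j)"
  shows "obs n \<in> measurable (model n e f) (Pi\<^sub>M {1..n} (\<lambda>_. borel))"
proof -
  have "(\<lambda>s. \<lambda>j\<in>{1..n}. fst s j + snd s j) \<in> measurable
    ((\<Pi>\<^sub>M j\<in>{1..n}. (borel :: real measure)) \<Otimes>\<^sub>M (\<Pi>\<^sub>M j\<in>{1..n}. (borel :: real measure))) (Pi\<^sub>M {1..n} (\<lambda>_. borel))"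
    by (intro measurable_restrict borel_measurable_add)
      (auto intro!: measurable_compose[OF measurable_fst measurable_component_singleton]
        measurable_compose[OF measurable_snd measurable_component_singleton])
  also have "measurable ((\<Pi>\<^sub>M j\<in>{1..n}. (borel :: real measure)) \<Otimes>\<^sub>M (\<Pi>\<^sub>M j\<in>{1..n}. (borel :: real measure))) (Pi\<^sub>M {1..n} (\<lambda>_. borel))
    = measurable (model n e f) (Pi\<^sub>M {1..n} (\<lambda>_. borel))"
    unfolding model_def
    by (intro measurable_cong_sets refl sets_pair_measure_cong sets_PiM_cong) auto
  finally show ?thesis unfolding obs_def[abs_def] .
qed

lemma prob_space_convolution:
  assumes f: "prob_density f" and e: "prob_density e"
  shows "prob_space (density lborel f \<star> density lborel e)"
  unfolding convolution_def
  by (intro prob_space.prob_space_distr prob_space_pair prob_space_density_lborel f e) simp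

text \<open>The joint law of the observations is a product of convolutions. The
  indicator of a box is a product over the coordinates, so its integral over the two product spaces
  factorises twice.\<close>

lemma distr_obs:
  assumes f: "prob_density f" and e: "\<And>j. prob_density (e j)"
  shows "distr (model n e f) (Pi\<^sub>M {1..n} (\<lambda>_. borel)) (obs n)
    = (\<Pi>\<^sub>M j\<in>{1..n}. density lborel f \<star> density lborel (e j))"
proof -
  let ?X = "density lborel f" and ?E = "\<lambda>j. density lborel (e j)"
  have fm: "finite_measure ?X" "\<And>j. finite_measure (?E j)"
    using prob_space_density_lborel f e by (auto intro: prob_space.finite_measure)
  interpret X: product_prob_space "\<lambda>_. ?X" "{1..n}"
    by (intro product_prob_spaceI prob_space_density_lborel f)
  interpret E: product_prob_space ?E "{1..n}"
    by (intro product_prob_spaceI prob_space_density_lborel e)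
  interpret Y: product_prob_space "\<lambda>j. ?X \<star> ?E j" "{1..n}"
    by (intro product_prob_spaceI prob_space_convolution f e)
  note [measurable] = obs_measurable[OF f e]
  show ?thesis
  proof (rule Y.PiM_eqI)
    show "sets (distr (model n e f) (Pi\<^sub>M {1..n} (\<lambda>_. borel)) (obs n)) = sets (Pi\<^sub>M {1..n} (\<lambda>j. ?X \<star> ?E j))"
      by (simp cong: sets_PiM_cong)
    fix A assume "\<And>j. j \<in> {1..n} \<Longrightarrow> A j \<in> sets (?X \<star> ?E j)"
    then have A[measurable]: "\<And>j. j \<in> {1..n} \<Longrightarrow> A j \<in> sets borel" by simp
    have box: "Pi\<^sub>E {1..n} A \<in> sets (Pi\<^sub>M {1..n} (\<lambda>_. borel))"
      by (intro sets_PiM_I_finite) (auto simp: A)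
    let ?g = "\<lambda>x y. \<Prod>j\<in>{1..n}. indicator (A j) (x j + y j) :: ennreal"
    have gm: "(\<lambda>s. ?g (fst s) (snd s)) \<in> borel_measurable ((\<Pi>\<^sub>M j\<in>{1..n}. ?X) \<Otimes>\<^sub>M (\<Pi>\<^sub>M j\<in>{1..n}. ?E j))"
    proof (intro borel_measurable_prod_ennreal)
      fix j assume j: "j \<in> {1..n}"
      have "(\<lambda>s. fst s j + snd s j) \<in> borel_measurable ((\<Pi>\<^sub>M j\<in>{1..n}. ?X) \<Otimes>\<^sub>M (\<Pi>\<^sub>M j\<in>{1..n}. ?E j))"
        using j by (intro borel_measurable_add measurable_compose[OF measurable_fst] measurable_compose[OF measurable_snd])
          (auto intro: measurable_component_singleton[of _ _ "\<lambda>_. ?X", simplified] measurable_component_singleton[of _ _ ?E, simplified])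
      from measurable_compose[OF this borel_measurable_indicator[OF A[OF j]]]
      show "(\<lambda>s. indicator (A j) (fst s j + snd s j)) \<in> borel_measurable ((\<Pi>\<^sub>M j\<in>{1..n}. ?X) \<Otimes>\<^sub>M (\<Pi>\<^sub>M j\<in>{1..n}. ?E j))"
        by simp
    qed
    have "emeasure (distr (model n e f) (Pi\<^sub>M {1..n} (\<lambda>_. borel)) (obs n)) (Pi\<^sub>E {1..n} A)
      = (\<integral>\<^sup>+s. indicator (Pi\<^sub>E {1..n} A) (obs n s) \<partial>model n e f)"
    proof -
      have "emeasure (distr (model n e f) (Pi\<^sub>M {1..n} (\<lambda>_. borel)) (obs n)) (Pi\<^sub>E {1..n} A)
        = (\<integral>\<^sup>+y. indicator (Pi\<^sub>E {1..n} A) y \<partial>distr (model n e f) (Pi\<^sub>M {1..n} (\<lambda>_. borel)) (obs n))"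
        by (rule nn_integral_indicator[symmetric]) (use box in \<open>simp only: sets_distr\<close>)
      also have "\<dots> = (\<integral>\<^sup>+s. indicator (Pi\<^sub>E {1..n} A) (obs n s) \<partial>model n e f)"
        by (rule nn_integral_distr[OF obs_measurable[OF f e]]) (use box in \<open>simp only: sets_distr borel_measurable_indicator\<close>)
      finally show ?thesis .
    qed
    also have "\<dots> = (\<integral>\<^sup>+s. ?g (fst s) (snd s) \<partial>model n e f)"
    proof (intro nn_integral_cong)
      fix s
      have "(\<Prod>j\<in>{1..n}. indicator (A j) (fst s j + snd s j) :: ennreal) = (if \<forall>j\<in>{1..n}. fst s j + snd s j \<in> A j then 1 else 0)"
      proof (cases "\<forall>j\<in>{1..n}. fst s j + snd s j \<in> A j")
        case False
        then obtain j where "j \<in> {1..n}" "indicator (A j) (fst s j + snd s j) = (0 :: ennreal)"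
          by (auto simp: indicator_def)
        then have "(\<Prod>j\<in>{1..n}. indicator (A j) (fst s j + snd s j) :: ennreal) = 0"
          by (intro prod_zero) blast+
        with False show ?thesis by (simp only: if_False)
      qed (simp add: prod.neutral)
      then show "indicator (Pi\<^sub>E {1..n} A) (obs n s) = ?g (fst s) (snd s)"
        by (auto simp: obs_def indicator_def PiE_iff)
    qed
    also have "\<dots> = (\<integral>\<^sup>+x. \<integral>\<^sup>+y. ?g x y \<partial>(\<Pi>\<^sub>M j\<in>{1..n}. ?E j) \<partial>(\<Pi>\<^sub>M j\<in>{1..n}. ?X))"
      unfolding model_def by (subst E.nn_integral_fst[OF gm, symmetric]) simp
    also have "\<dots> = (\<integral>\<^sup>+x. (\<Prod>j\<in>{1..n}. \<integral>\<^sup>+y. indicator (A j) (x j + y) \<partial>?E j) \<partial>(\<Pi>\<^sub>M j\<in>{1..n}. ?X))"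
      by (intro nn_integral_cong E.product_nn_integral_prod) auto
    also have "\<dots> = (\<Prod>j\<in>{1..n}. \<integral>\<^sup>+x. \<integral>\<^sup>+y. indicator (A j) (x + y) \<partial>?E j \<partial>?X)"
    proof (rule X.product_nn_integral_prod)
      fix j assume j[measurable]: "j \<in> {1..n}"
      interpret Ej: prob_space "?E j" by (intro prob_space_density_lborel e)
      note [measurable] = A[OF j]
      show "(\<lambda>x. \<integral>\<^sup>+y. indicator (A j) (x + y) \<partial>?E j) \<in> borel_measurable ?X"
        by measurable
    qed simp
    also have "\<dots> = (\<Prod>j\<in>{1..n}. emeasure (?X \<star> ?E j) (A j))"
      by (intro prod.cong refl convolution_emeasure'[symmetric] A fm) auto
    finally show "emeasure (distr (model n e f) (Pi\<^sub>M {1..n} (\<lambda>_. borel)) (obs n)) (Pi\<^sub>E {1..n} A)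
      = (\<Prod>j\<in>{1..n}. emeasure (?X \<star> ?E j) (A j))" .
  qed simp
qed

lemma model_cong:
  assumes "\<And>j. j \<in> {1..n} \<Longrightarrow> e j = e' j"
  shows "model n e f = model n e' f"
  unfolding model_def by (intro arg_cong2[where f=pair_measure] PiM_cong refl) (simp add: assms)

text \<open>The risk and the estimator see the error densities only for indices in \<open>{1..n}\<close>. This allows one to
  replace them by a family of densities indexed by all natural numbers, as product measures
  require.\<close>

lemma risk_cong:
  assumes "\<And>j. j \<in> {1..n} \<Longrightarrow> e j = e' j"
  shows "risk n e f g = risk n e' f g"
  using model_cong[of n e e' f] assms by (simp add: risk_def)

lemma fhat_cong:
  assumes "\<And>j. j \<in> {1..n} \<Longrightarrow> e j = e' j"
  shows "fhat n e Kft w = fhat n e' Kft w"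
proof -
  have "Psi n e y t = Psi n e' y t" for y t
    unfolding Psi_def
    by (intro arg_cong2[where f="(/)"] arg_cong[where f=complex_of_real] sum.cong refl) (simp_all only: assms)
  then show ?thesis unfolding fhat_def[abs_def] by simp
qed

lemma nn_integral_obs:
  assumes f: "prob_density f" and e: "\<And>j. prob_density (e j)"
    and "h \<in> borel_measurable (Pi\<^sub>M {1..n} (\<lambda>_. borel))"
  shows "(\<integral>\<^sup>+s. h (obs n s) \<partial>model n e f)
    = (\<integral>\<^sup>+y. h y \<partial>(\<Pi>\<^sub>M j\<in>{1..n}. density lborel f \<star> density lborel (e j)))"
  unfolding distr_obs[OF f e, symmetric]
  by (rule nn_integral_distr[symmetric, OF obs_measurable[OF f e]]) (simp only: measurable_distr_eq1 assms(3))

lemma ft_convolution: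
  assumes f: "prob_density f" and e: "prob_density e"
  shows "(CLINT y|density lborel f \<star> density lborel e. iexp (t * y)) = ft f t * ft e t"
proof -
  let ?X = "density lborel f" and ?E = "density lborel e"
  interpret X: prob_space ?X by (rule prob_space_density_lborel[OF f])
  interpret E: prob_space ?E by (rule prob_space_density_lborel[OF e])
  interpret XE: pair_prob_space ?X ?E ..
  have int: "integrable (?X \<Otimes>\<^sub>M ?E) (\<lambda>(x, y). iexp (t * (x + y)))"
    by (rule XE.integrable_const_bound[where B=1]) (auto simp: split_beta')
  have "(CLINT y|?X \<star> ?E. iexp (t * y)) = (CLINT z|?X \<Otimes>\<^sub>M ?E. (case z of (x, y) \<Rightarrow> iexp (t * (x + y))))"
    unfolding convolution_def by (subst integral_distr) (auto simp: split_beta')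
  also have "\<dots> = (CLINT x|?X. CLINT y|?E. iexp (t * (x + y)))"
    using XE.integral_fst'[OF int] by simp
  also have "\<dots> = (CLINT x|?X. iexp (t * x)) * (CLINT y|?E. iexp (t * y))"
    by (simp add: distrib_left exp_add)
  also have "\<dots> = char ?X t * char ?E t" by (simp add: char_def)
  finally show ?thesis by (simp only: char_density[OF f] char_density[OF e])
qed

text \<open>Variances of independent centred variables add: in the expansion of the square, the mixed terms
  factorise into means.\<close>

lemma second_moment_indep_sum:
  fixes Z :: "nat \<Rightarrow> real \<Rightarrow> complex"
  assumes P: "\<And>j. prob_space (M j)" and I: "finite I"
    and Z[measurable]: "\<And>j. Z j \<in> borel_measurable (M j)"
    and bd: "\<And>j x. cmod (Z j x) \<le> B"
    and mean: "\<And>j. j \<in> I \<Longrightarrow> (CLINT x|M j. Z j x) = 0"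
  shows "(\<integral>\<^sup>+y. ennreal ((cmod (\<Sum>j\<in>I. Z j (y j)))\<^sup>2) \<partial>Pi\<^sub>M I M)
    = ennreal (\<Sum>j\<in>I. LINT x|M j. (cmod (Z j x))\<^sup>2)"
proof -
  interpret M: product_prob_space M I by (intro product_prob_spaceI P)
  have PP: "prob_space (Pi\<^sub>M I M)" by (rule prob_space_PiM) (rule P)
  have B0: "0 \<le> B" using bd[of 0 undefined] norm_ge_zero order_trans by blast
  have intZ: "integrable (M j) (Z j)" for j
    by (rule finite_measure.integrable_const_bound[OF prob_space.finite_measure[OF P], where B=B])
      (auto simp: bd)
  have comp: "(\<lambda>y. Z j (y j)) \<in> borel_measurable (Pi\<^sub>M I M)" if "j \<in> I" for j
    by (rule measurable_compose[OF measurable_component_singleton[OF that] Z])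
  have cross: "(CLINT y|Pi\<^sub>M I M. Z j (y j) * cnj (Z k (y k)))
      = (if j = k then complex_of_real (LINT x|M j. (cmod (Z j x))\<^sup>2) else 0)"
    and icross: "integrable (Pi\<^sub>M I M) (\<lambda>y. Z j (y j) * cnj (Z k (y k)))"
    if jk: "j \<in> I" "k \<in> I" for j k
  proof -
    \<comment> \<open>the mixed term as a product over all coordinates, with factor \<open>1\<close> except at \<open>j\<close> and \<open>k\<close>\<close>
    let ?h = "\<lambda>i x. (if i = j then Z j x else 1) * (if i = k then cnj (Z k x) else 1)"
    have hm: "?h i \<in> borel_measurable (M i)" for i
    proof -
      have "(\<lambda>x. cnj (Z k x)) \<in> borel_measurable (M k)" for k
        using borel_measurable_continuous_on[OF continuous_on_cnj[OF continuous_on_id] Z] by simp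
      then show ?thesis using Z by (cases "i = j"; cases "i = k") simp_all
    qed
    have ih: "integrable (M i) (?h i)" for i
    proof (rule finite_measure.integrable_const_bound[OF prob_space.finite_measure[OF P], where B="(max 1 B) * (max 1 B)"])
      show "AE x in M i. cmod (?h i x) \<le> max 1 B * max 1 B"
        unfolding norm_mult using bd B0
        by (intro AE_I2 mult_mono) (auto simp: le_max_iff_disj)
    qed (rule hm)
    have pr: "(\<Prod>i\<in>I. ?h i (y i)) = Z j (y j) * cnj (Z k (y k))" for y
      using jk I by (simp add: prod.distrib prod.delta)
    show "integrable (Pi\<^sub>M I M) (\<lambda>y. Z j (y j) * cnj (Z k (y k)))"
      using M.product_integrable_prod[OF I ih] by (simp only: pr)
    have "(CLINT y|Pi\<^sub>M I M. Z j (y j) * cnj (Z k (y k))) = (\<Prod>i\<in>I. CLINT x|M i. ?h i x)"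
      using M.product_integral_prod[OF I ih] by (simp only: pr)
    also have "\<dots> = (if j = k then complex_of_real (LINT x|M j. (cmod (Z j x))\<^sup>2) else 0)"
    proof (cases "j = k")
      case True
      have "(\<Prod>i\<in>I. CLINT x|M i. ?h i x) = (\<Prod>i\<in>I. if i = j then (CLINT x|M j. complex_of_real ((cmod (Z j x))\<^sup>2)) else 1)"
        by (intro prod.cong refl) (use True M.prob_space in \<open>auto simp: complex_norm_square prob_space.prob_space[OF P] simp del: of_real_power\<close>)
      then show ?thesis using True jk I by (simp add: prod.delta flip: integral_complex_of_real)
    next
      case False
      have "(CLINT x|M j. ?h j x) = 0" using mean[OF jk(1)] False by simp
      then have "(\<Prod>i\<in>I. CLINT x|M i. ?h i x) = 0"
        by (intro prod_zero I bexI[OF _ jk(1)])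
      with False show ?thesis by (simp only: if_False)
    qed
    finally show "(CLINT y|Pi\<^sub>M I M. Z j (y j) * cnj (Z k (y k)))
      = (if j = k then complex_of_real (LINT x|M j. (cmod (Z j x))\<^sup>2) else 0)" .
  qed
  have expand: "complex_of_real ((cmod (\<Sum>j\<in>I. Z j (y j)))\<^sup>2) = (\<Sum>j\<in>I. \<Sum>k\<in>I. Z j (y j) * cnj (Z k (y k)))" for y
    unfolding complex_norm_square by (simp add: sum_product)
  have "complex_of_real (LINT y|Pi\<^sub>M I M. (cmod (\<Sum>j\<in>I. Z j (y j)))\<^sup>2)
    = (CLINT y|Pi\<^sub>M I M. (\<Sum>j\<in>I. \<Sum>k\<in>I. Z j (y j) * cnj (Z k (y k))))"
    unfolding expand[symmetric] by (rule integral_complex_of_real[symmetric])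
  also have "\<dots> = (\<Sum>j\<in>I. \<Sum>k\<in>I. CLINT y|Pi\<^sub>M I M. Z j (y j) * cnj (Z k (y k)))"
    by (subst Bochner_Integration.integral_sum; (intro sum.cong refl Bochner_Integration.integral_sum Bochner_Integration.integrable_sum icross)?) auto
  also have "\<dots> = (\<Sum>j\<in>I. complex_of_real (LINT x|M j. (cmod (Z j x))\<^sup>2))"
    by (intro sum.cong refl) (simp add: cross I sum.delta cong: if_cong)
  finally have eq: "(LINT y|Pi\<^sub>M I M. (cmod (\<Sum>j\<in>I. Z j (y j)))\<^sup>2) = (\<Sum>j\<in>I. LINT x|M j. (cmod (Z j x))\<^sup>2)"
    by (simp only: of_real_sum[symmetric] of_real_eq_iff)
  have "integrable (Pi\<^sub>M I M) (\<lambda>y. (cmod (\<Sum>j\<in>I. Z j (y j)))\<^sup>2)"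
  proof (rule finite_measure.integrable_const_bound[OF prob_space.finite_measure[OF PP], where B="(real (card I) * B)\<^sup>2"])
    show "AE y in Pi\<^sub>M I M. norm ((cmod (\<Sum>j\<in>I. Z j (y j)))\<^sup>2) \<le> (real (card I) * B)\<^sup>2"
      by (intro AE_I2) (auto intro!: power_mono sum_norm_le[of I _ "\<lambda>_. B", simplified] bd)
    show "(\<lambda>y. (cmod (\<Sum>j\<in>I. Z j (y j)))\<^sup>2) \<in> borel_measurable (Pi\<^sub>M I M)"
      by (intro borel_measurable_power borel_measurable_norm[THEN measurable_compose[rotated]] borel_measurable_sum comp)
  qed
  then show ?thesis
    unfolding eq[symmetric] by (intro nn_integral_eq_integral) auto
qed

section \<open>Risk of the deconvolution estimator\<close>

text \<open>Keep the index set \<open>{1..n}\<close> in the form in which the model is stated.\<close>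

declare One_nat_def [simp del]

lemma cmod_ft_le_1:
  assumes "prob_density f"
  shows "cmod (ft f t) \<le> 1"
  using real_distribution.cmod_char_le_1[OF real_distribution_density[OF assms]]
  by (simp add: char_density[OF assms])

lemma ft_uminus: "ft g (- t) = cnj (ft g t)"
proof -
  have "cnj (ft g t) = (CLINT x|lborel. cnj (iexp (t * x) * complex_of_real (g x)))"
    unfolding ft_def by (rule Bochner_Integration.integral_cnj[symmetric])
  also have "\<dots> = ft g (- t)"
    unfolding ft_def by (intro Bochner_Integration.integral_cong refl) (simp add: exp_cnj)
  finally show ?thesis by simp
qed

lemma powr_square: "(t\<^sup>2) powr b = \<bar>t\<bar> powr (2 * b)" if "t \<noteq> 0" for t b :: real
proof -
  have "t\<^sup>2 = \<bar>t\<bar> powr 2" using that by simp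
  then show ?thesis by (simp only: powr_powr)
qed

lemma nn_integral_powr_tail:
  assumes "1 < p"
  shows "(\<integral>\<^sup>+t. ennreal (t powr (- p)) * indicator {1..} t \<partial>lborel) = ennreal (1 / (p - 1))"
proof -
  have lim: "((\<lambda>t. (- 1 / (p - 1)) * t powr (1 - p)) \<longlongrightarrow> (- 1 / (p - 1)) * 0) at_top"
    using assms by (intro tendsto_intros tendsto_neg_powr filterlim_ident) auto
  have "(\<integral>\<^sup>+t. ennreal (t powr (- p)) * indicator {1..} t \<partial>lborel)
      = ennreal ((- 1 / (p - 1)) * 0 - (- 1 / (p - 1)) * 1 powr (1 - p))"
  proof (rule nn_integral_FTC_atLeast[OF _ _ _ lim])
    fix t :: real assume "1 \<le> t"
    then have "((\<lambda>t. t powr (1 - p)) has_real_derivative (1 - p) * t powr (- p)) (at t)"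
      using has_real_derivative_powr[of t "1 - p"] by simp
    from DERIV_cmult[OF this, of "- 1 / (p - 1)"]
    have "((\<lambda>t. (- 1 / (p - 1)) * t powr (1 - p)) has_real_derivative ((- 1 / (p - 1)) * (1 - p)) * t powr (- p)) (at t)"
      by (simp only: mult.assoc)
    moreover have "(- 1 / (p - 1)) * (1 - p) = 1" using assms by (simp add: field_simps)
    ultimately show "((\<lambda>t. (- 1 / (p - 1)) * t powr (1 - p)) has_real_derivative t powr (- p)) (at t)"
      by (simp only: mult_1_left)
  qed auto
  then show ?thesis by simp
qed

text \<open>This is the place where the class condition needs \<open>\<beta> > 1/2\<close>.\<close>

lemma integrable_powr_weight:
  assumes "1 / 2 < \<beta>"
  shows "integrable lborel (\<lambda>t::real. (1 + t\<^sup>2) powr (- \<beta>))"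
proof (rule integrableI_bounded)
  let ?g = "\<lambda>t::real. ennreal (t powr (- (2 * \<beta>))) * indicator {1..} t"
  have pt: "ennreal (norm ((1 + t\<^sup>2) powr (- \<beta>))) \<le> indicator {-1..1} t + ?g t + ?g (- t)" for t :: real
  proof (cases "\<bar>t\<bar> \<le> 1")
    case True
    have "(1 + t\<^sup>2) powr (- \<beta>) \<le> 1 powr (- \<beta>)"
      using assms by (intro powr_mono2') auto
    then have "ennreal (norm ((1 + t\<^sup>2) powr (- \<beta>))) \<le> indicator {-1..1} t"
      using True by (auto simp: abs_le_iff)
    then show ?thesis by (metis add.assoc add_increasing2 zero_le)
  next
    case False
    have "(1 + t\<^sup>2) powr (- \<beta>) \<le> (t\<^sup>2) powr (- \<beta>)"
      using assms False by (intro powr_mono2') auto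
    also have "(t\<^sup>2) powr (- \<beta>) = \<bar>t\<bar> powr (- (2 * \<beta>))"
      using False by (subst powr_square) auto
    finally have "ennreal (norm ((1 + t\<^sup>2) powr (- \<beta>))) \<le> ennreal (\<bar>t\<bar> powr (- (2 * \<beta>)))"
      by (simp add: ennreal_leI)
    also have "\<dots> \<le> ?g t + ?g (- t)"
      using False by (cases "0 \<le> t") auto
    finally show ?thesis by (simp add: add.assoc add_increasing)
  qed
  have "(\<integral>\<^sup>+t. ennreal (norm ((1 + t\<^sup>2) powr (- \<beta>))) \<partial>lborel) \<le> (\<integral>\<^sup>+t. indicator {-1..1} t + ?g t + ?g (- t) \<partial>lborel)"
    by (rule nn_integral_mono) (rule pt)
  also have "\<dots> = (\<integral>\<^sup>+t. indicator {-1..1::real} t \<partial>lborel) + (\<integral>\<^sup>+t. ?g t \<partial>lborel) + (\<integral>\<^sup>+t. ?g (- t) \<partial>lborel)"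
    by (simp add: nn_integral_add)
  also have "(\<integral>\<^sup>+t. ?g (- t) \<partial>lborel) = (\<integral>\<^sup>+t. ?g t \<partial>lborel)"
    using nn_integral_real_affine[of ?g "-1" 0] by simp
  also have "(\<integral>\<^sup>+t. ?g t \<partial>lborel) = ennreal (1 / (2 * \<beta> - 1))"
    using assms by (intro nn_integral_powr_tail) simp
  finally show "(\<integral>\<^sup>+t. ennreal (norm ((1 + t\<^sup>2) powr (- \<beta>))) \<partial>lborel) < \<infinity>"
    by (simp add: emeasure_lborel_Icc_eq le_less_trans)
qed simp

text \<open>From \<open>x \<le> x\<^sup>2 * q + 1 / q\<close> with \<open>q = (1 + t\<^sup>2) powr \<beta>\<close>.\<close>

lemma integrable_ft_density_class:
  assumes \<beta>: "1 / 2 < \<beta>" and f: "f \<in> density_class \<beta> C"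
  shows "integrable lborel (ft f)"
proof (rule integrableI_bounded)
  have pf: "prob_density f" and le: "(\<integral>\<^sup>+t. ennreal ((cmod (ft f t))\<^sup>2 * (1 + t\<^sup>2) powr \<beta>) \<partial>lborel) \<le> ennreal C"
    using f by (auto simp: density_class_def)
  have [measurable]: "f \<in> borel_measurable borel" by (rule prob_densityD[OF pf])
  show "ft f \<in> borel_measurable lborel" by simp
  have pt: "cmod z \<le> (cmod z)\<^sup>2 * (1 + t\<^sup>2) powr \<beta> + (1 + t\<^sup>2) powr (- \<beta>)" for z :: complex and t :: real
  proof -
    define q where "q = (1 + t\<^sup>2) powr \<beta>"
    have "0 < 1 + t\<^sup>2" by (simp add: add_pos_nonneg)
    then have q: "0 < q" "(1 + t\<^sup>2) powr (- \<beta>) = 1 / q"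
      by (auto simp: q_def powr_minus_divide)
    have "0 \<le> (cmod z * q - 1)\<^sup>2" by simp
    then have "2 * (cmod z * q) \<le> (cmod z * q)\<^sup>2 + 1" by (simp add: power2_diff)
    moreover have "0 \<le> cmod z * q" using q by simp
    ultimately have "cmod z * q \<le> (cmod z * q)\<^sup>2 + 1" by linarith
    then have "cmod z \<le> ((cmod z * q)\<^sup>2 + 1) / q" using q(1) by (simp add: pos_le_divide_eq)
    also have "\<dots> = (cmod z)\<^sup>2 * q + 1 / q" using q(1) by (simp add: field_simps power2_eq_square)
    finally show ?thesis using q by (simp add: q_def)
  qed
  have "(\<integral>\<^sup>+t. ennreal (cmod (ft f t)) \<partial>lborel)
    \<le> (\<integral>\<^sup>+t. ennreal ((cmod (ft f t))\<^sup>2 * (1 + t\<^sup>2) powr \<beta>) + ennreal ((1 + t\<^sup>2) powr (- \<beta>)) \<partial>lborel)"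
    by (intro nn_integral_mono) (simp add: pt ennreal_leI flip: ennreal_plus)
  also have "\<dots> = (\<integral>\<^sup>+t. ennreal ((cmod (ft f t))\<^sup>2 * (1 + t\<^sup>2) powr \<beta>) \<partial>lborel) + (\<integral>\<^sup>+t. ennreal ((1 + t\<^sup>2) powr (- \<beta>)) \<partial>lborel)"
    by (rule nn_integral_add) auto
  also have "\<dots> < \<infinity>"
  proof -
    have "(\<integral>\<^sup>+t. ennreal ((1 + t\<^sup>2) powr (- \<beta>)) \<partial>(lborel :: real measure)) < \<infinity>"
      using integrable_powr_weight[OF \<beta>] by (simp add: integrable_iff_bounded)
    moreover have "(\<integral>\<^sup>+t. ennreal ((cmod (ft f t))\<^sup>2 * (1 + t\<^sup>2) powr \<beta>) \<partial>lborel) < \<infinity>"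
      using le by (rule le_less_trans) simp
    ultimately show ?thesis by simp
  qed
  finally show "(\<integral>\<^sup>+t. ennreal (norm (ft f t)) \<partial>lborel) < \<infinity>" .
qed

lemma norm_add_sq_le: "(cmod (a + b))\<^sup>2 \<le> 2 * (cmod a)\<^sup>2 + 2 * (cmod b)\<^sup>2"
proof -
  have "(cmod (a + b))\<^sup>2 \<le> (cmod a + cmod b)\<^sup>2"
    by (intro power_mono norm_triangle_ineq) simp
  also have "\<dots> \<le> 2 * (cmod a)\<^sup>2 + 2 * (cmod b)\<^sup>2"
    using sum_squares_bound[of "cmod a" "cmod b"] by (simp add: power2_sum)
  finally show ?thesis .
qed

text \<open>\<open>Psi - ft f\<close> is a sum of independent centred terms, the \<open>j\<close>-th bounded by
  \<open>2 * \<bar>ft (e j) t\<bar> / S\<close>; the squares of these bounds add up to \<open>4 * S / S\<^sup>2\<close>.\<close>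

lemma Psi_mean_square_error:
  assumes f: "prob_density f" and e: "\<And>j. prob_density (e j)"
    and S: "0 < (\<Sum>k=1..n. (cmod (ft (e k) t))\<^sup>2)" (is "0 < ?S")
  shows "(\<integral>\<^sup>+y. ennreal ((cmod (Psi n e y t - ft f t))\<^sup>2)
      \<partial>(\<Pi>\<^sub>M j\<in>{1..n}. density lborel f \<star> density lborel (e j))) \<le> ennreal (4 / ?S)"
proof -
  let ?Y = "\<lambda>j. density lborel f \<star> density lborel (e j)"
  define Z where "Z = (\<lambda>j u. cnj (ft (e j) t) * (iexp (t * u) - ft f t * ft (e j) t) / complex_of_real ?S)"
  have Zm: "Z j \<in> borel_measurable borel" for j
    unfolding Z_def by measurable
  have bnd: "cmod (iexp (t * u) - ft f t * ft (e j) t) \<le> 2" for j u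
  proof -
    have "cmod (ft f t * ft (e j) t) \<le> 1 * 1"
      unfolding norm_mult by (intro mult_mono cmod_ft_le_1 f e) auto
    then show ?thesis
      using norm_triangle_ineq4[of "iexp (t * u)" "ft f t * ft (e j) t"] by (simp del: of_real_mult)
  qed
  have Zle: "(cmod (Z j u))\<^sup>2 \<le> 4 * (cmod (ft (e j) t))\<^sup>2 / ?S\<^sup>2" for j u
  proof -
    have "(cmod (Z j u))\<^sup>2 = (cmod (ft (e j) t))\<^sup>2 * (cmod (iexp (t * u) - ft f t * ft (e j) t))\<^sup>2 / ?S\<^sup>2"
      by (simp only: Z_def norm_mult norm_divide complex_mod_cnj norm_of_real power_mult_distrib power_divide power2_abs)
    also have "\<dots> \<le> (cmod (ft (e j) t))\<^sup>2 * 2\<^sup>2 / ?S\<^sup>2"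
      by (intro divide_right_mono mult_left_mono power_mono bnd) auto
    finally show ?thesis by (simp add: mult.commute)
  qed
  have prob: "prob_space (?Y j)" for j by (rule prob_space_convolution[OF f e])
  have Zbd: "cmod (Z j u) \<le> 2 / ?S" for j u
  proof -
    have "cmod (Z j u) = cmod (ft (e j) t) * cmod (iexp (t * u) - ft f t * ft (e j) t) / \<bar>?S\<bar>"
      by (simp only: Z_def norm_mult norm_divide complex_mod_cnj norm_of_real)
    also have "\<dots> \<le> 1 * 2 / \<bar>?S\<bar>"
      by (intro divide_right_mono mult_mono bnd cmod_ft_le_1 e) auto
    finally show ?thesis using S by simp
  qed
  have intY: "integrable (?Y j) (\<lambda>u. iexp (t * u))" for j
    by (rule finite_measure.integrable_const_bound[OF prob_space.finite_measure[OF prob], where B=1]) auto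
  have mean: "(CLINT u|?Y j. Z j u) = 0" for j
  proof -
    have "(CLINT u|?Y j. iexp (t * u) - ft f t * ft (e j) t) = 0"
      using intY[of j] finite_measure.integrable_const[OF prob_space.finite_measure[OF prob], of j "ft f t * ft (e j) t"]
      by (subst Bochner_Integration.integral_diff)
        (simp_all only: ft_convolution[OF f e] lebesgue_integral_const prob_space.prob_space[OF prob] scaleR_one diff_self)
    then show ?thesis
      by (simp only: Z_def integral_mult_right_zero integral_divide_zero mult_zero_right div_0)
  qed
  have Psi_eq: "Psi n e y t - ft f t = (\<Sum>j\<in>{1..n}. Z j (y j))" for y
  proof -
    have "complex_of_real ?S = (\<Sum>j=1..n. cnj (ft (e j) t) * ft (e j) t)"
      by (simp only: of_real_sum complex_norm_square mult.commute)
    then have "(\<Sum>j=1..n. cnj (ft (e j) t) * (ft f t * ft (e j) t)) = ft f t * complex_of_real ?S"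
      by (simp only: sum_distrib_left mult.left_commute)
    moreover have "complex_of_real ?S \<noteq> 0" using S by (simp only: of_real_eq_0_iff)
    ultimately have "(\<Sum>j=1..n. cnj (ft (e j) t) * (ft f t * ft (e j) t)) / complex_of_real ?S = ft f t"
      by (simp only: nonzero_mult_div_cancel_right not_False_eq_True)
    then show ?thesis unfolding Psi_def ft_uminus Z_def
      by (simp only: sum_divide_distrib[symmetric] right_diff_distrib sum_subtractf diff_divide_distrib)
  qed
  have second: "(LINT u|?Y j. (cmod (Z j u))\<^sup>2) \<le> 4 * (cmod (ft (e j) t))\<^sup>2 / ?S\<^sup>2" for j
  proof -
    interpret Yj: prob_space "?Y j" by (rule prob)
    have "integrable (?Y j) (\<lambda>u. (cmod (Z j u))\<^sup>2)"
    proof (rule Yj.integrable_const_bound)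
      show "AE u in ?Y j. norm ((cmod (Z j u))\<^sup>2) \<le> 4 * (cmod (ft (e j) t))\<^sup>2 / ?S\<^sup>2"
        using Zle by (intro AE_I2) (simp only: real_norm_def abs_power2)
      show "(\<lambda>u. (cmod (Z j u))\<^sup>2) \<in> borel_measurable (?Y j)"
        using Zm[of j] by simp
    qed
    then have "(LINT u|?Y j. (cmod (Z j u))\<^sup>2) \<le> (LINT u|?Y j. 4 * (cmod (ft (e j) t))\<^sup>2 / ?S\<^sup>2)"
      by (rule integral_mono[OF _ Yj.integrable_const Zle])
    then show ?thesis
      by (simp only: lebesgue_integral_const Yj.prob_space scaleR_one)
  qed
  have "(\<Sum>j\<in>{1..n}. LINT u|?Y j. (cmod (Z j u))\<^sup>2) \<le> (\<Sum>j\<in>{1..n}. 4 * (cmod (ft (e j) t))\<^sup>2 / ?S\<^sup>2)"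
    by (rule sum_mono) (rule second)
  also have "\<dots> = 4 * ?S / ?S\<^sup>2"
    by (simp only: sum_divide_distrib sum_distrib_left)
  also have "\<dots> = 4 / ?S" using S by (simp only: power2_eq_square) simp
  finally have le: "(\<Sum>j\<in>{1..n}. LINT u|?Y j. (cmod (Z j u))\<^sup>2) \<le> 4 / ?S" .
  have "(\<integral>\<^sup>+y. ennreal ((cmod (Psi n e y t - ft f t))\<^sup>2) \<partial>Pi\<^sub>M {1..n} ?Y)
     = ennreal (\<Sum>j\<in>{1..n}. LINT u|?Y j. (cmod (Z j u))\<^sup>2)"
    unfolding Psi_eq
  proof (rule second_moment_indep_sum)
    show "prob_space (?Y j)" "Z j \<in> borel_measurable (?Y j)" "cmod (Z j u) \<le> 2 / ?S" for j u
      using prob Zm[of j] Zbd by simp_all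
    show "(CLINT u|?Y j. Z j u) = 0" for j by (rule mean)
  qed simp
  also have "\<dots> \<le> ennreal (4 / ?S)" by (rule ennreal_leI[OF le])
  finally show ?thesis .
qed

lemma fhat_eq_inv_ft: "fhat n e Kft w y = inv_ft (\<lambda>t. Kft (t / w) * Psi n e y t)"
  by (simp add: fhat_def[abs_def] inv_ft_def[abs_def] mult.assoc)

text \<open>The bound for a single sample size. The first term is the variance, integrated over the band
  \<open>[-w, w]\<close> to which \<open>Kft (t / w)\<close> confines the estimator; the second is the squared bias
  \<open>\<bar>Kft (t / w) - 1\<bar>\<^sup>2 * \<bar>ft f t\<bar>\<^sup>2\<close>, controlled by the class condition.\<close>

lemma risk_fhat_le:
  assumes \<beta>: "1 / 2 < \<beta>" and C: "0 \<le> C" and f: "f \<in> density_class \<beta> C" and e: "\<And>j. prob_density (e j)"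
    and [measurable]: "Kft \<in> borel_measurable borel"
    and K1: "\<And>t. cmod (Kft t) \<le> 1" and Ksupp: "\<And>t. 1 < \<bar>t\<bar> \<Longrightarrow> Kft t = 0"
    and Kb: "\<And>t. cmod (Kft t - 1) \<le> B * \<bar>t\<bar> powr \<beta>"
    and w: "0 < w" and s0: "0 < s0"
    and S: "\<And>t. t \<noteq> 0 \<Longrightarrow> \<bar>t\<bar> \<le> w \<Longrightarrow> s0 \<le> (\<Sum>k=1..n. (cmod (ft (e k) t))\<^sup>2)"
  shows "risk n e f (fhat n e Kft w) \<le> ennreal (1 / (2 * pi) * (16 * w / s0 + 2 * B\<^sup>2 * C * w powr (- 2 * \<beta>)))"
proof -
  let ?S = "\<lambda>t. \<Sum>k=1..n. (cmod (ft (e k) t))\<^sup>2"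
  have pf: "prob_density f" and cls: "(\<integral>\<^sup>+t. ennreal ((cmod (ft f t))\<^sup>2 * (1 + t\<^sup>2) powr \<beta>) \<partial>lborel) \<le> ennreal C"
    using f by (auto simp: density_class_def)
  have [measurable]: "f \<in> borel_measurable borel" "\<And>j. e j \<in> borel_measurable borel"
    using prob_densityD pf e by auto
  let ?P = "\<Pi>\<^sub>M j\<in>{1..n}. density lborel f \<star> density lborel (e j)"
  let ?H = "\<lambda>y t. Kft (t / w) * Psi n e y t"
  let ?phi = "ft f"
  let ?sq = "\<lambda>y t. ennreal ((cmod (?H y t - ?phi t))\<^sup>2)"
  let ?bias2 = "\<lambda>t. 2 * (cmod ((Kft (t / w) - 1) * ?phi t))\<^sup>2"
  let ?wt = "\<lambda>t. ennreal ((cmod (?phi t))\<^sup>2 * (1 + t\<^sup>2) powr \<beta>)"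
  let ?err = "\<lambda>y x. cmod (fhat n e Kft w y x - complex_of_real (f x))"
  have sP: "sets ?P = sets (Pi\<^sub>M {1..n} (\<lambda>_. borel))" by (intro sets_PiM_cong) auto
  have intphi: "integrable lborel ?phi" by (rule integrable_ft_density_class[OF \<beta> f])
  have Psi_meas: "(\<lambda>z. Psi n e (fst z) (snd z)) \<in> borel_measurable (Pi\<^sub>M {1..n} (\<lambda>_. borel) \<Otimes>\<^sub>M borel)"
    unfolding Psi_def
  proof (intro borel_measurable_divide borel_measurable_sum borel_measurable_times)
    fix j assume j: "j \<in> {1..n}"
    have [measurable]: "(\<lambda>z. fst z j) \<in> borel_measurable (Pi\<^sub>M {1..n} (\<lambda>_. borel :: real measure) \<Otimes>\<^sub>M (borel :: real measure))"
      by (rule measurable_compose[OF measurable_fst measurable_component_singleton[OF j]])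
    show "(\<lambda>z. iexp (snd z * fst z j)) \<in> borel_measurable (Pi\<^sub>M {1..n} (\<lambda>_. borel :: real measure) \<Otimes>\<^sub>M (borel :: real measure))"
      by measurable
  qed measurable
  have Psi_meas1: "Psi n e y \<in> borel_measurable borel" for y
    unfolding Psi_def[abs_def] by measurable
  have Psi_le: "cmod (Psi n e y t) \<le> real n / s0" if "t \<noteq> 0" "\<bar>t\<bar> \<le> w" for y t
  proof -
    let ?S = "\<Sum>k=1..n. (cmod (ft (e k) t))\<^sup>2"
    have Sp: "0 < ?S" by (rule less_le_trans[OF s0 S[OF that]])
    have num: "cmod (\<Sum>j=1..n. ft (e j) (- t) * iexp (t * y j)) \<le> (\<Sum>j=1..n. 1)"
      by (rule sum_norm_le) (simp only: norm_mult norm_exp_imag mult_1_right cmod_ft_le_1 e)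
    have "cmod (Psi n e y t) = cmod (\<Sum>j=1..n. ft (e j) (- t) * iexp (t * y j)) / ?S"
      by (simp only: Psi_def norm_divide norm_of_real abs_of_pos[OF Sp])
    also have "\<dots> \<le> (\<Sum>j=1..n. 1) / ?S" by (rule divide_right_mono[OF num less_imp_le[OF Sp]])
    also have "\<dots> = real n / ?S" by simp
    also have "\<dots> \<le> real n / s0"
      by (rule divide_left_mono[OF S[OF that]]) (simp_all only: of_nat_0_le_iff mult_pos_pos Sp s0)
    finally show ?thesis .
  qed
  have H0: "?H y t = 0" if "w < \<bar>t\<bar>" for y t
  proof -
    have "1 < \<bar>t\<bar> / w" using that w by simp
    then have "1 < \<bar>t / w\<bar>" using w by (simp only: abs_divide abs_of_pos)
    from Ksupp[OF this] show ?thesis by simp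
  qed
  have intH: "integrable lborel (?H y)" for y
  proof (rule Bochner_Integration.integrable_bound)
    show "integrable lborel (\<lambda>t. indicator {-w..w} t * (real n / s0))"
      by (intro integrable_mult_left integrable_real_indicator) (auto simp: emeasure_lborel_Icc_eq)
    show "?H y \<in> borel_measurable lborel" using Psi_meas1 by simp
    show "AE t in lborel. cmod (?H y t) \<le> norm (indicator {-w..w} t * (real n / s0))"
      using AE_lborel_singleton[of 0]
    proof eventually_elim
      case (elim t)
      show ?case
      proof (cases "\<bar>t\<bar> \<le> w")
        case True
        have "cmod (?H y t) \<le> 1 * (real n / s0)"
          unfolding norm_mult by (intro mult_mono K1 Psi_le elim True) auto
        then show ?thesis using True s0 by (auto simp: abs_le_iff)
      next
        case False
        then have "w < \<bar>t\<bar>" by simp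
        from H0[OF this] show ?thesis by (simp only: norm_zero norm_ge_zero)
      qed
    qed
  qed
  have loss: "(\<integral>\<^sup>+x. ennreal ((?err y x)\<^sup>2) \<partial>lborel)
      \<le> ennreal (1 / (2 * pi)) * (\<integral>\<^sup>+t. ?sq y t \<partial>lborel)" for y
  proof -
    have "AE x in lborel. fhat n e Kft w y x - complex_of_real (f x) = inv_ft (\<lambda>t. ?H y t - ?phi t) x"
      using inv_ft_ft_AE[OF pf intphi]
    proof eventually_elim
      case (elim x)
      have "inv_ft (\<lambda>t. ?H y t - ?phi t) x = inv_ft (?H y) x - inv_ft ?phi x"
        unfolding inv_ft_def right_diff_distrib
        by (subst Bochner_Integration.integral_diff[OF integrable_iexp_mult[OF intH] integrable_iexp_mult[OF intphi]])
          (auto simp: right_diff_distrib)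
      then show ?case by (simp only: elim fhat_eq_inv_ft)
    qed
    then have "(\<integral>\<^sup>+x. ennreal ((?err y x)\<^sup>2) \<partial>lborel)
      = (\<integral>\<^sup>+x. ennreal ((cmod (inv_ft (\<lambda>t. ?H y t - ?phi t) x))\<^sup>2) \<partial>lborel)"
      by (intro nn_integral_cong_AE) (auto elim!: eventually_mono)
    also have "\<dots> \<le> ennreal (1 / (2 * pi)) * (\<integral>\<^sup>+t. ?sq y t \<partial>lborel)"
      by (rule plancherel_le) (intro Bochner_Integration.integrable_diff intH intphi)
    finally show ?thesis .
  qed
  have joint: "(\<lambda>z. ennreal ((cmod (?H (fst z) (snd z) - ?phi (snd z)))\<^sup>2)) \<in> borel_measurable (Pi\<^sub>M {1..n} (\<lambda>_. borel) \<Otimes>\<^sub>M borel)"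
    using Psi_meas by measurable
  have joint': "(\<lambda>(y, t). ?sq y t) \<in> borel_measurable (?P \<Otimes>\<^sub>M lborel)"
    using joint unfolding split_beta'
    by (subst measurable_cong_sets[OF sets_pair_measure_cong[OF sP sets_lborel] refl])
  interpret P: prob_space ?P
    by (intro prob_space_PiM prob_space_convolution pf e)
  interpret PL: pair_sigma_finite ?P lborel ..
  have meas_inner: "(\<lambda>y. \<integral>\<^sup>+t. ?sq y t \<partial>lborel) \<in> borel_measurable (Pi\<^sub>M {1..n} (\<lambda>_. borel))"
    using lborel.borel_measurable_nn_integral_fst[of "\<lambda>z. ennreal ((cmod (?H (fst z) (snd z) - ?phi (snd z)))\<^sup>2)" "Pi\<^sub>M {1..n} (\<lambda>_. borel)"]
      joint by (simp cong: measurable_cong_sets)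
  have mse: "(\<integral>\<^sup>+y. ?sq y t \<partial>?P)
      \<le> ennreal (8 / s0) * indicator {-w..w} t + ennreal (2 * B\<^sup>2 * w powr (- 2 * \<beta>)) * ?wt t"
    (is "_ \<le> _ + ?bias") if t: "t \<noteq> 0" for t
  proof -
    have bias: "ennreal (?bias2 t) \<le> ?bias"
    proof -
      have "(cmod (Kft (t / w) - 1))\<^sup>2 \<le> (B * \<bar>t / w\<bar> powr \<beta>)\<^sup>2"
        by (intro power_mono Kb) simp
      also have "\<dots> = B\<^sup>2 * (\<bar>t\<bar> powr (2 * \<beta>) * w powr (- 2 * \<beta>))"
      proof -
        have "(\<bar>t / w\<bar> powr \<beta>)\<^sup>2 = \<bar>t / w\<bar> powr (2 * \<beta>)"
          using t w by (simp add: power2_eq_square flip: powr_add)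
        also have "\<dots> = \<bar>t\<bar> powr (2 * \<beta>) / w powr (2 * \<beta>)"
          using w by (simp add: abs_divide powr_divide)
        also have "\<dots> = \<bar>t\<bar> powr (2 * \<beta>) * w powr (- 2 * \<beta>)"
          by (simp add: powr_minus divide_inverse del: inverse_eq_divide)
        finally show ?thesis by (simp only: power_mult_distrib)
      qed
      also have "\<bar>t\<bar> powr (2 * \<beta>) = (t\<^sup>2) powr \<beta>" using t by (rule powr_square[symmetric])
      also have "B\<^sup>2 * ((t\<^sup>2) powr \<beta> * w powr (- 2 * \<beta>)) \<le> B\<^sup>2 * ((1 + t\<^sup>2) powr \<beta> * w powr (- 2 * \<beta>))"
        using \<beta> by (intro mult_left_mono mult_right_mono powr_mono2) auto
      finally have "2 * ((cmod (Kft (t / w) - 1))\<^sup>2 * (cmod (?phi t))\<^sup>2)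
        \<le> 2 * ((B\<^sup>2 * ((1 + t\<^sup>2) powr \<beta> * w powr (- 2 * \<beta>))) * (cmod (?phi t))\<^sup>2)"
        by (intro mult_left_mono mult_right_mono) auto
      then have "?bias2 t
        \<le> (2 * B\<^sup>2 * w powr (- 2 * \<beta>)) * ((cmod (?phi t))\<^sup>2 * (1 + t\<^sup>2) powr \<beta>)"
        by (simp add: norm_mult power_mult_distrib mult_ac)
      then show ?thesis
        by (subst ennreal_mult[symmetric]) (auto intro: ennreal_leI)
    qed
    show ?thesis
    proof (cases "\<bar>t\<bar> \<le> w")
      case True
      have Spos: "0 < ?S t" using S[OF t True] s0 by linarith
      have [measurable]: "(\<lambda>y. Psi n e y t) \<in> borel_measurable ?P"
        using measurable_compose[OF measurable_Pair2'[of t borel] Psi_meas]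
        by (subst measurable_cong_sets[OF sP refl]) simp
      have "(\<integral>\<^sup>+y. ?sq y t \<partial>?P)
        \<le> (\<integral>\<^sup>+y. 2 * ennreal ((cmod (Psi n e y t - ?phi t))\<^sup>2) + ennreal (?bias2 t) \<partial>?P)"
      proof (rule nn_integral_mono)
        fix y
        have "(cmod (?H y t - ?phi t))\<^sup>2 = (cmod (Kft (t / w) * (Psi n e y t - ?phi t) + (Kft (t / w) - 1) * ?phi t))\<^sup>2"
          by (simp add: algebra_simps)
        also have "\<dots> \<le> 2 * (cmod (Kft (t / w) * (Psi n e y t - ?phi t)))\<^sup>2 + ?bias2 t"
          by (rule norm_add_sq_le)
        also have "(cmod (Kft (t / w) * (Psi n e y t - ?phi t)))\<^sup>2 \<le> (cmod (Psi n e y t - ?phi t))\<^sup>2"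
          unfolding norm_mult by (intro power_mono mult_left_le_one_le K1) auto
        finally have "?sq y t \<le> ennreal (2 * (cmod (Psi n e y t - ?phi t))\<^sup>2 + ?bias2 t)"
          by (intro ennreal_leI) simp
        then show "?sq y t \<le> 2 * ennreal ((cmod (Psi n e y t - ?phi t))\<^sup>2) + ennreal (?bias2 t)"
          by (simp add: ennreal_plus ennreal_mult')
      qed
      also have "\<dots> = 2 * (\<integral>\<^sup>+y. ennreal ((cmod (Psi n e y t - ?phi t))\<^sup>2) \<partial>?P) + ennreal (?bias2 t)"
        by (subst nn_integral_add) (simp_all add: nn_integral_cmult P.emeasure_space_1)
      also have "\<dots> \<le> 2 * ennreal (4 / s0) + ?bias"
      proof (intro add_mono mult_left_mono bias)
        have "4 / ?S t \<le> 4 / s0"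
          using S[OF t True] s0 by (intro divide_left_mono) auto
        then show "(\<integral>\<^sup>+y. ennreal ((cmod (Psi n e y t - ?phi t))\<^sup>2) \<partial>?P) \<le> ennreal (4 / s0)"
          by (intro order_trans[OF Psi_mean_square_error[OF pf e Spos]] ennreal_leI)
      qed simp
      also have "2 * ennreal (4 / s0) = ennreal (8 / s0) * indicator {-w..w} t"
      proof -
        have "2 * ennreal (4 / s0) = ennreal (2 * (4 / s0))" using s0 by (subst ennreal_mult) auto
        then show ?thesis using True by (simp add: abs_le_iff indicator_def)
      qed
      finally show ?thesis .
    next
      case False
      then have "1 < \<bar>t\<bar> / w" using w by simp
      then have "1 < \<bar>t / w\<bar>" using w by (simp only: abs_divide abs_of_pos)
      from Ksupp[OF this] have "(\<integral>\<^sup>+y. ?sq y t \<partial>?P) \<le> ennreal (?bias2 t)"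
        by (simp add: P.emeasure_space_1 ennreal_leI)
      also have "\<dots> \<le> ?bias" by (rule bias)
      finally show ?thesis by (simp add: add_increasing)
    qed
  qed
  have "risk n e f (fhat n e Kft w) \<le> (\<integral>\<^sup>+s. ennreal (1 / (2 * pi)) * (\<integral>\<^sup>+t. ennreal ((cmod (?H (obs n s) t - ?phi t))\<^sup>2) \<partial>lborel) \<partial>model n e f)"
    unfolding risk_def by (rule nn_integral_mono) (rule loss)
  also have "\<dots> = (\<integral>\<^sup>+y. ennreal (1 / (2 * pi)) * (\<integral>\<^sup>+t. ?sq y t \<partial>lborel) \<partial>?P)"
    by (rule nn_integral_obs[OF pf e]) (intro borel_measurable_times_ennreal borel_measurable_const meas_inner)
  also have "\<dots> = ennreal (1 / (2 * pi)) * (\<integral>\<^sup>+y. \<integral>\<^sup>+t. ?sq y t \<partial>lborel \<partial>?P)"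
    by (rule nn_integral_cmult) (subst measurable_cong_sets[OF sP refl], rule meas_inner)
  also have "(\<integral>\<^sup>+y. \<integral>\<^sup>+t. ?sq y t \<partial>lborel \<partial>?P)
     = (\<integral>\<^sup>+t. \<integral>\<^sup>+y. ?sq y t \<partial>?P \<partial>lborel)"
    by (rule PL.Fubini'[OF joint', symmetric])
  also have "\<dots> \<le> (\<integral>\<^sup>+t. ennreal (8 / s0) * indicator {-w..w} t + ennreal (2 * B\<^sup>2 * w powr (- 2 * \<beta>)) * ?wt t \<partial>lborel)"
    by (rule nn_integral_mono_AE) (use AE_lborel_singleton[of 0] mse in \<open>auto elim!: eventually_mono\<close>)
  also have "\<dots> = ennreal (8 / s0) * (\<integral>\<^sup>+t. indicator {-w..w} t \<partial>lborel) + ennreal (2 * B\<^sup>2 * w powr (- 2 * \<beta>)) * (\<integral>\<^sup>+t. ?wt t \<partial>lborel)"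
    by (subst nn_integral_add) (simp_all add: nn_integral_cmult)
  also have "\<dots> \<le> ennreal (8 / s0) * ennreal (2 * w) + ennreal (2 * B\<^sup>2 * w powr (- 2 * \<beta>)) * ennreal C"
    using w by (intro add_mono mult_left_mono cls) (auto simp: emeasure_lborel_Icc_eq)
  also have "\<dots> = ennreal (16 * w / s0 + 2 * B\<^sup>2 * C * w powr (- 2 * \<beta>))"
    using s0 w C by (simp add: ennreal_mult[symmetric] ennreal_plus[symmetric] mult_ac del: ennreal_plus)
  finally have "risk n e f (fhat n e Kft w) \<le> ennreal (1 / (2 * pi)) * ennreal (16 * w / s0 + 2 * B\<^sup>2 * C * w powr (- 2 * \<beta>))"
    by (simp add: mult_left_mono)
  then show ?thesis by (subst ennreal_mult'[OF divide_nonneg_nonneg]) auto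
qed

text \<open>Near zero this is the order condition on the kernel; away from zero, \<open>\<bar>Kft - 1\<bar> \<le> 2\<close> is absorbed by
  enlarging the constant.\<close>

lemma kernel_holder_bound:
  assumes B: "condition_B \<beta> Kft" and K0: "Kft 0 = 1" and \<beta>: "0 < \<beta>"
  obtains B where "0 < B" "\<And>t. cmod (Kft t - 1) \<le> B * \<bar>t\<bar> powr \<beta>"
proof -
  have K1: "\<And>t. cmod (Kft t) \<le> 1" and o: "(\<lambda>t. cmod (Kft t - 1)) \<in> o[at 0](\<lambda>t. \<bar>t\<bar> powr \<beta>)"
    using B by (auto simp: condition_B_def)
  from landau_o.smallD[OF o zero_less_one]
  obtain d where d: "0 < d" "\<And>t. t \<noteq> 0 \<Longrightarrow> \<bar>t\<bar> < d \<Longrightarrow> cmod (Kft t - 1) \<le> \<bar>t\<bar> powr \<beta>"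
    by (auto simp: eventually_at dist_real_def)
  define B where "B = max 1 (2 / d powr \<beta>)"
  have "cmod (Kft t - 1) \<le> B * \<bar>t\<bar> powr \<beta>" for t
  proof (cases "t = 0 \<or> \<bar>t\<bar> < d")
    case True
    have "cmod (Kft t - 1) \<le> 1 * \<bar>t\<bar> powr \<beta>"
      using True d(2)[of t] K0 by (cases "t = 0") auto
    also have "\<dots> \<le> B * \<bar>t\<bar> powr \<beta>" by (intro mult_right_mono) (auto simp: B_def)
    finally show ?thesis .
  next
    case False
    have "cmod (Kft t - 1) \<le> 2" using norm_triangle_ineq4[of "Kft t" 1] K1[of t] by simp
    also have "2 = 2 / d powr \<beta> * d powr \<beta>" using d(1) by simp
    also have "\<dots> \<le> B * \<bar>t\<bar> powr \<beta>"
      using False d(1) \<beta> by (intro mult_mono powr_mono2) (auto simp: B_def)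
    finally show ?thesis .
  qed
  moreover have "0 < B" by (simp add: B_def)
  ultimately show ?thesis using that by blast
qed

text \<open>For \<open>\<bar>t\<bar> > T\<close>, the lower envelope at \<open>\<bar>t\<bar>\<close> dominates \<open>c1\<close> times the upper envelope at \<open>c2 * \<bar>t\<bar> \<le> m\<close>.
  For \<open>0 < \<bar>t\<bar> \<le> T\<close> the same holds with \<open>T\<close> in place of \<open>\<bar>t\<bar>\<close>. At \<open>t = 0\<close> nothing can be said if
  \<open>T = 0\<close>, which is harmless as a single point is a null set.\<close>

lemma energy_lower_bound:
  fixes e :: "nat \<Rightarrow> real \<Rightarrow> real"
  assumes C: "condition_C fe \<alpha> C0 T c1 c2 \<phi>u \<phi>l" and n: "1 \<le> n"
    and m: "c2 * T \<le> m" and t: "t \<noteq> 0" "c2 * \<bar>t\<bar> \<le> m"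
  shows "c1\<^sup>2 * (\<Sum>k=1..n. \<bar>\<phi>u n k m\<bar>\<^sup>2) \<le> (\<Sum>k=1..n. (cmod (ft (fe n k) t))\<^sup>2)"
proof -
  have c: "0 \<le> T" "0 < c1" "1 \<le> c2" using C by (auto simp: condition_C_def)
  have mpos: "0 < m" using t c by (smt (verit) mult_pos_pos zero_less_abs_iff)
  have "c1\<^sup>2 * \<bar>\<phi>u n k m\<bar>\<^sup>2 \<le> (cmod (ft (fe n k) t))\<^sup>2" if k: "k \<in> {1..n}" for k
  proof -
    have Ck: "\<And>t. 0 < t \<Longrightarrow> 0 < \<phi>u n k t" "antimono_on {0<..} (\<phi>u n k)"
      "\<And>t. \<bar>t\<bar> \<le> T \<Longrightarrow> \<phi>l n k T \<le> cmod (ft (fe n k) t)"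
      "\<And>t. T < t \<Longrightarrow> \<phi>l n k t \<le> cmod (ft (fe n k) t)"
      "\<And>t. 0 < t \<Longrightarrow> c1 * \<phi>u n k (c2 * t) \<le> \<phi>l n k t"
      using C n k by (auto simp: condition_C_def)
    have "c1 * \<phi>u n k m \<le> cmod (ft (fe n k) t)"
    proof -
      \<comment> \<open>on \<open>\<bar>t\<bar> \<le> T\<close> the lower bound is constant, equal to its value at \<open>T\<close>\<close>
      define s where "s = max T \<bar>t\<bar>"
      have s: "0 < s" "c2 * s \<le> m" using t m c by (auto simp: s_def max_def)
      have "\<phi>u n k m \<le> \<phi>u n k (c2 * s)"
        using monotone_onD[OF Ck(2), of "c2 * s" m] s c mpos by simp
      then have "c1 * \<phi>u n k m \<le> c1 * \<phi>u n k (c2 * s)" using c by simp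
      also have "\<dots> \<le> \<phi>l n k s" by (rule Ck(5)[OF s(1)])
      also have "\<dots> \<le> cmod (ft (fe n k) t)"
      proof (cases "\<bar>t\<bar> \<le> T")
        case True
        then show ?thesis using Ck(3)[OF True] by (simp add: s_def max_def)
      next
        case False
        have "cmod (ft (fe n k) \<bar>t\<bar>) = cmod (ft (fe n k) t)"
          by (cases "0 \<le> t") (simp_all add: ft_uminus)
        then show ?thesis using Ck(4)[of "\<bar>t\<bar>"] False by (simp add: s_def max_def)
      qed
      finally show ?thesis .
    qed
    then have "(c1 * \<phi>u n k m)\<^sup>2 \<le> (cmod (ft (fe n k) t))\<^sup>2"
      using Ck(1)[OF mpos] c by (intro power_mono) auto
    then show ?thesis by (simp add: power_mult_distrib)
  qed
  then show ?thesis unfolding sum_distrib_left by (intro sum_mono)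
qed

text \<open>Part (a): the previous bound with \<open>w = m / c2\<close> and \<open>s0 = c1\<^sup>2 * C1 * m powr (1 + 2 * \<beta>)\<close>, for all \<open>n\<close> so
  large that \<open>c2 * T \<le> m n\<close>.\<close>

lemma fhat_rate:
  fixes fe :: "nat \<Rightarrow> nat \<Rightarrow> real \<Rightarrow> real"
    and K :: "real \<Rightarrow> real" and Kft :: "real \<Rightarrow> complex"
    and w m :: "nat \<Rightarrow> real"
  assumes err: "\<And>n j. n \<ge> 1 \<Longrightarrow> j \<in> {1..n} \<Longrightarrow> prob_density (fe n j)"
    and kernel: "L2_ft K Kft" and K0: "Kft 0 = 1"
    and beta: "\<beta> > 1/2"
    and condB: "condition_B \<beta> Kft"
    and condC: "condition_C fe \<alpha> C0 T c1 c2 \<phi>u \<phi>l"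
    and m_pos: "\<And>n. n \<ge> 1 \<Longrightarrow> m n > 0"
    and m_lim: "filterlim m at_top sequentially"
    and C1: "C1 > 0"
    and m_bound: "\<And>n. n \<ge> 1 \<Longrightarrow> C1 * m n powr (1 + 2*\<beta>) \<le> (\<Sum>j=1..n. \<bar>\<phi>u n j (m n)\<bar>\<^sup>2)"
    and w: "\<And>n. n \<ge> 1 \<Longrightarrow> w n = inverse c2 * m n" and C: "C > 0"
  shows "\<exists>M::real. \<forall>\<^sub>F n in sequentially.
              (SUP f\<in>density_class \<beta> C. risk n (fe n) f (fhat n (fe n) Kft (w n)))
                \<le> ennreal (M * m n powr (-2*\<beta>))"
proof -
  have c: "0 \<le> T" "0 < c1" "1 \<le> c2" using condC by (auto simp: condition_C_def)
  have K: "Kft \<in> borel_measurable borel"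
    using kernel by (auto simp: L2_ft_def square_integrable_def)
  obtain B where B: "0 < B" "\<And>t. cmod (Kft t - 1) \<le> B * \<bar>t\<bar> powr \<beta>"
    using kernel_holder_bound[OF condB K0] beta by auto
  have K1: "\<And>t. cmod (Kft t) \<le> 1" using condB by (auto simp: condition_B_def)
  have Ks: "Kft t = 0" if "1 < \<bar>t\<bar>" for t
  proof -
    have "t \<notin> {-1..1}" using that by auto
    then show ?thesis using condB unfolding condition_B_def by blast
  qed
  define M where "M = 1 / (2 * pi) * (16 / (c2 * (c1\<^sup>2 * C1)) + 2 * B\<^sup>2 * C * c2 powr (2 * \<beta>))"
  have "\<forall>\<^sub>F n in sequentially. c2 * T \<le> m n"
    using m_lim by (auto simp: filterlim_at_top)
  then have "\<forall>\<^sub>F n in sequentially. (SUP f\<in>density_class \<beta> C. risk n (fe n) f (fhat n (fe n) Kft (w n)))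
                \<le> ennreal (M * m n powr (-2*\<beta>))"
    using eventually_ge_at_top[of 1]
  proof eventually_elim
    case (elim n)
    define e where "e j = (if j \<in> {1..n} then fe n j else fejer)" for j
    have e: "prob_density (e j)" for j
      using err elim by (auto simp: e_def prob_density_fejer)
    have ee: "j \<in> {1..n} \<Longrightarrow> fe n j = e j" for j by (simp add: e_def)
    have mn: "0 < m n" and wn: "w n = m n / c2" using m_pos w elim by (auto simp: divide_inverse)
    have wpos: "0 < w n" using mn wn c by simp
    let ?s0 = "c1\<^sup>2 * (C1 * m n powr (1 + 2*\<beta>))"
    have s0: "0 < ?s0" using c C1 mn by simp
    have S: "?s0 \<le> (\<Sum>k=1..n. (cmod (ft (e k) t))\<^sup>2)" if "t \<noteq> 0" "\<bar>t\<bar> \<le> w n" for t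
    proof -
      have "c2 * \<bar>t\<bar> \<le> m n" using that(2) wn c by (simp add: pos_le_divide_eq mult.commute)
      have "?s0 \<le> c1\<^sup>2 * (\<Sum>k=1..n. \<bar>\<phi>u n k (m n)\<bar>\<^sup>2)"
        using m_bound[OF elim(2)] by (intro mult_left_mono) auto
      also have "\<dots> \<le> (\<Sum>k=1..n. (cmod (ft (fe n k) t))\<^sup>2)"
        by (rule energy_lower_bound[OF condC elim(2) elim(1) that(1)]) fact
      also have "\<dots> = (\<Sum>k=1..n. (cmod (ft (e k) t))\<^sup>2)"
        by (intro sum.cong refl) (simp only: ee)
      finally show ?thesis .
    qed
    have const: "1 / (2 * pi) * (16 * w n / ?s0 + 2 * B\<^sup>2 * C * w n powr (- 2 * \<beta>)) = M * m n powr (-2*\<beta>)"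
    proof -
      have "m n powr (1 + 2 * \<beta>) = m n * m n powr (2 * \<beta>)" using mn by (simp add: powr_add)
      then have "16 * w n / ?s0 = 16 / (c2 * (c1\<^sup>2 * C1)) * (1 / m n powr (2 * \<beta>))"
        using mn c C1 by (simp add: wn)
      also have "1 / m n powr (2 * \<beta>) = m n powr (-2 * \<beta>)" by (simp add: powr_minus_divide)
      finally have 1: "16 * w n / ?s0 = 16 / (c2 * (c1\<^sup>2 * C1)) * m n powr (-2 * \<beta>)" .
      have "w n powr (- 2 * \<beta>) = m n powr (- 2 * \<beta>) / c2 powr (- 2 * \<beta>)"
        using mn c by (simp add: wn powr_divide)
      also have "\<dots> = c2 powr (2 * \<beta>) * m n powr (- 2 * \<beta>)"
        by (simp add: powr_minus_divide)
      finally have 2: "w n powr (- 2 * \<beta>) = c2 powr (2 * \<beta>) * m n powr (- 2 * \<beta>)" .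
      show ?thesis unfolding 1 2 M_def by (simp only: distrib_left distrib_right mult.assoc)
    qed
    show ?case
    proof (rule SUP_least)
      fix f assume f: "f \<in> density_class \<beta> C"
      have "risk n (fe n) f (fhat n (fe n) Kft (w n)) = risk n e f (fhat n e Kft (w n))"
        using risk_cong[of n "fe n" e] fhat_cong[of n "fe n" e] ee by simp
      also have "\<dots> \<le> ennreal (1 / (2 * pi) * (16 * w n / ?s0 + 2 * B\<^sup>2 * C * w n powr (- 2 * \<beta>)))"
        by (rule risk_fhat_le[OF beta _ f e K K1 Ks B(2) wpos s0 S]) (use C in auto)
      finally show "risk n (fe n) f (fhat n (fe n) Kft (w n)) \<le> ennreal (M * m n powr (-2*\<beta>))"
        unfolding const .
    qed
  qed
  then show ?thesis by blast
qed

section \<open>Perturbations in a frequency band\<close>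

lemma iexp_add: "iexp (a + b) = iexp a * iexp b"
  by (simp add: distrib_left exp_add)

lemma inv_ft_shift:
  assumes [measurable]: "G \<in> borel_measurable borel"
  shows "inv_ft (\<lambda>t. G (t - c)) x = iexp (- (c * x)) * inv_ft G x"
proof -
  have "(CLINT t|lborel. iexp (- (t * x)) * G (t - c))
    = (CLINT t|lborel. iexp (- ((c + 1 * t) * x)) * G ((c + 1 * t) - c))"
    by (subst lborel_integral_real_affine[where c=1 and t=c]) auto
  also have "\<dots> = (CLINT t|lborel. iexp (- (c * x)) * (iexp (- (t * x)) * G t))"
  proof (intro Bochner_Integration.integral_cong refl)
    fix t
    have eq: "- ((c + 1 * t) * x) = - (c * x) + - (t * x)" "c + 1 * t - c = t" by (simp_all add: algebra_simps)
    show "iexp (- ((c + 1 * t) * x)) * G (c + 1 * t - c) = iexp (- (c * x)) * (iexp (- (t * x)) * G t)"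
      by (simp only: eq iexp_add mult.assoc)
  qed
  also have "\<dots> = iexp (- (c * x)) * (CLINT t|lborel. iexp (- (t * x)) * G t)"
    by (rule integral_mult_right_zero)
  finally show ?thesis unfolding inv_ft_def by (simp only: mult.left_commute)
qed

text \<open>The transform of \<open>(\<lambda>x. iexp (- (c * x)) * fejer x)\<close> convolved with the density \<open>e\<close>. It is supported in
  the single band around \<open>c\<close>, so that \<open>ft e\<close> enters at positive frequencies only; \<open>wave c\<close> is the real
  part of the modulated kernel.\<close>

definition band :: "(real \<Rightarrow> real) \<Rightarrow> real \<Rightarrow> real \<Rightarrow> complex" where
  "band e c t = complex_of_real (triangle (t - c)) * ft e t"

lemma band_measurable [measurable]:
  assumes [measurable]: "e \<in> borel_measurable borel"
  shows "band e c \<in> borel_measurable borel"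
  unfolding band_def[abs_def] by measurable

lemma band_eq_0: "t \<notin> {c - 1..c + 1} \<Longrightarrow> band e c t = 0"
  by (auto simp: band_def tri_eq_0)

lemma inv_ft_band:
  assumes e: "prob_density e"
  shows "inv_ft (band e c) y = (CLINT u|lborel. complex_of_real (e u) * (iexp (- (c * (y - u))) * complex_of_real (fejer (y - u))))"
proof -
  have [measurable]: "e \<in> borel_measurable borel" using prob_densityD e by auto
  have inte: "integrable lborel (\<lambda>u. complex_of_real (e u))" using prob_densityD[OF e] by simp
  have trim: "integrable lborel (\<lambda>t. triangle (t - c))"
    using lborel_integrable_real_affine[OF integrable_tri, of 1 "-c"] by simp
  have F: "integrable lborel (\<lambda>t. iexp (- (t * y)) * complex_of_real (triangle (t - c)))"
    by (rule integrable_iexp_mult) (use trim in auto)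
  have "inv_ft (band e c) y = 1 / (2 * pi) * (CLINT t|lborel. (iexp (- (t * y)) * complex_of_real (triangle (t - c))) * (CLINT u|lborel. iexp (t * u) * complex_of_real (e u)))"
    by (simp only: inv_ft_def band_def ft_def mult.assoc)
  also have "(CLINT t|lborel. (iexp (- (t * y)) * complex_of_real (triangle (t - c))) * (CLINT u|lborel. iexp (t * u) * complex_of_real (e u)))
     = (CLINT u|lborel. complex_of_real (e u) * (CLINT t|lborel. iexp (t * u) * (iexp (- (t * y)) * complex_of_real (triangle (t - c)))))"
    by (rule integral_kernel_swap[OF F inte, where B=1]) auto
  also have "1 / (2 * pi) * \<dots> = (CLINT u|lborel. complex_of_real (e u) * inv_ft (\<lambda>t. complex_of_real (triangle (t - c))) (y - u))"
  proof -
    have "iexp (t * u) * (iexp (- (t * y)) * z) = iexp (- (t * (y - u))) * z" for t u z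
    proof -
      have "- (t * (y - u)) = t * u + - (t * y)" by (simp add: algebra_simps)
      then show ?thesis by (simp only: iexp_add mult.assoc)
    qed
    note this[where z="complex_of_real (triangle (_ - c))"]
    then have "(CLINT t|lborel. iexp (t * u) * (iexp (- (t * y)) * complex_of_real (triangle (t - c)))) = 2 * pi * inv_ft (\<lambda>t. complex_of_real (triangle (t - c))) (y - u)" for u
      by (simp only: inv_ft_def) simp
    then show ?thesis
      by (simp only: mult.left_commute[of "complex_of_real (e _)"] integral_mult_right_zero) simp
  qed
  also have "\<dots> = (CLINT u|lborel. complex_of_real (e u) * (iexp (- (c * (y - u))) * complex_of_real (fejer (y - u))))"
  proof -
    have "(\<lambda>t. complex_of_real (triangle t)) \<in> borel_measurable borel" by simp
    from inv_ft_shift[OF this] show ?thesis by (simp only: fejer_eq_inv_ft)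
  qed
  finally show ?thesis .
qed

definition conv :: "(real \<Rightarrow> real) \<Rightarrow> (real \<Rightarrow> real) \<Rightarrow> real \<Rightarrow> real" where
  "conv f e y = (LINT u|lborel. f (y - u) * e u)"

lemma integrable_conv:
  assumes e: "prob_density e" and [measurable]: "f \<in> borel_measurable borel" and B: "\<And>x. \<bar>f x\<bar> \<le> B"
  shows "integrable lborel (\<lambda>u. f (y - u) * e u)"
proof (rule Bochner_Integration.integrable_bound)
  note e' = prob_densityD[OF e]
  have [measurable]: "e \<in> borel_measurable borel" by (rule e')
  show "integrable lborel (\<lambda>u. B * e u)" using e' by simp
  have "0 \<le> B" using B[of 0] by linarith
  then show "AE u in lborel. norm (f (y - u) * e u) \<le> norm (B * e u)"
    using B e' by (auto simp: abs_mult intro!: mult_right_mono)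
  show "(\<lambda>u. f (y - u) * e u) \<in> borel_measurable lborel" by measurable
qed

lemma conv_measurable [measurable]:
  assumes [measurable]: "f \<in> borel_measurable borel" "e \<in> borel_measurable borel"
  shows "conv f e \<in> borel_measurable borel"
  unfolding conv_def[abs_def] by measurable

text \<open>The density \<open>e\<close> is real, so taking real parts commutes with the convolution.\<close>

lemma abs_conv_wave_le:
  assumes e: "prob_density e"
  shows "\<bar>conv (wave c) e y\<bar> \<le> cmod (inv_ft (band e c) y)"
proof -
  note e' = prob_densityD[OF e]
  have [measurable]: "e \<in> borel_measurable borel" by (rule e')
  let ?h = "\<lambda>u. complex_of_real (e u) * (iexp (- (c * (y - u))) * complex_of_real (fejer (y - u)))"
  have "integrable lborel ?h"
  proof (rule Bochner_Integration.integrable_bound)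
    show "integrable lborel (\<lambda>u. 4 * e u)" using e' by simp
    show "AE u in lborel. norm (?h u) \<le> norm (4 * e u)"
    proof (rule AE_I2)
      fix u
      have "e u * fejer (y - u) \<le> e u * 4" using e'(2) fejer_le_4 by (intro mult_left_mono)
      then show "norm (?h u) \<le> norm (4 * e u)"
        unfolding norm_mult norm_exp_imag norm_of_real using e'(2)[of u] fejer_nonneg[of "y - u"] by simp
    qed
  qed measurable
  from integral_Re[OF this] have "Re (CLINT u|lborel. ?h u) = (LINT u|lborel. Re (?h u))" by simp
  also have "\<dots> = conv (wave c) e y"
    unfolding conv_def by (intro Bochner_Integration.integral_cong refl) (simp add: wave_def Re_exp mult_ac)
  finally have "conv (wave c) e y = Re (inv_ft (band e c) y)" using inv_ft_band[OF e] by simp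
  then show ?thesis by (simp add: abs_Re_le_cmod)
qed

lemma ft_lipschitz_beyond:
  assumes "\<And>t. a \<le> t \<Longrightarrow> ft e differentiable (at t)"
    and "\<And>t. a \<le> t \<Longrightarrow> cmod (vector_derivative (ft e) (at t)) \<le> \<phi>"
    and "a \<le> s" "a \<le> t"
  shows "cmod (ft e s - ft e t) \<le> \<phi> * \<bar>s - t\<bar>"
proof -
  have "norm (ft e s - ft e t) \<le> \<phi> * norm (s - t)"
  proof (rule differentiable_bound[of "{a..}" _ "\<lambda>x h. h *\<^sub>R vector_derivative (ft e) (at x)"])
    fix x assume x: "x \<in> {a..}"
    then have "(ft e has_vector_derivative vector_derivative (ft e) (at x)) (at x)"
      using assms(1) by (simp add: vector_derivative_works)
    then show "(ft e has_derivative (\<lambda>h. h *\<^sub>R vector_derivative (ft e) (at x))) (at x within {a..})"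
      unfolding has_vector_derivative_def by (rule has_derivative_at_withinI)
    show "onorm (\<lambda>h. h *\<^sub>R vector_derivative (ft e) (at x)) \<le> \<phi>"
    proof (rule onorm_le)
      fix h
      have "\<bar>h\<bar> * cmod (vector_derivative (ft e) (at x)) \<le> \<bar>h\<bar> * \<phi>"
        using assms(2) x by (intro mult_left_mono) auto
      then show "norm (h *\<^sub>R vector_derivative (ft e) (at x)) \<le> \<phi> * norm h"
        by (simp add: mult.commute)
    qed
  qed (use assms in auto)
  then show ?thesis by simp
qed

text \<open>The product rule for Lipschitz constants on \<open>{c - 1..}\<close>. To the left of \<open>c - 1\<close> the function \<open>band\<close>
  keeps the value \<open>0\<close> that it has at \<open>c - 1\<close>, so the bound extends to the whole line.\<close>

lemma band_lipschitz:
  assumes d: "\<And>t. c - 1 \<le> t \<Longrightarrow> ft e differentiable (at t)"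
    "\<And>t. c - 1 \<le> t \<Longrightarrow> cmod (vector_derivative (ft e) (at t)) \<le> \<phi>"
    and b: "\<And>t. c - 1 \<le> t \<Longrightarrow> cmod (ft e t) \<le> \<phi>"
  shows "cmod (band e c s - band e c t) \<le> 2 * \<phi> * \<bar>s - t\<bar>"
proof -
  have "cmod (ft e c) \<le> \<phi>" by (rule b) simp
  then have \<phi>: "0 \<le> \<phi>" using norm_ge_zero[of "ft e c"] by linarith
  have main: "cmod (band e c s - band e c t) \<le> 2 * \<phi> * \<bar>s - t\<bar>" if "c - 1 \<le> s" "c - 1 \<le> t" for s t
  proof -
    have "band e c s - band e c t = complex_of_real (triangle (s - c) - triangle (t - c)) * ft e s
        + complex_of_real (triangle (t - c)) * (ft e s - ft e t)"
      by (simp add: band_def algebra_simps)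
    also have "cmod \<dots> \<le> \<bar>triangle (s - c) - triangle (t - c)\<bar> * cmod (ft e s) + \<bar>triangle (t - c)\<bar> * cmod (ft e s - ft e t)"
      by (rule order_trans[OF norm_triangle_ineq]) (simp only: norm_mult norm_of_real order_refl)
    also have "\<dots> \<le> \<bar>s - t\<bar> * \<phi> + 1 * (\<phi> * \<bar>s - t\<bar>)"
      using tri_lipschitz[of "s - c" "t - c"] tri_simps(1,2)[of "t - c"]
      by (intro add_mono mult_mono b ft_lipschitz_beyond[OF d] that) (auto intro: that)
    finally show ?thesis by (simp add: mult_ac)
  qed
  \<comment> \<open>projecting onto \<open>{c - 1..}\<close> is nonexpansive and does not change \<open>band\<close>\<close>
  have ext: "band e c u = band e c (max u (c - 1))" for u
    using band_eq_0[of u c e] by (auto simp: max_def band_def tri_eq_0)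
  have "cmod (band e c s - band e c t) \<le> 2 * \<phi> * \<bar>max s (c - 1) - max t (c - 1)\<bar>"
    by (subst ext, subst (2) ext) (rule main; simp)
  also have "\<dots> \<le> 2 * \<phi> * \<bar>s - t\<bar>"
    using \<phi> by (intro mult_left_mono) auto
  finally show ?thesis .
qed

lemma nn_integral_sq_le_of_support:
  fixes G :: "real \<Rightarrow> complex"
  assumes "a \<le> b" "0 \<le> L" and "\<And>t. cmod (G t) \<le> L" and "\<And>t. t \<notin> {a..b} \<Longrightarrow> G t = 0"
  shows "(\<integral>\<^sup>+t. ennreal ((cmod (G t))\<^sup>2) \<partial>lborel) \<le> ennreal (L\<^sup>2 * (b - a))"
proof -
  have "(\<integral>\<^sup>+t. ennreal ((cmod (G t))\<^sup>2) \<partial>lborel) \<le> (\<integral>\<^sup>+t. ennreal (L\<^sup>2) * indicator {a..b} t \<partial>lborel)"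
  proof (rule nn_integral_mono)
    fix t
    show "ennreal ((cmod (G t))\<^sup>2) \<le> ennreal (L\<^sup>2) * indicator {a..b} t"
      using assms(3)[of t] assms(4)[of t] by (cases "t \<in> {a..b}") (auto intro!: ennreal_leI power_mono)
  qed
  also have "\<dots> = ennreal (L\<^sup>2 * (b - a))"
    using assms by (simp add: nn_integral_cmult_indicator ennreal_mult)
  finally show ?thesis .
qed

lemma integrable_of_support:
  fixes G :: "real \<Rightarrow> complex"
  assumes [measurable]: "G \<in> borel_measurable borel" and "\<And>t. cmod (G t) \<le> L" and "\<And>t. t \<notin> {a..b} \<Longrightarrow> G t = 0"
  shows "integrable lborel G"
proof (rule Bochner_Integration.integrable_bound)
  show "integrable lborel (\<lambda>t. indicator {a..b} t * L)"
    by (intro integrable_mult_left integrable_real_indicator) (auto simp: emeasure_lborel_Icc_eq)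
  have "0 \<le> L" using assms(2)[of 0] norm_ge_zero order_trans by blast
  show "AE t in lborel. cmod (G t) \<le> norm (indicator {a..b} t * L)"
  proof (rule AE_I2)
    fix t
    show "cmod (G t) \<le> norm (indicator {a..b} t * L)"
      using assms(2)[of t] assms(3)[of t] \<open>0 \<le> L\<close> by (cases "t \<in> {a..b}") auto
  qed
qed simp

text \<open>The weight \<open>y\<^sup>2\<close> as a limit of difference quotients of characters.\<close>

lemma cmod_iexp_diff_quotient_tendsto:
  "(\<lambda>n. (cmod ((iexp (inverse (real (Suc n)) * y) - 1) / complex_of_real (inverse (real (Suc n)))))\<^sup>2) \<longlonglongrightarrow> y\<^sup>2"
proof -
  have "((\<lambda>z :: complex. exp (\<i> * (z * y))) has_field_derivative (\<i> * y)) (at 0)"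
    by (auto intro!: derivative_eq_intros)
  then have lim: "((\<lambda>z :: complex. (exp (\<i> * (z * y)) - 1) / z) \<longlongrightarrow> \<i> * y) (at 0)"
    by (simp add: has_field_derivative_iff)
  have "filterlim (\<lambda>n. complex_of_real (inverse (real (Suc n)))) (at 0) sequentially"
    unfolding filterlim_at
  proof (intro conjI always_eventually allI)
    show "complex_of_real (inverse (real (Suc n))) \<noteq> 0" for n
      by (simp del: of_nat_Suc)
    show "(\<lambda>n. complex_of_real (inverse (real (Suc n)))) \<longlonglongrightarrow> 0"
      using tendsto_of_real[OF LIMSEQ_inverse_real_of_nat, where 'a=complex] by (simp del: of_nat_Suc)
  qed simp
  from filterlim_compose[OF lim this]
  have "(\<lambda>n. (cmod ((exp (\<i> * (complex_of_real (inverse (real (Suc n))) * y)) - 1) / complex_of_real (inverse (real (Suc n)))))\<^sup>2) \<longlonglongrightarrow> (cmod (\<i> * y))\<^sup>2"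
    by (intro tendsto_intros)
  then show ?thesis by (simp add: norm_mult)
qed

text \<open>Plancherel for the perturbation and for \<open>y\<close> times the perturbation. Multiplication by \<open>y\<close> corresponds
  to differentiation of the transform, of which only differentiability with a bounded derivative is
  known; the derivative is therefore replaced by difference quotients, bounded by the Lipschitz
  constant, and Fatou's lemma passes to the limit.\<close>

lemma band_energy:
  assumes e: "prob_density e"
    and d: "\<And>t. c - 1 \<le> t \<Longrightarrow> ft e differentiable (at t)"
    "\<And>t. c - 1 \<le> t \<Longrightarrow> cmod (vector_derivative (ft e) (at t)) \<le> \<phi>"
    and b: "\<And>t. c - 1 \<le> t \<Longrightarrow> cmod (ft e t) \<le> \<phi>"
  shows "(\<integral>\<^sup>+y. ennreal ((1 + y\<^sup>2) * (conv (wave c) e y)\<^sup>2) \<partial>lborel) \<le> ennreal (3 * \<phi>\<^sup>2)"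
proof -
  let ?d = "\<lambda>n y. cmod ((iexp (inverse (real (Suc n)) * y) - 1) / complex_of_real (inverse (real (Suc n))))"
  have [measurable]: "e \<in> borel_measurable borel" using prob_densityD e by auto
  have "cmod (ft e c) \<le> \<phi>" by (rule b) simp
  then have \<phi>: "0 \<le> \<phi>" using norm_ge_zero[of "ft e c"] by linarith
  let ?G = "band e c" and ?z = "inv_ft (band e c)"
  have Gle: "cmod (?G t) \<le> \<phi>" for t
  proof (cases "c - 1 \<le> t")
    case True
    have "cmod (?G t) \<le> 1 * \<phi>"
      unfolding band_def norm_mult norm_of_real using tri_simps(1,2)[of "t - c"] True
      by (intro mult_mono b) auto
    then show ?thesis by simp
  next
    case False
    then have "?G t = 0" by (intro band_eq_0) auto
    then show ?thesis using \<phi> by (simp only: norm_zero)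
  qed
  have intG: "integrable lborel ?G"
    by (rule integrable_of_support[OF _ Gle band_eq_0]) simp
  have [measurable]: "?z \<in> borel_measurable borel"
    by (rule borel_measurable_continuous_onI[OF continuous_inv_ft[OF intG]])
  have z0: "(\<integral>\<^sup>+y. ennreal ((cmod (?z y))\<^sup>2) \<partial>lborel) \<le> ennreal (\<phi>\<^sup>2)"
  proof -
    have "(\<integral>\<^sup>+y. ennreal ((cmod (?z y))\<^sup>2) \<partial>lborel) \<le> ennreal (1 / (2 * pi)) * ennreal (\<phi>\<^sup>2 * ((c + 1) - (c - 1)))"
      by (intro order_trans[OF plancherel_le[OF intG]] mult_left_mono nn_integral_sq_le_of_support Gle \<phi>)
        (auto intro: band_eq_0)
    also have "\<dots> = ennreal (\<phi>\<^sup>2 / pi)" by (subst ennreal_mult[symmetric]) auto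
    also have "\<dots> \<le> ennreal (\<phi>\<^sup>2)"
    proof (rule ennreal_leI)
      have "\<phi>\<^sup>2 * 1 \<le> \<phi>\<^sup>2 * pi" using pi_gt3 by (intro mult_left_mono) auto
      then show "\<phi>\<^sup>2 / pi \<le> \<phi>\<^sup>2" by (simp add: pos_divide_le_eq)
    qed
    finally show ?thesis .
  qed
  have z1: "(\<integral>\<^sup>+y. ennreal (y\<^sup>2 * (cmod (?z y))\<^sup>2) \<partial>lborel) \<le> ennreal (2 * \<phi>\<^sup>2)"
  proof (rule nn_integral_le_of_tendsto[where u="\<lambda>n y. ennreal ((?d n y)\<^sup>2 * (cmod (?z y))\<^sup>2)"])
    fix y :: real
    show "(\<lambda>n. ennreal ((?d n y)\<^sup>2 * (cmod (?z y))\<^sup>2))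
      \<longlonglongrightarrow> ennreal (y\<^sup>2 * (cmod (?z y))\<^sup>2)"
      by (intro tendsto_ennrealI tendsto_mult tendsto_const cmod_iexp_diff_quotient_tendsto)
  next
    fix n
    define \<delta> where "\<delta> = inverse (real (Suc n))"
    have \<delta>: "0 < \<delta>" "\<delta> \<le> 1" by (auto simp: \<delta>_def inverse_le_1_iff)
    \<comment> \<open>the difference quotient of the transform; its inverse transform is \<open>?z\<close> times that of the character\<close>
    define D where "D = (\<lambda>t. (?G (t - (- \<delta>)) - ?G t) / complex_of_real \<delta>)"
    have [measurable]: "D \<in> borel_measurable borel" unfolding D_def by measurable
    have Dle: "cmod (D t) \<le> 2 * \<phi>" for t
    proof -
      have "cmod (?G (t - (- \<delta>)) - ?G t) \<le> 2 * \<phi> * \<delta>"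
        using band_lipschitz[where c=c and e=e and \<phi>=\<phi> and s="t - (- \<delta>)" and t=t, OF d b] \<delta> by simp
      then show ?thesis using \<delta> by (simp add: D_def norm_divide pos_divide_le_eq)
    qed
    have D0: "D t = 0" if "t \<notin> {c - 2..c + 1}" for t
      using that \<delta> by (auto simp: D_def band_eq_0)
    have intD: "integrable lborel D" by (rule integrable_of_support[OF _ Dle D0]) simp
    have intG': "integrable lborel (\<lambda>t. ?G (t - (- \<delta>)))"
      using lborel_integrable_real_affine[OF intG, of 1 \<delta>] by (simp add: add.commute)
    have invD: "inv_ft D y = (iexp (\<delta> * y) - 1) / complex_of_real \<delta> * ?z y" for y
    proof -
      have "inv_ft D y = (inv_ft (\<lambda>t. ?G (t - (- \<delta>))) y - ?z y) / complex_of_real \<delta>"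
      proof -
        have "(CLINT t|lborel. iexp (- (t * y)) * D t)
          = (CLINT t|lborel. (iexp (- (t * y)) * ?G (t - (- \<delta>)) - iexp (- (t * y)) * ?G t) / complex_of_real \<delta>)"
          by (simp only: D_def times_divide_eq_right right_diff_distrib)
        also have "\<dots> = ((CLINT t|lborel. iexp (- (t * y)) * ?G (t - (- \<delta>))) - (CLINT t|lborel. iexp (- (t * y)) * ?G t)) / complex_of_real \<delta>"
        proof -
          have "integrable lborel (\<lambda>t. iexp (- (t * y)) * ?G (t - (- \<delta>)))" "integrable lborel (\<lambda>t. iexp (- (t * y)) * ?G t)"
            by (rule integrable_iexp_mult[OF intG'], simp, rule integrable_iexp_mult[OF intG], simp)
          then show ?thesis by (simp only: integral_divide_zero Bochner_Integration.integral_diff)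
        qed
        finally show ?thesis unfolding inv_ft_def by (simp only: times_divide_eq_right right_diff_distrib)
      qed
      also have "inv_ft (\<lambda>t. ?G (t - (- \<delta>))) y = iexp (- (- \<delta> * y)) * ?z y"
        by (rule inv_ft_shift) simp
      finally show ?thesis by (simp add: left_diff_distrib)
    qed
    have "(\<integral>\<^sup>+y. ennreal ((cmod ((iexp (\<delta> * y) - 1) / complex_of_real \<delta>))\<^sup>2 * (cmod (?z y))\<^sup>2) \<partial>lborel)
      = (\<integral>\<^sup>+y. ennreal ((cmod (inv_ft D y))\<^sup>2) \<partial>lborel)"
      by (simp only: invD norm_mult power_mult_distrib)
    also have "\<dots> \<le> ennreal (1 / (2 * pi)) * ennreal ((2 * \<phi>)\<^sup>2 * ((c + 1) - (c - 2)))"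
      by (intro order_trans[OF plancherel_le[OF intD]] mult_left_mono nn_integral_sq_le_of_support Dle D0)
        (use \<phi> in auto)
    also have "\<dots> = ennreal (6 * \<phi>\<^sup>2 / pi)"
      by (subst ennreal_mult[symmetric]) (auto simp: power_mult_distrib)
    also have "\<dots> \<le> ennreal (2 * \<phi>\<^sup>2)"
    proof (rule ennreal_leI)
      have "6 * \<phi>\<^sup>2 \<le> (2 * \<phi>\<^sup>2) * pi"
        using mult_left_mono[of 3 pi "2 * \<phi>\<^sup>2"] pi_gt3 by simp
      then show "6 * \<phi>\<^sup>2 / pi \<le> 2 * \<phi>\<^sup>2" by (simp add: pos_divide_le_eq)
    qed
    finally show "(\<integral>\<^sup>+y. ennreal ((?d n y)\<^sup>2 * (cmod (?z y))\<^sup>2) \<partial>lborel) \<le> ennreal (2 * \<phi>\<^sup>2)"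
      unfolding \<delta>_def .
  qed measurable
  have "(\<integral>\<^sup>+y. ennreal ((1 + y\<^sup>2) * (conv (wave c) e y)\<^sup>2) \<partial>lborel)
    \<le> (\<integral>\<^sup>+y. ennreal ((cmod (?z y))\<^sup>2) + ennreal (y\<^sup>2 * (cmod (?z y))\<^sup>2) \<partial>lborel)"
  proof (rule nn_integral_mono)
    fix y
    have "(conv (wave c) e y)\<^sup>2 \<le> (cmod (?z y))\<^sup>2"
      using abs_conv_wave_le[OF e] by (simp add: abs_le_square_iff[symmetric])
    then have "(1 + y\<^sup>2) * (conv (wave c) e y)\<^sup>2 \<le> (1 + y\<^sup>2) * (cmod (?z y))\<^sup>2"
      by (intro mult_left_mono) auto
    then have "ennreal ((1 + y\<^sup>2) * (conv (wave c) e y)\<^sup>2) \<le> ennreal ((cmod (?z y))\<^sup>2 + y\<^sup>2 * (cmod (?z y))\<^sup>2)"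
      by (intro ennreal_leI) (simp add: distrib_right)
    then show "ennreal ((1 + y\<^sup>2) * (conv (wave c) e y)\<^sup>2) \<le> ennreal ((cmod (?z y))\<^sup>2) + ennreal (y\<^sup>2 * (cmod (?z y))\<^sup>2)"
      by (subst ennreal_plus[symmetric]) auto
  qed
  also have "\<dots> = (\<integral>\<^sup>+y. ennreal ((cmod (?z y))\<^sup>2) \<partial>lborel) + (\<integral>\<^sup>+y. ennreal (y\<^sup>2 * (cmod (?z y))\<^sup>2) \<partial>lborel)"
    by (rule nn_integral_add) auto
  also have "\<dots> \<le> ennreal (\<phi>\<^sup>2) + ennreal (2 * \<phi>\<^sup>2)" by (rule add_mono[OF z0 z1])
  also have "\<dots> = ennreal (3 * \<phi>\<^sup>2)" by (subst ennreal_plus[symmetric]) auto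
  finally show ?thesis .
qed

section \<open>Chi-square bounds and two-point testing\<close>

lemma conv_nonneg:
  assumes "prob_density e" "\<And>x. 0 \<le> f x"
  shows "0 \<le> conv f e y"
  unfolding conv_def using prob_densityD(2)[OF assms(1)] assms(2) by (intro integral_nonneg_AE) auto

text \<open>On the event \<open>\<bar>u\<bar> \<le> \<alpha>\<close> the shift by \<open>u\<close> changes the weight \<open>1 + y\<^sup>2\<close> by a factor of at most
  \<open>2 + 2 * \<alpha>\<^sup>2\<close>.\<close>

lemma conv_lower:
  assumes e: "prob_density e" and [measurable]: "f \<in> borel_measurable borel"
    and B: "\<And>x. \<bar>f x\<bar> \<le> B" and low: "\<And>x. \<kappa> * inverse (1 + x\<^sup>2) \<le> f x" and \<kappa>: "0 \<le> \<kappa>"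
    and C0: "C0 \<le> measure (density lborel e) {u. \<bar>u\<bar> \<le> \<alpha>}"
  shows "\<kappa> * C0 / (2 + 2 * \<alpha>\<^sup>2) * inverse (1 + y\<^sup>2) \<le> conv f e y"
proof -
  note e' = prob_densityD[OF e]
  have [measurable]: "e \<in> borel_measurable borel" by (rule e')
  interpret E: prob_space "density lborel e" by (rule prob_space_density_lborel[OF e])
  let ?A = "{u::real. \<bar>u\<bar> \<le> \<alpha>}"
  define c where "c = \<kappa> / (2 + 2 * \<alpha>\<^sup>2) * inverse (1 + y\<^sup>2)"
  have pos: "0 < 1 + x\<^sup>2" "0 < 2 + 2 * x\<^sup>2" for x :: real by (simp_all add: add_pos_nonneg)
  have c0: "0 \<le> c" unfolding c_def using \<kappa> pos[of y] pos[of \<alpha>] by (intro mult_nonneg_nonneg divide_nonneg_nonneg) auto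
  have f0: "0 \<le> f x" for x
  proof -
    have "0 \<le> \<kappa> * inverse (1 + x\<^sup>2)" using \<kappa> pos[of x] by simp
    then show ?thesis using low[of x] by linarith
  qed
  have mA: "measure (density lborel e) ?A = (LINT u|lborel. e u * indicator ?A u)"
  proof -
    have "measure (density lborel e) ?A = (LINT u|density lborel e. indicator ?A u)" by simp
    also have "\<dots> = (LINT u|lborel. e u * indicator ?A u)"
      by (subst integral_density) (use e' in auto)
    finally show ?thesis .
  qed
  have "\<kappa> * C0 / (2 + 2 * \<alpha>\<^sup>2) * inverse (1 + y\<^sup>2) = c * C0"
    unfolding c_def by (simp only: divide_inverse mult_ac)
  also have "\<dots> \<le> c * (LINT u|lborel. e u * indicator ?A u)"
    unfolding mA[symmetric] by (rule mult_left_mono[OF C0 c0])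
  also have "\<dots> = (LINT u|lborel. c * (e u * indicator ?A u))" by simp
  also have "\<dots> \<le> conv f e y"
    unfolding conv_def
  proof (rule integral_mono)
    show "integrable lborel (\<lambda>u. f (y - u) * e u)" by (rule integrable_conv[OF e _ B]) simp
    show "integrable lborel (\<lambda>u. c * (e u * indicator ?A u))"
      by (intro integrable_mult_right integrable_real_mult_indicator e'(3)) simp
    fix u
    show "c * (e u * indicator ?A u) \<le> f (y - u) * e u"
    proof (cases "\<bar>u\<bar> \<le> \<alpha>")
      case True
      then have "u\<^sup>2 \<le> \<alpha>\<^sup>2" by (simp add: abs_le_square_iff[symmetric])
      moreover have "(y - u)\<^sup>2 \<le> 2 * y\<^sup>2 + 2 * u\<^sup>2"
        using zero_le_power2[of "y + u"] by (simp add: power2_sum power2_diff)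
      moreover have "0 \<le> \<alpha>\<^sup>2 * y\<^sup>2" by simp
      moreover have "(2 + 2 * \<alpha>\<^sup>2) * (1 + y\<^sup>2) = 2 + 2 * \<alpha>\<^sup>2 + 2 * y\<^sup>2 + 2 * (\<alpha>\<^sup>2 * y\<^sup>2)"
        by (simp add: algebra_simps)
      ultimately have "1 + (y - u)\<^sup>2 \<le> (2 + 2 * \<alpha>\<^sup>2) * (1 + y\<^sup>2)" by argo
      then have "inverse ((2 + 2 * \<alpha>\<^sup>2) * (1 + y\<^sup>2)) \<le> inverse (1 + (y - u)\<^sup>2)"
        using pos(1)[of "y - u"] by (rule le_imp_inverse_le)
      then have "\<kappa> * inverse ((2 + 2 * \<alpha>\<^sup>2) * (1 + y\<^sup>2)) \<le> \<kappa> * inverse (1 + (y - u)\<^sup>2)"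
        using \<kappa> by (rule mult_left_mono)
      also have "\<dots> \<le> f (y - u)" by (rule low)
      finally have "c \<le> f (y - u)" by (simp only: c_def divide_inverse inverse_mult_distrib mult.assoc)
      then show ?thesis using e'(2)[of u] True by (simp add: mult_right_mono)
    qed (use f0 e'(2) in simp)
  qed
  finally show ?thesis .
qed

lemma convolution_eq_density_conv:
  assumes f: "prob_density f" and e: "prob_density e" and B: "\<And>x. \<bar>f x\<bar> \<le> B"
  shows "density lborel f \<star> density lborel e = density lborel (conv f e)"
proof -
  note f' = prob_densityD[OF f] and e' = prob_densityD[OF e]
  have [measurable]: "f \<in> borel_measurable borel" "e \<in> borel_measurable borel" by (rule f', rule e')
  have "density lborel f \<star> density lborel e = density lborel (\<lambda>y. \<integral>\<^sup>+u. ennreal (f (y - u)) * ennreal (e u) \<partial>lborel)"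
    by (rule convolution_density) (auto intro!: prob_space.finite_measure prob_space_density_lborel f e)
  also have "(\<lambda>y. \<integral>\<^sup>+u. ennreal (f (y - u)) * ennreal (e u) \<partial>lborel) = (\<lambda>y. ennreal (conv f e y))"
  proof
    fix y
    have "(\<integral>\<^sup>+u. ennreal (f (y - u)) * ennreal (e u) \<partial>lborel) = (\<integral>\<^sup>+u. ennreal (f (y - u) * e u) \<partial>lborel)"
      using f' e' by (simp add: ennreal_mult)
    also have "\<dots> = ennreal (conv f e y)"
      unfolding conv_def using f' e'
      by (intro nn_integral_eq_integral integrable_conv[OF e _ B]) auto
    finally show "(\<integral>\<^sup>+u. ennreal (f (y - u)) * ennreal (e u) \<partial>lborel) = ennreal (conv f e y)" .
  qed
  finally show ?thesis .
qed

lemma prob_densityI_density: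
  assumes [measurable]: "p \<in> borel_measurable borel" and p0: "\<And>x. 0 \<le> p x" and ps: "prob_space (density lborel p)"
  shows "prob_density p"
proof -
  interpret prob_space "density lborel p" by (rule ps)
  have "(\<integral>\<^sup>+x. ennreal (p x) \<partial>lborel) = 1"
    using emeasure_space_1 by (simp add: emeasure_density)
  then have "has_bochner_integral lborel p 1"
    by (intro has_bochner_integral_nn_integral) (auto simp: p0)
  then show ?thesis by (simp add: prob_density_def p0)
qed

lemma prob_density_conv:
  assumes f: "prob_density f" and e: "prob_density e" and B: "\<And>x. \<bar>f x\<bar> \<le> B"
  shows "prob_density (conv f e)"
proof (rule prob_densityI_density)
  have [measurable]: "f \<in> borel_measurable borel" "e \<in> borel_measurable borel" using prob_densityD f e by auto
  show "conv f e \<in> borel_measurable borel" by simp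
  show "0 \<le> conv f e x" for x using conv_nonneg[OF e] prob_densityD(2)[OF f] by simp
  show "prob_space (density lborel (conv f e))"
    using prob_space_convolution[OF f e] convolution_eq_density_conv[OF f e B] by simp
qed

text \<open>Expanding \<open>q\<^sup>2 / p = 2 q - p + (q - p)\<^sup>2 / p\<close>, the linear terms integrate to exactly \<open>1\<close>. This
  matters since the bound will be multiplied over the whole sample.\<close>

lemma chi_square_le:
  assumes p: "prob_density p" and q: "prob_density q" and [measurable]: "v \<in> borel_measurable borel"
    and q_eq: "\<And>y. q y = p y + a * v y"
    and low: "\<And>y. \<kappa> * inverse (1 + y\<^sup>2) \<le> p y" and \<kappa>: "0 < \<kappa>" and V0: "0 \<le> V"
    and V: "(\<integral>\<^sup>+y. ennreal ((1 + y\<^sup>2) * (v y)\<^sup>2) \<partial>lborel) \<le> ennreal V"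
  shows "(\<integral>\<^sup>+y. ennreal ((q y)\<^sup>2 / p y) \<partial>lborel) \<le> ennreal (1 + a\<^sup>2 * V / \<kappa>)"
proof -
  note p' = prob_densityD[OF p] and q' = prob_densityD[OF q]
  have pos: "0 < 1 + y\<^sup>2" for y :: real by (simp add: add_pos_nonneg)
  define g where "g = (\<lambda>y. a\<^sup>2 / \<kappa> * ((1 + y\<^sup>2) * (v y)\<^sup>2))"
  have g0: "0 \<le> g y" for y using \<kappa> pos[of y] by (simp add: g_def)
  have [measurable]: "g \<in> borel_measurable borel" unfolding g_def by measurable
  have "(\<integral>\<^sup>+y. ennreal (g y) \<partial>lborel) = ennreal (a\<^sup>2 / \<kappa>) * (\<integral>\<^sup>+y. ennreal ((1 + y\<^sup>2) * (v y)\<^sup>2) \<partial>lborel)"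
  proof -
    have "ennreal (g y) = ennreal (a\<^sup>2 / \<kappa>) * ennreal ((1 + y\<^sup>2) * (v y)\<^sup>2)" for y
      unfolding g_def using \<kappa> pos[of y] by (intro ennreal_mult mult_nonneg_nonneg) auto
    then show ?thesis by (simp only:) (rule nn_integral_cmult, measurable)
  qed
  also have "\<dots> \<le> ennreal (a\<^sup>2 / \<kappa>) * ennreal V" by (rule mult_left_mono[OF V]) simp
  also have "\<dots> = ennreal (a\<^sup>2 * V / \<kappa>)" using \<kappa> V0 by (subst ennreal_mult[symmetric]) auto
  finally have nng: "(\<integral>\<^sup>+y. ennreal (g y) \<partial>lborel) \<le> ennreal (a\<^sup>2 * V / \<kappa>)" .
  have intg: "integrable lborel g"
    by (rule integrableI_bounded) (use g0 nng in \<open>auto simp: less_top[symmetric] top_unique\<close>)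
  have "ennreal (LINT y|lborel. g y) \<le> ennreal (a\<^sup>2 * V / \<kappa>)"
    using nng by (subst (asm) nn_integral_eq_integral[OF intg]) (auto simp: g0)
  then have LINTg: "(LINT y|lborel. g y) \<le> a\<^sup>2 * V / \<kappa>"
    using \<kappa> V0 by (simp add: ennreal_le_iff)
  have pt: "(q y)\<^sup>2 / p y \<le> 2 * q y - p y + g y" for y
  proof -
    have lpos: "0 < \<kappa> * inverse (1 + y\<^sup>2)" using \<kappa> pos[of y] by simp
    then have pp: "0 < p y" using low[of y] by linarith
    have "(q y)\<^sup>2 / p y = 2 * q y - p y + a\<^sup>2 * (v y)\<^sup>2 / p y"
      using pp by (simp add: q_eq field_simps power2_eq_square)
    also have "a\<^sup>2 * (v y)\<^sup>2 / p y \<le> a\<^sup>2 * (v y)\<^sup>2 / (\<kappa> * inverse (1 + y\<^sup>2))"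
      using low[of y] lpos pp by (intro divide_left_mono) auto
    also have "\<dots> = g y" using \<kappa> pos[of y] by (simp add: g_def field_simps)
    finally show ?thesis by simp
  qed
  have int: "integrable lborel (\<lambda>y. 2 * q y - p y + g y)"
    by (intro Bochner_Integration.integrable_add Bochner_Integration.integrable_diff integrable_mult_right p'(3) q'(3) intg)
  have "(\<integral>\<^sup>+y. ennreal ((q y)\<^sup>2 / p y) \<partial>lborel) \<le> (\<integral>\<^sup>+y. ennreal (2 * q y - p y + g y) \<partial>lborel)"
    by (intro nn_integral_mono ennreal_leI pt)
  also have "\<dots> = ennreal (LINT y|lborel. 2 * q y - p y + g y)"
  proof (rule nn_integral_eq_integral[OF int], rule AE_I2)
    fix y
    have "0 \<le> (q y)\<^sup>2 / p y" using p'(2)[of y] by simp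
    then show "0 \<le> 2 * q y - p y + g y" using pt[of y] by linarith
  qed
  also have "(LINT y|lborel. 2 * q y - p y + g y) = 1 + (LINT y|lborel. g y)"
    by (simp only: Bochner_Integration.integral_add[OF Bochner_Integration.integrable_diff[OF integrable_mult_right[OF q'(3)] p'(3)] intg]
        Bochner_Integration.integral_diff[OF integrable_mult_right[OF q'(3)] p'(3)] integral_mult_right_zero p'(4) q'(4))
  also have "ennreal (1 + (LINT y|lborel. g y)) \<le> ennreal (1 + a\<^sup>2 * V / \<kappa>)"
    using LINTg by (intro ennreal_leI) simp
  finally show ?thesis .
qed

lemma PiM_density_prod:
  fixes r :: "'i \<Rightarrow> 'a \<Rightarrow> ennreal"
  assumes I: "finite I" and M: "\<And>j. prob_space (M j)" and N: "\<And>j. prob_space (density (M j) (r j))"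
    and r[measurable]: "\<And>j. r j \<in> borel_measurable (M j)"
  shows "Pi\<^sub>M I (\<lambda>j. density (M j) (r j)) = density (Pi\<^sub>M I M) (\<lambda>y. \<Prod>j\<in>I. r j (y j))"
proof -
  interpret M: product_prob_space M I by (intro product_prob_spaceI M)
  interpret N: product_prob_space "\<lambda>j. density (M j) (r j)" I by (intro product_prob_spaceI N)
  have comp: "(\<lambda>y. r j (y j)) \<in> borel_measurable (Pi\<^sub>M I M)" if "j \<in> I" for j
    by (rule measurable_compose[OF measurable_component_singleton[OF that] r])
  have Rm: "(\<lambda>y. \<Prod>j\<in>I. r j (y j)) \<in> borel_measurable (Pi\<^sub>M I M)"
    by (intro borel_measurable_prod_ennreal comp)
  show ?thesis
  proof (rule N.PiM_eqI[symmetric, OF I])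
    show "sets (density (Pi\<^sub>M I M) (\<lambda>y. \<Prod>j\<in>I. r j (y j))) = sets (Pi\<^sub>M I (\<lambda>j. density (M j) (r j)))"
      by (simp cong: sets_PiM_cong)
    fix A assume "\<And>j. j \<in> I \<Longrightarrow> A j \<in> sets (density (M j) (r j))"
    then have A: "\<And>j. j \<in> I \<Longrightarrow> A j \<in> sets (M j)" by simp
    have box: "Pi\<^sub>E I A \<in> sets (Pi\<^sub>M I M)" by (intro sets_PiM_I_finite I A)
    have "emeasure (density (Pi\<^sub>M I M) (\<lambda>y. \<Prod>j\<in>I. r j (y j))) (Pi\<^sub>E I A)
      = (\<integral>\<^sup>+y. (\<Prod>j\<in>I. r j (y j)) * indicator (Pi\<^sub>E I A) y \<partial>Pi\<^sub>M I M)"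
      by (rule emeasure_density[OF Rm box])
    also have "\<dots> = (\<integral>\<^sup>+y. (\<Prod>j\<in>I. r j (y j) * indicator (A j) (y j)) \<partial>Pi\<^sub>M I M)"
    proof (rule nn_integral_cong)
      fix y assume y: "y \<in> space (Pi\<^sub>M I M)"
      have "indicator (Pi\<^sub>E I A) y = (\<Prod>j\<in>I. indicator (A j) (y j) :: ennreal)"
      proof (cases "\<forall>j\<in>I. y j \<in> A j")
        case True
        then have "y \<in> Pi\<^sub>E I A" using y by (auto simp: space_PiM PiE_iff)
        then show ?thesis using True by (simp add: prod.neutral)
      next
        case False
        then obtain j where j: "j \<in> I" "indicator (A j) (y j) = (0 :: ennreal)"
          by (auto simp: indicator_def)
        then have "(\<Prod>j\<in>I. indicator (A j) (y j) :: ennreal) = 0"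
          using I by (intro prod_zero) blast+
        then show ?thesis using False by (auto simp: indicator_def PiE_iff)
      qed
      then show "(\<Prod>j\<in>I. r j (y j)) * indicator (Pi\<^sub>E I A) y = (\<Prod>j\<in>I. r j (y j) * indicator (A j) (y j))"
        by (simp only: prod.distrib)
    qed
    also have "\<dots> = (\<Prod>j\<in>I. \<integral>\<^sup>+x. r j x * indicator (A j) x \<partial>M j)"
      by (intro M.product_nn_integral_prod I borel_measurable_times_ennreal r borel_measurable_indicator A)
    also have "\<dots> = (\<Prod>j\<in>I. emeasure (density (M j) (r j)) (A j))"
      by (intro prod.cong refl emeasure_density[symmetric] r A)
    finally show "emeasure (density (Pi\<^sub>M I M) (\<lambda>y. \<Prod>j\<in>I. r j (y j))) (Pi\<^sub>E I A)
      = (\<Prod>j\<in>I. emeasure (density (M j) (r j)) (A j))" .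
  qed
qed

text \<open>The two-point method with a chi-square bound. Minimising over \<open>b\<close> pointwise gives
  \<open>b\<^sup>2 + R * (b - a)\<^sup>2 \<ge> a\<^sup>2 * R / (1 + R)\<close>. The function \<open>1 / (1 + R)\<close> is convex and therefore lies above
  \<open>2 l - l\<^sup>2 * (1 + R)\<close> for every \<open>l\<close>, and integrating this against \<open>R\<close> brings in only the first two
  moments of \<open>R\<close>.\<close>

lemma two_point_bound:
  assumes P: "prob_space P" and [measurable]: "R \<in> borel_measurable P" "b \<in> borel_measurable P"
    and R0: "\<And>y. 0 \<le> R y" and R1: "(\<integral>\<^sup>+y. ennreal (R y) \<partial>P) = 1"
    and R2: "(\<integral>\<^sup>+y. ennreal ((R y)\<^sup>2) \<partial>P) \<le> ennreal M" and M: "0 \<le> M"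
  shows "ennreal (a\<^sup>2 / (1 + M)) \<le> (\<integral>\<^sup>+y. ennreal ((b y)\<^sup>2) \<partial>P) + (\<integral>\<^sup>+y. ennreal ((b y - a)\<^sup>2) \<partial>density P (\<lambda>y. ennreal (R y)))"
proof -
  \<comment> \<open>the optimal slope of the tangent bound for \<open>1 / (1 + R)\<close>\<close>
  define l where "l = 1 / (1 + M)"
  have l: "0 < l" "l * (1 + M) = 1" using M by (auto simp: l_def)
  let ?X = "(\<integral>\<^sup>+y. ennreal ((b y)\<^sup>2) \<partial>P) + (\<integral>\<^sup>+y. ennreal ((b y - a)\<^sup>2) \<partial>density P (\<lambda>y. ennreal (R y)))"
  have pt: "2 * a\<^sup>2 * l * R y \<le> (b y)\<^sup>2 + R y * (b y - a)\<^sup>2 + a\<^sup>2 * l\<^sup>2 * (R y + (R y)\<^sup>2)" for y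
  proof -
    have r: "0 < 1 + R y" using R0[of y] by linarith
    have id: "((b y)\<^sup>2 + R y * (b y - a)\<^sup>2) * (1 + R y) = ((1 + R y) * b y - R y * a)\<^sup>2 + R y * a\<^sup>2"
      by (simp add: power2_eq_square algebra_simps)
    then have "R y * a\<^sup>2 \<le> ((b y)\<^sup>2 + R y * (b y - a)\<^sup>2) * (1 + R y)" by simp
    then have 1: "R y * a\<^sup>2 / (1 + R y) \<le> (b y)\<^sup>2 + R y * (b y - a)\<^sup>2"
      using r by (simp add: pos_divide_le_eq)
    have "0 \<le> a\<^sup>2 * R y * (1 - l * (1 + R y))\<^sup>2" using R0 by simp
    also have "\<dots> = a\<^sup>2 * R y - (2 * a\<^sup>2 * l * R y - a\<^sup>2 * l\<^sup>2 * (R y + (R y)\<^sup>2)) * (1 + R y)"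
      by (simp add: power2_eq_square algebra_simps)
    finally have "2 * a\<^sup>2 * l * R y - a\<^sup>2 * l\<^sup>2 * (R y + (R y)\<^sup>2) \<le> R y * a\<^sup>2 / (1 + R y)"
      using r by (simp add: pos_le_divide_eq mult.commute)
    with 1 show ?thesis by linarith
  qed
  have "ennreal (2 * a\<^sup>2 * l) = (\<integral>\<^sup>+y. ennreal (2 * a\<^sup>2 * l) * ennreal (R y) \<partial>P)"
    using R1 by (simp add: nn_integral_cmult)
  also have "\<dots> \<le> (\<integral>\<^sup>+y. (ennreal ((b y)\<^sup>2) + ennreal (R y) * ennreal ((b y - a)\<^sup>2)) + ennreal (a\<^sup>2 * l\<^sup>2) * (ennreal (R y) + ennreal ((R y)\<^sup>2)) \<partial>P)"
  proof (rule nn_integral_mono)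
    fix y
    have "ennreal (2 * a\<^sup>2 * l) * ennreal (R y) = ennreal (2 * a\<^sup>2 * l * R y)"
      using l R0 by (simp add: ennreal_mult)
    also have "\<dots> \<le> ennreal ((b y)\<^sup>2 + R y * (b y - a)\<^sup>2 + a\<^sup>2 * l\<^sup>2 * (R y + (R y)\<^sup>2))"
      by (rule ennreal_leI[OF pt])
    also have "\<dots> = (ennreal ((b y)\<^sup>2) + ennreal (R y) * ennreal ((b y - a)\<^sup>2)) + ennreal (a\<^sup>2 * l\<^sup>2) * (ennreal (R y) + ennreal ((R y)\<^sup>2))"
      using R0 by (simp add: ennreal_mult ennreal_plus)
    finally show "ennreal (2 * a\<^sup>2 * l) * ennreal (R y) \<le> (ennreal ((b y)\<^sup>2) + ennreal (R y) * ennreal ((b y - a)\<^sup>2)) + ennreal (a\<^sup>2 * l\<^sup>2) * (ennreal (R y) + ennreal ((R y)\<^sup>2))" .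
  qed
  also have "\<dots> = ?X + ennreal (a\<^sup>2 * l\<^sup>2) * ((\<integral>\<^sup>+y. ennreal (R y) \<partial>P) + (\<integral>\<^sup>+y. ennreal ((R y)\<^sup>2) \<partial>P))"
    by (simp add: nn_integral_add nn_integral_cmult nn_integral_density)
  also have "\<dots> \<le> ?X + ennreal (a\<^sup>2 * l\<^sup>2) * (1 + ennreal M)"
    using R1 R2 by (intro add_left_mono mult_left_mono add_mono) auto
  also have "ennreal (a\<^sup>2 * l\<^sup>2) * (1 + ennreal M) = ennreal (a\<^sup>2 * l)"
  proof -
    have "1 + ennreal M = ennreal (1 + M)" using M by simp
    then have "ennreal (a\<^sup>2 * l\<^sup>2) * (1 + ennreal M) = ennreal (a\<^sup>2 * l\<^sup>2) * ennreal (1 + M)"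
      by (rule arg_cong)
    also have "\<dots> = ennreal (a\<^sup>2 * l\<^sup>2 * (1 + M))"
      using M by (intro ennreal_mult[symmetric]) auto
    also have "a\<^sup>2 * l\<^sup>2 * (1 + M) = a\<^sup>2 * l * (l * (1 + M))" by (simp only: power2_eq_square mult_ac)
    finally show ?thesis by (simp only: l(2) mult_1_right)
  qed
  finally have fin: "ennreal (2 * a\<^sup>2 * l) \<le> ?X + ennreal (a\<^sup>2 * l)" .
  have "ennreal (2 * a\<^sup>2 * l) = ennreal (a\<^sup>2 * l) + ennreal (a\<^sup>2 * l)"
    using l(1) by (subst ennreal_plus[symmetric]) auto
  with fin have "ennreal (a\<^sup>2 * l) + ennreal (a\<^sup>2 * l) \<le> ?X + ennreal (a\<^sup>2 * l)" by simp
  then have "ennreal (a\<^sup>2 * l) + ennreal (a\<^sup>2 * l) \<le> ennreal (a\<^sup>2 * l) + ?X"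
    by (subst (2) add.commute)
  then have "ennreal (a\<^sup>2 * l) \<le> ?X"
    unfolding ennreal_add_left_cancel_le by simp
  then show ?thesis by (simp only: l_def times_divide_eq_right mult_1_right)
qed

text \<open>The second moment of the likelihood ratio of the sample is a product of factors \<open>1 + x j \<le> exp (x j)\<close>,
  so it stays bounded as long as the sum of the chi-square distances does.\<close>

lemma product_two_point_bound:
  fixes p q :: "'i \<Rightarrow> real \<Rightarrow> real"
  assumes I: "finite I" and p: "\<And>j. prob_density (p j)" and q: "\<And>j. prob_density (q j)"
    and ppos: "\<And>j y. 0 < p j y"
    and chi: "\<And>j. j \<in> I \<Longrightarrow> (\<integral>\<^sup>+y. ennreal ((q j y)\<^sup>2 / p j y) \<partial>lborel) \<le> ennreal (1 + x j)"
    and x0: "\<And>j. 0 \<le> x j" and X: "(\<Sum>j\<in>I. x j) \<le> X"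
    and b: "b \<in> borel_measurable (Pi\<^sub>M I (\<lambda>_. borel))"
  shows "ennreal (a\<^sup>2 / (1 + exp X)) \<le>
     (\<integral>\<^sup>+y. ennreal ((b y)\<^sup>2) \<partial>Pi\<^sub>M I (\<lambda>j. density lborel (p j)))
     + (\<integral>\<^sup>+y. ennreal ((b y - a)\<^sup>2) \<partial>Pi\<^sub>M I (\<lambda>j. density lborel (q j)))"
proof -
  let ?P = "\<lambda>j. density lborel (p j)"
  have [measurable]: "\<And>j. p j \<in> borel_measurable borel" "\<And>j. q j \<in> borel_measurable borel"
    using prob_densityD p q by auto
  define r where "r = (\<lambda>j y. q j y / p j y)"
  have [measurable]: "r j \<in> borel_measurable borel" for j unfolding r_def by measurable
  have r0: "0 \<le> r j y" for j y using prob_densityD(2)[OF q] ppos by (simp add: r_def less_imp_le)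
  have dq: "density (?P j) (\<lambda>y. ennreal (r j y)) = density lborel (q j)" for j
  proof -
    have "density (?P j) (\<lambda>y. ennreal (r j y)) = density lborel (\<lambda>y. ennreal (p j y) * ennreal (r j y))"
      by (rule density_density_eq) auto
    also have "(\<lambda>y. ennreal (p j y) * ennreal (r j y)) = (\<lambda>y. ennreal (q j y))"
    proof
      fix y
      have "ennreal (p j y) * ennreal (r j y) = ennreal (p j y * r j y)"
        using ppos[of j y] r0 by (simp add: ennreal_mult less_imp_le)
      also have "p j y * r j y = q j y" using ppos[of j y] by (simp add: r_def)
      finally show "ennreal (p j y) * ennreal (r j y) = ennreal (q j y)" .
    qed
    finally show ?thesis .
  qed
  have PP: "prob_space (?P j)" for j by (rule prob_space_density_lborel[OF p])
  interpret P: product_prob_space ?P I by (intro product_prob_spaceI PP)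
  define R where "R = (\<lambda>y. \<Prod>j\<in>I. r j (y j))"
  have R_enn: "ennreal (R y) = (\<Prod>j\<in>I. ennreal (r j (y j)))" for y
    unfolding R_def using r0 by (simp add: prod_ennreal)
  have PiQ: "Pi\<^sub>M I (\<lambda>j. density lborel (q j)) = density (Pi\<^sub>M I ?P) (\<lambda>y. ennreal (R y))"
    unfolding dq[symmetric] R_enn
    by (rule PiM_density_prod[OF I PP]) (simp_all add: dq prob_space_density_lborel[OF q])
  have comp: "(\<lambda>y. r j (y j)) \<in> borel_measurable (Pi\<^sub>M I ?P)" if "j \<in> I" for j
    by (rule measurable_compose[OF measurable_component_singleton[OF that]]) simp
  have Rm: "R \<in> borel_measurable (Pi\<^sub>M I ?P)"
    unfolding R_def by (intro borel_measurable_prod comp)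
  have sP: "sets (Pi\<^sub>M I ?P) = sets (Pi\<^sub>M I (\<lambda>_. borel))" by (intro sets_PiM_cong) auto
  have R1: "(\<integral>\<^sup>+y. ennreal (R y) \<partial>Pi\<^sub>M I ?P) = 1"
  proof -
    have "(\<integral>\<^sup>+y. ennreal (R y) \<partial>Pi\<^sub>M I ?P) = (\<Prod>j\<in>I. \<integral>\<^sup>+y. ennreal (r j y) \<partial>?P j)"
      unfolding R_enn by (rule P.product_nn_integral_prod[OF I]) simp
    also have "\<dots> = 1"
    proof (rule prod.neutral, rule ballI)
      fix j
      have "(\<integral>\<^sup>+y. ennreal (r j y) \<partial>?P j) = emeasure (density (?P j) (\<lambda>y. ennreal (r j y))) UNIV"
        by (simp add: emeasure_density)
      also have "\<dots> = 1"
        unfolding dq using prob_space.emeasure_space_1[OF prob_space_density_lborel[OF q]] by simp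
      finally show "(\<integral>\<^sup>+y. ennreal (r j y) \<partial>?P j) = 1" .
    qed
    finally show ?thesis .
  qed
  have R2: "(\<integral>\<^sup>+y. ennreal ((R y)\<^sup>2) \<partial>Pi\<^sub>M I ?P) \<le> ennreal (exp X)"
  proof -
    have "ennreal ((R y)\<^sup>2) = (\<Prod>j\<in>I. ennreal ((r j (y j))\<^sup>2))" for y
      unfolding R_def by (simp add: prod_ennreal flip: prod_power_distrib)
    then have "(\<integral>\<^sup>+y. ennreal ((R y)\<^sup>2) \<partial>Pi\<^sub>M I ?P) = (\<Prod>j\<in>I. \<integral>\<^sup>+y. ennreal ((r j y)\<^sup>2) \<partial>?P j)"
      by (simp only:) (rule P.product_nn_integral_prod[OF I], simp)
    also have "\<dots> \<le> (\<Prod>j\<in>I. ennreal (1 + x j))"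
    proof (rule prod_mono_ennreal)
      fix j assume j: "j \<in> I"
      have "(\<integral>\<^sup>+y. ennreal ((r j y)\<^sup>2) \<partial>?P j) = (\<integral>\<^sup>+y. ennreal (p j y) * ennreal ((r j y)\<^sup>2) \<partial>lborel)"
        by (rule nn_integral_density) auto
      also have "\<dots> = (\<integral>\<^sup>+y. ennreal ((q j y)\<^sup>2 / p j y) \<partial>lborel)"
      proof (rule nn_integral_cong)
        fix y
        have "p j y * (r j y)\<^sup>2 = (q j y)\<^sup>2 / p j y"
          using ppos[of j y] by (simp add: r_def power2_eq_square)
        then show "ennreal (p j y) * ennreal ((r j y)\<^sup>2) = ennreal ((q j y)\<^sup>2 / p j y)"
          using ppos[of j y] by (simp add: ennreal_mult[symmetric] less_imp_le)
      qed
      also have "\<dots> \<le> ennreal (1 + x j)" by (rule chi[OF j])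
      finally show "(\<integral>\<^sup>+y. ennreal ((r j y)\<^sup>2) \<partial>?P j) \<le> ennreal (1 + x j)" .
    qed
    also have "\<dots> = ennreal (\<Prod>j\<in>I. 1 + x j)" using x0 by (intro prod_ennreal) (simp add: add_nonneg_nonneg)
    also have "\<dots> \<le> ennreal (exp X)"
    proof (rule ennreal_leI)
      have "(\<Prod>j\<in>I. 1 + x j) \<le> (\<Prod>j\<in>I. exp (x j))"
        using x0 by (intro prod_mono) (auto simp: exp_ge_add_one_self add_nonneg_nonneg)
      also have "\<dots> = exp (\<Sum>j\<in>I. x j)" by (simp add: exp_sum[OF I])
      also have "\<dots> \<le> exp X" using X by simp
      finally show "(\<Prod>j\<in>I. 1 + x j) \<le> exp X" .
    qed
    finally show ?thesis .
  qed
  have bm: "b \<in> borel_measurable (Pi\<^sub>M I ?P)"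
    using b by (subst measurable_cong_sets[OF sP refl])
  have "prob_space (Pi\<^sub>M I ?P)" by (intro prob_space_PiM PP)
  moreover have "0 \<le> R y" for y unfolding R_def by (intro prod_nonneg) (simp add: r0)
  ultimately show ?thesis
    unfolding PiQ by (intro two_point_bound[OF _ Rm bm _ R1 R2]) auto
qed

section \<open>The hypercube of densities\<close>

text \<open>The vertices of the hypercube, indexed by subsets \<open>S\<close> of \<open>{K..<2 * K}\<close>.\<close>

definition perturbed :: "real \<Rightarrow> nat set \<Rightarrow> real \<Rightarrow> real" where
  "perturbed a S x = base_density x + a * (\<Sum>j\<in>S. wave (2 * real j) x)"

lemma perturbed_measurable [measurable]: "perturbed a S \<in> borel_measurable borel"
  unfolding perturbed_def[abs_def] by measurable

lemma base_le_4: "base_density x \<le> 4"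
  using fejer_le_4[of x] fejer_le_4[of "x - pi"] by (simp add: base_density_def)

lemma abs_perturbation_le:
  assumes "0 \<le> a" "a * real (card S) \<le> 1 / 4"
  shows "\<bar>a * (\<Sum>j\<in>S. wave (2 * real j) x)\<bar> \<le> fejer x / 4"
proof -
  have "\<bar>\<Sum>j\<in>S. wave (2 * real j) x\<bar> \<le> (\<Sum>j\<in>S. fejer x)"
    by (rule order_trans[OF sum_abs sum_mono[OF abs_wave_le]])
  then have "\<bar>a * (\<Sum>j\<in>S. wave (2 * real j) x)\<bar> \<le> a * (real (card S) * fejer x)"
    using assms(1) by (simp add: abs_mult mult_left_mono)
  also have "\<dots> = (a * real (card S)) * fejer x" by simp
  also have "\<dots> \<le> 1 / 4 * fejer x" by (intro mult_right_mono assms(2) fejer_nonneg)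
  finally show ?thesis by simp
qed

lemma perturbed_bounds:
  assumes "0 \<le> a" "a * real (card S) \<le> 1 / 4"
  shows "base_density x / 2 \<le> perturbed a S x" "\<bar>perturbed a S x\<bar> \<le> 5" "0 \<le> perturbed a S x"
    "1 / (72 * pi) * inverse (1 + x\<^sup>2) \<le> perturbed a S x"
proof -
  show 1: "base_density x / 2 \<le> perturbed a S x"
    using abs_perturbation_le[OF assms, of x] base_ge_fejer[of x] by (simp add: perturbed_def abs_le_iff)
  then show 2: "0 \<le> perturbed a S x" using base_nonneg[of x] by linarith
  show "\<bar>perturbed a S x\<bar> \<le> 5"
    using 2 abs_perturbation_le[OF assms, of x] base_le_4[of x] fejer_le_4[of x] by (simp add: perturbed_def abs_le_iff)
  have "1 / (72 * pi) * inverse (1 + x\<^sup>2) = (1 / (36 * pi) * inverse (1 + x\<^sup>2)) / 2" by simp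
  also have "\<dots> \<le> base_density x / 2" by (intro divide_right_mono base_lower) simp
  finally show "1 / (72 * pi) * inverse (1 + x\<^sup>2) \<le> perturbed a S x" using 1 by linarith
qed

lemma integral_wave:
  assumes "1 \<le> \<bar>c\<bar>"
  shows "(LINT x|lborel. wave c x) = 0"
proof -
  have "complex_of_real (LINT x|lborel. wave c x) = ft (wave c) 0" by (simp add: ft_def)
  also have "\<dots> = 0" unfolding ft_wave using assms tri_eq_0[of c] tri_eq_0[of "- c"] by simp
  finally show ?thesis by simp
qed

text \<open>The perturbations integrate to zero because their transforms vanish at \<open>0\<close>.\<close>

lemma prob_density_perturbed:
  assumes a: "0 \<le> a" "a * real (card S) \<le> 1 / 4" and S: "\<And>j. j \<in> S \<Longrightarrow> 1 \<le> j"
  shows "prob_density (perturbed a S)"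
proof -
  have i: "integrable lborel (\<lambda>x. a * (\<Sum>j\<in>S. wave (2 * real j) x))"
    by (intro integrable_mult_right Bochner_Integration.integrable_sum integrable_wave)
  have "(LINT x|lborel. a * (\<Sum>j\<in>S. wave (2 * real j) x)) = a * (\<Sum>j\<in>S. LINT x|lborel. wave (2 * real j) x)"
    by (simp add: Bochner_Integration.integral_sum integrable_wave)
  also have "(\<Sum>j\<in>S. LINT x|lborel. wave (2 * real j) x) = 0"
  proof (intro sum.neutral ballI integral_wave)
    fix j assume "j \<in> S"
    from S[OF this] show "1 \<le> \<bar>2 * real j\<bar>" by simp
  qed
  finally have z: "(LINT x|lborel. a * (\<Sum>j\<in>S. wave (2 * real j) x)) = 0" by simp
  have "(LINT x|lborel. perturbed a S x) = 1"
    unfolding perturbed_def by (simp only: Bochner_Integration.integral_add[OF integrable_base i] integral_base z add_0_right)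
  moreover have "integrable lborel (perturbed a S)"
    unfolding perturbed_def[abs_def] by (rule Bochner_Integration.integrable_add[OF integrable_base i])
  ultimately show ?thesis
    by (simp add: prob_density_def has_bochner_integral_iff perturbed_bounds[OF a])
qed

text \<open>The triangles are centred at even integers, so at most one of them is nonzero at \<open>t\<close>.\<close>

lemma sum_tri_le_1:
  assumes "finite S"
  shows "(\<Sum>j\<in>S. triangle (t - 2 * real j)) \<le> 1"
proof (cases "\<exists>j\<in>S. triangle (t - 2 * real j) \<noteq> 0")
  case True
  then obtain j where j: "j \<in> S" "triangle (t - 2 * real j) \<noteq> 0" by blast
  have near: "\<bar>t - 2 * real j\<bar> < 1" using j(2) tri_eq_0 not_less by blast
  have "(\<Sum>j\<in>S. triangle (t - 2 * real j)) = (\<Sum>j\<in>{j}. triangle (t - 2 * real j))"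
  proof (rule sum.mono_neutral_right[OF assms])
    show "\<forall>i\<in>S - {j}. triangle (t - 2 * real i) = 0"
    proof
      fix i assume "i \<in> S - {j}"
      then have "1 \<le> \<bar>real i - real j\<bar>" by (cases "i < j") auto
      then have "1 \<le> \<bar>t - 2 * real i\<bar>" using near by (auto simp: abs_if split: if_splits)
      then show "triangle (t - 2 * real i) = 0" by (rule tri_eq_0)
    qed
  qed (use j in auto)
  then show ?thesis using tri_simps(2) by simp
next
  case False
  then have "(\<Sum>j\<in>S. triangle (t - 2 * real j)) = 0" by (intro sum.neutral) auto
  then show ?thesis by simp
qed

lemma cmod_ft_perturbed_le:
  assumes a: "0 \<le> a" and S: "S \<subseteq> {K..<2 * K}"
  shows "cmod (ft (perturbed a S) t) \<le> triangle t + a * indicator {- 4 * real K..4 * real K} t"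
proof -
  have fin: "finite S" using S finite_subset by blast
  have iw: "integrable lborel (\<lambda>x. iexp (t * x) * complex_of_real (wave c x))" for c
    by (rule integrable_iexp_mult) (use integrable_wave in auto)
  have ib: "integrable lborel (\<lambda>x. iexp (t * x) * complex_of_real (base_density x))"
    by (rule integrable_iexp_mult) (use integrable_base in auto)
  have "ft (perturbed a S) t = (CLINT x|lborel. iexp (t * x) * complex_of_real (base_density x) + complex_of_real a * (\<Sum>j\<in>S. iexp (t * x) * complex_of_real (wave (2 * real j) x)))"
    unfolding ft_def perturbed_def
    by (intro Bochner_Integration.integral_cong refl) (simp add: distrib_left sum_distrib_left mult_ac)
  also have "\<dots> = ft base_density t + complex_of_real a * (\<Sum>j\<in>S. ft (wave (2 * real j)) t)"
    unfolding ft_def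
    by (simp only: Bochner_Integration.integral_add[OF ib integrable_mult_right[OF Bochner_Integration.integrable_sum[OF iw]]]
        integral_mult_right_zero Bochner_Integration.integral_sum[OF iw])
  also have "(\<Sum>j\<in>S. ft (wave (2 * real j)) t) = complex_of_real (\<Sum>j\<in>S. (triangle (t + 2 * real j) + triangle (t - 2 * real j)) / 2)"
    by (simp only: ft_wave of_real_sum)
  finally have eq: "ft (perturbed a S) t = ft base_density t + complex_of_real (a * (\<Sum>j\<in>S. (triangle (t + 2 * real j) + triangle (t - 2 * real j)) / 2))"
    by (simp only: of_real_mult)
  let ?s = "\<Sum>j\<in>S. (triangle (t + 2 * real j) + triangle (t - 2 * real j)) / 2"
  have s0: "0 \<le> ?s" by (intro sum_nonneg divide_nonneg_nonneg add_nonneg_nonneg tri_simps(1)) simp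
  have sle: "?s \<le> indicator {- 4 * real K..4 * real K} t"
  proof (cases "t \<in> {- 4 * real K..4 * real K}")
    case True
    have "triangle (t + 2 * real j) = triangle (- t - 2 * real j)" for j
      using tri_simps(3)[of "t + 2 * real j"] by (simp add: minus_diff_commute)
    then have "(\<Sum>j\<in>S. triangle (t + 2 * real j)) \<le> 1" using sum_tri_le_1[OF fin, of "- t"] by simp
    then have "?s \<le> 1" using sum_tri_le_1[OF fin, of t]
      by (simp add: sum_divide_distrib[symmetric] sum.distrib)
    then show ?thesis using True by simp
  next
    case False
    have "?s = 0"
    proof (intro sum.neutral ballI)
      fix j assume "j \<in> S"
      then have "2 * real j + 1 \<le> 4 * real K" using S by auto
      then have "1 \<le> \<bar>t + 2 * real j\<bar>" "1 \<le> \<bar>t - 2 * real j\<bar>" using False by auto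
      then show "(triangle (t + 2 * real j) + triangle (t - 2 * real j)) / 2 = 0" by (simp add: tri_eq_0)
    qed
    then show ?thesis by simp
  qed
  have "cmod (ft (perturbed a S) t) \<le> cmod (ft base_density t) + \<bar>a * ?s\<bar>"
    unfolding eq by (rule order_trans[OF norm_triangle_ineq]) (simp only: norm_of_real order_refl)
  also have "\<dots> \<le> triangle t + a * indicator {- 4 * real K..4 * real K} t"
    using a s0 sle by (intro add_mono ft_base_le) (simp add: abs_mult mult_left_mono)
  finally show ?thesis .
qed

text \<open>The size of the perturbation. The bound on \<open>a * card S\<close>, which keeps the densities positive, rests on
  \<open>\<beta> > 1/2\<close>.\<close>

lemma amplitude:
  assumes "1 \<le> K" "1 / 2 < \<beta>" and a: "a = real K powr (- \<beta> - 1 / 2) / 4"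
  shows amplitude_nonneg: "0 \<le> a"
    and amplitude_sq: "a\<^sup>2 = real K powr (- 2 * \<beta> - 1) / 16"
    and amplitude_card: "S \<subseteq> {K..<2 * K} \<Longrightarrow> a * real (card S) \<le> 1 / 4"
proof -
  have Kr: "1 \<le> real K" using assms(1) by simp
  show a0: "0 \<le> a" by (simp add: a)
  have "real K powr (- \<beta> - 1 / 2) * real K powr (- \<beta> - 1 / 2) = real K powr (- 2 * \<beta> - 1)"
    by (simp only: powr_add[symmetric]) simp
  then show "a\<^sup>2 = real K powr (- 2 * \<beta> - 1) / 16" by (simp add: a power2_eq_square)
  assume S: "S \<subseteq> {K..<2 * K}"
  have "real (card S) \<le> real K" using card_mono[OF _ S] by simp
  then have "a * real (card S) \<le> a * real K" by (rule mult_left_mono[OF _ a0])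
  also have "\<dots> = real K powr (1 / 2 - \<beta>) / 4"
  proof -
    have "real K powr (- \<beta> - 1 / 2) * real K powr 1 = real K powr (1 / 2 - \<beta>)"
      by (simp only: powr_add[symmetric]) simp
    then show ?thesis using Kr by (simp add: a)
  qed
  also have "real K powr (1 / 2 - \<beta>) \<le> real K powr 0"
    using Kr assms(2) by (intro powr_mono) auto
  finally show "a * real (card S) \<le> 1 / 4" using Kr by simp
qed

text \<open>The base contributes at most \<open>4 * 2 powr \<beta>\<close>. The perturbation has transform at most \<open>a\<close> on
  \<open>\<bar>t\<bar> \<le> 4 * K\<close>, where \<open>(1 + t\<^sup>2) powr \<beta> \<le> 17 powr \<beta> * K powr (2 * \<beta>)\<close>; the powers of \<open>K\<close> cancel, which is
  what dictates the size of \<open>a\<close>.\<close>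

lemma perturbed_in_density_class:
  fixes \<beta> :: real
  assumes K: "1 \<le> K" and S: "S \<subseteq> {K..<2 * K}" and \<beta>: "1 / 2 < \<beta>" and a: "a = real K powr (- \<beta> - 1 / 2) / 4"
    and C: "4 * 2 powr \<beta> + 17 powr \<beta> \<le> C"
  shows "perturbed a S \<in> density_class \<beta> C"
proof -
  have Kr: "1 \<le> real K" using K by simp
  note a0 = amplitude_nonneg[OF K \<beta> a] and a2 = amplitude_sq[OF K \<beta> a] and acard = amplitude_card[OF K \<beta> a S]
  have S1: "1 \<le> j" if "j \<in> S" for j using that S K by auto
  have pd: "prob_density (perturbed a S)" by (rule prob_density_perturbed[OF a0 acard S1])
  have pt: "(cmod (ft (perturbed a S) t))\<^sup>2 * (1 + t\<^sup>2) powr \<beta>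
    \<le> 2 * 2 powr \<beta> * indicator {-1..1} t + 2 * a\<^sup>2 * (17 powr \<beta> * real K powr (2 * \<beta>)) * indicator {- 4 * real K..4 * real K} t" for t
  proof -
    let ?i = "indicator {- 4 * real K..4 * real K} t :: real"
    have "(cmod (ft (perturbed a S) t))\<^sup>2 \<le> (triangle t + a * ?i)\<^sup>2"
      by (intro power_mono cmod_ft_perturbed_le[OF a0 S]) simp
    also have "\<dots> \<le> 2 * (triangle t)\<^sup>2 + 2 * (a * ?i)\<^sup>2"
      using sum_squares_bound[of "triangle t" "a * ?i"] by (simp add: power2_sum)
    finally have "(cmod (ft (perturbed a S) t))\<^sup>2 * (1 + t\<^sup>2) powr \<beta> \<le> (2 * (triangle t)\<^sup>2 + 2 * (a * ?i)\<^sup>2) * (1 + t\<^sup>2) powr \<beta>"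
      by (rule mult_right_mono) simp
    also have "\<dots> = 2 * ((triangle t)\<^sup>2 * (1 + t\<^sup>2) powr \<beta>) + 2 * a\<^sup>2 * (?i * (1 + t\<^sup>2) powr \<beta>)"
      by (cases "t \<in> {- 4 * real K..4 * real K}") (simp_all add: distrib_right)
    also have "\<dots> \<le> 2 * (2 powr \<beta> * indicator {-1..1} t) + 2 * a\<^sup>2 * (17 powr \<beta> * real K powr (2 * \<beta>) * ?i)"
    proof (intro add_mono mult_left_mono)
      show "(triangle t)\<^sup>2 * (1 + t\<^sup>2) powr \<beta> \<le> 2 powr \<beta> * indicator {-1..1} t"
      proof (cases "t \<in> {-1..1}")
        case True
        then have "t\<^sup>2 \<le> 1" by (auto simp: abs_square_le_1 abs_le_iff)
        then have "(1 + t\<^sup>2) powr \<beta> \<le> 2 powr \<beta>" using \<beta> by (intro powr_mono2) auto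
        moreover have "(triangle t)\<^sup>2 \<le> 1" using tri_simps(1,2)[of t] by (simp add: power_le_one)
        ultimately have "(triangle t)\<^sup>2 * (1 + t\<^sup>2) powr \<beta> \<le> 1 * 2 powr \<beta>" by (intro mult_mono) auto
        then show ?thesis using True by simp
      next
        case False
        then have "triangle t = 0" by (intro tri_eq_0) auto
        then show ?thesis by simp
      qed
      show "?i * (1 + t\<^sup>2) powr \<beta> \<le> 17 powr \<beta> * real K powr (2 * \<beta>) * ?i"
      proof (cases "t \<in> {- 4 * real K..4 * real K}")
        case True
        then have "t\<^sup>2 \<le> (4 * real K)\<^sup>2" by (intro abs_le_square_iff[THEN iffD1]) (auto simp: abs_le_iff)
        moreover have "1 \<le> (real K)\<^sup>2" using Kr by (simp add: one_le_power)
        ultimately have "1 + t\<^sup>2 \<le> 17 * (real K)\<^sup>2" by (simp add: power_mult_distrib)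
        then have "(1 + t\<^sup>2) powr \<beta> \<le> (17 * (real K)\<^sup>2) powr \<beta>" using \<beta> by (intro powr_mono2) auto
        also have "\<dots> = 17 powr \<beta> * real K powr (2 * \<beta>)"
          using Kr powr_square[of "real K" \<beta>] by (simp add: powr_mult)
        finally show ?thesis using True by simp
      qed simp
    qed auto
    finally show ?thesis by (simp only: mult.assoc)
  qed
  have "(\<integral>\<^sup>+t. ennreal ((cmod (ft (perturbed a S) t))\<^sup>2 * (1 + t\<^sup>2) powr \<beta>) \<partial>lborel)
    \<le> (\<integral>\<^sup>+t. ennreal (2 * 2 powr \<beta>) * indicator {-1..1} t + ennreal (2 * a\<^sup>2 * (17 powr \<beta> * real K powr (2 * \<beta>))) * indicator {- 4 * real K..4 * real K} t \<partial>lborel)"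
  proof (rule nn_integral_mono)
    fix t
    show "ennreal ((cmod (ft (perturbed a S) t))\<^sup>2 * (1 + t\<^sup>2) powr \<beta>)
      \<le> ennreal (2 * 2 powr \<beta>) * indicator {-1..1} t + ennreal (2 * a\<^sup>2 * (17 powr \<beta> * real K powr (2 * \<beta>))) * indicator {- 4 * real K..4 * real K} t"
      by (rule order_trans[OF ennreal_leI[OF pt]])
        (cases "t \<in> {-1..1}"; cases "t \<in> {- 4 * real K..4 * real K}"; simp add: ennreal_plus[symmetric] del: ennreal_plus)
  qed
  also have "\<dots> = ennreal (2 * 2 powr \<beta>) * ennreal 2 + ennreal (2 * a\<^sup>2 * (17 powr \<beta> * real K powr (2 * \<beta>))) * ennreal (8 * real K)"
    by (simp add: nn_integral_add nn_integral_cmult_indicator emeasure_lborel_Icc_eq)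
  also have "\<dots> = ennreal (4 * 2 powr \<beta> + 16 * a\<^sup>2 * real K * (17 powr \<beta> * real K powr (2 * \<beta>)))"
    by (subst (1 2) ennreal_mult[symmetric]; (subst ennreal_plus[symmetric])?) (auto simp: mult_ac)
  also have "16 * a\<^sup>2 * real K * (17 powr \<beta> * real K powr (2 * \<beta>)) = 17 powr \<beta>"
  proof -
    have "real K powr (- 2 * \<beta> - 1) * real K powr 1 * real K powr (2 * \<beta>) = real K powr 0"
      by (simp only: powr_add[symmetric]) simp
    then have "real K powr (- 2 * \<beta> - 1) * real K * real K powr (2 * \<beta>) = 1" using Kr by simp
    then show ?thesis by (simp add: a2 mult_ac)
  qed
  also have "ennreal (4 * 2 powr \<beta> + 17 powr \<beta>) \<le> ennreal C" by (rule ennreal_leI[OF C])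
  finally show ?thesis using pd by (simp add: density_class_def)
qed

lemma integrable_mult_wave:
  assumes [measurable]: "u \<in> borel_measurable borel" and u: "integrable lborel (\<lambda>x. (u x)\<^sup>2)"
  shows "integrable lborel (\<lambda>x. u x * wave c x)"
proof (rule Bochner_Integration.integrable_bound)
  show "integrable lborel (\<lambda>x. (u x)\<^sup>2 + wave c x * wave c x)"
    by (rule Bochner_Integration.integrable_add[OF u integrable_wave_mult])
  show "AE x in lborel. norm (u x * wave c x) \<le> norm ((u x)\<^sup>2 + wave c x * wave c x)"
  proof (rule AE_I2)
    fix x
    have "2 * (\<bar>u x\<bar> * \<bar>wave c x\<bar>) \<le> (u x)\<^sup>2 + wave c x * wave c x"
      using sum_squares_bound[of "\<bar>u x\<bar>" "\<bar>wave c x\<bar>"] by (simp add: power2_eq_square)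
    moreover have "0 \<le> \<bar>u x\<bar> * \<bar>wave c x\<bar>" by simp
    ultimately show "norm (u x * wave c x) \<le> norm ((u x)\<^sup>2 + wave c x * wave c x)"
      unfolding real_norm_def abs_mult by linarith
  qed
qed simp

lemma bessel_wave:
  assumes [measurable]: "u \<in> borel_measurable borel" and u: "integrable lborel (\<lambda>x. (u x)\<^sup>2)"
    and J: "finite J" "\<And>j. j \<in> J \<Longrightarrow> 1 \<le> j"
  shows "wave_sq * (\<Sum>j\<in>J. ((LINT x|lborel. u x * wave (2 * real j) x) / wave_sq)\<^sup>2) \<le> (LINT x|lborel. (u x)\<^sup>2)"
proof -
  let ?p = "\<lambda>j k x. wave (2 * real j) x * wave (2 * real k) x"
  let ?u = "\<lambda>j x. u x * wave (2 * real j) x"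
  define c where "c = (\<lambda>j. (LINT x|lborel. u x * wave (2 * real j) x) / wave_sq)"
  have c: "(LINT x|lborel. u x * wave (2 * real j) x) = c j * wave_sq" for j
    using wave_sq_pos by (simp add: c_def)
  have i1: "integrable lborel (\<lambda>x. \<Sum>j\<in>J. c j * ?u j x)"
    by (intro Bochner_Integration.integrable_sum integrable_mult_right integrable_mult_wave u) simp
  have i2: "integrable lborel (\<lambda>x. \<Sum>j\<in>J. \<Sum>k\<in>J. (c j * c k) * ?p j k x)"
    by (intro Bochner_Integration.integrable_sum integrable_mult_right integrable_wave_mult)
  have I1: "(LINT x|lborel. (\<Sum>j\<in>J. c j * ?u j x)) = (\<Sum>j\<in>J. c j * (c j * wave_sq))"
  proof -
    have "(LINT x|lborel. (\<Sum>j\<in>J. c j * ?u j x)) = (\<Sum>j\<in>J. LINT x|lborel. c j * ?u j x)"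
      by (intro Bochner_Integration.integral_sum integrable_mult_right integrable_mult_wave u) simp
    then show ?thesis by (simp only: integral_mult_right_zero c)
  qed
  have I2: "(LINT x|lborel. (\<Sum>j\<in>J. \<Sum>k\<in>J. (c j * c k) * ?p j k x)) = (\<Sum>j\<in>J. c j * (c j * wave_sq))"
  proof -
    have "(LINT x|lborel. (\<Sum>j\<in>J. \<Sum>k\<in>J. (c j * c k) * ?p j k x))
      = (\<Sum>j\<in>J. LINT x|lborel. (\<Sum>k\<in>J. (c j * c k) * ?p j k x))"
      by (intro Bochner_Integration.integral_sum Bochner_Integration.integrable_sum integrable_mult_right integrable_wave_mult)
    also have "\<dots> = (\<Sum>j\<in>J. \<Sum>k\<in>J. (c j * c k) * (LINT x|lborel. ?p j k x))"
    proof (rule sum.cong[OF refl])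
      fix j
      have "(LINT x|lborel. (\<Sum>k\<in>J. (c j * c k) * ?p j k x))
        = (\<Sum>k\<in>J. LINT x|lborel. (c j * c k) * ?p j k x)"
        by (intro Bochner_Integration.integral_sum integrable_mult_right integrable_wave_mult)
      then show "(LINT x|lborel. (\<Sum>k\<in>J. (c j * c k) * ?p j k x))
        = (\<Sum>k\<in>J. (c j * c k) * (LINT x|lborel. ?p j k x))"
        by (simp only: integral_mult_right_zero)
    qed
    also have "\<dots> = (\<Sum>j\<in>J. \<Sum>k\<in>J. if j = k then c j * (c j * wave_sq) else 0)"
      by (intro sum.cong refl) (simp add: integral_wave_mult J(2))
    also have "\<dots> = (\<Sum>j\<in>J. c j * (c j * wave_sq))"
      by (intro sum.cong refl) (simp add: J(1))
    finally show ?thesis .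
  qed
  have "0 \<le> (LINT x|lborel. (u x - (\<Sum>j\<in>J. c j * wave (2 * real j) x))\<^sup>2)"
    by (intro integral_nonneg_AE) simp
  also have "\<dots> = (LINT x|lborel. ((u x)\<^sup>2 - 2 * (\<Sum>j\<in>J. c j * ?u j x))
      + (\<Sum>j\<in>J. \<Sum>k\<in>J. (c j * c k) * ?p j k x))"
  proof (intro Bochner_Integration.integral_cong refl)
    fix x
    let ?s = "\<Sum>j\<in>J. c j * wave (2 * real j) x"
    have "(\<Sum>j\<in>J. \<Sum>k\<in>J. (c j * c k) * ?p j k x) = ?s * ?s"
      unfolding sum_product by (intro sum.cong refl) (simp only: mult_ac)
    moreover have "(\<Sum>j\<in>J. c j * ?u j x) = u x * ?s"
      unfolding sum_distrib_left by (intro sum.cong refl) (simp only: mult_ac)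
    ultimately show "(u x - ?s)\<^sup>2 = ((u x)\<^sup>2 - 2 * (\<Sum>j\<in>J. c j * ?u j x))
      + (\<Sum>j\<in>J. \<Sum>k\<in>J. (c j * c k) * ?p j k x)"
      by (simp only: power2_eq_square) (simp add: algebra_simps)
  qed
  also have "\<dots> = ((LINT x|lborel. (u x)\<^sup>2) - 2 * (\<Sum>j\<in>J. c j * (c j * wave_sq))) + (\<Sum>j\<in>J. c j * (c j * wave_sq))"
    by (simp only: Bochner_Integration.integral_add[OF Bochner_Integration.integrable_diff[OF u integrable_mult_right[OF i1]] i2]
        Bochner_Integration.integral_diff[OF u integrable_mult_right[OF i1]] integral_mult_right_zero I1 I2)
  finally have "(\<Sum>j\<in>J. c j * (c j * wave_sq)) \<le> (LINT x|lborel. (u x)\<^sup>2)" by linarith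
  then have "wave_sq * (\<Sum>j\<in>J. (c j)\<^sup>2) \<le> (LINT x|lborel. (u x)\<^sup>2)"
    unfolding sum_distrib_left by (simp only: power2_eq_square mult_ac)
  then show ?thesis unfolding c_def .
qed

text \<open>What an estimate \<open>h\<close> says about the \<open>j\<close>-th bit: at \<open>h = perturbed a S\<close> it equals \<open>a\<close> or \<open>0\<close> according to
  whether \<open>j \<in> S\<close>.\<close>

definition wave_coef :: "(real \<Rightarrow> complex) \<Rightarrow> nat \<Rightarrow> real" where
  "wave_coef h j = (LINT x|lborel. (Re (h x) - base_density x) * wave (2 * real j) x) / wave_sq"

text \<open>Bessel's inequality for the real part of the error. If the error is not square integrable, the
  right-hand side is infinite and the coefficients may be meaningless.\<close>

lemma loss_ge_coef:
  assumes [measurable]: "h \<in> borel_measurable borel"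
    and J: "finite J" "\<And>j. j \<in> J \<Longrightarrow> 1 \<le> j" and S: "S \<subseteq> J"
  shows "ennreal (wave_sq * (\<Sum>j\<in>J. (wave_coef h j - (if j \<in> S then a else 0))\<^sup>2))
    \<le> (\<integral>\<^sup>+x. ennreal ((cmod (h x - complex_of_real (perturbed a S x)))\<^sup>2) \<partial>lborel)"
proof -
  let ?loss = "\<integral>\<^sup>+x. ennreal ((cmod (h x - complex_of_real (perturbed a S x)))\<^sup>2) \<partial>lborel"
  let ?t = "\<lambda>j. (wave_coef h j - (if j \<in> S then a else 0))\<^sup>2"
  define u where "u = (\<lambda>x. Re (h x) - perturbed a S x)"
  have [measurable]: "u \<in> borel_measurable borel" unfolding u_def by measurable
  have le: "(\<integral>\<^sup>+x. ennreal ((u x)\<^sup>2) \<partial>lborel) \<le> (\<integral>\<^sup>+x. ennreal ((cmod (h x - complex_of_real (perturbed a S x)))\<^sup>2) \<partial>lborel)"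
  proof (intro nn_integral_mono ennreal_leI)
    fix x
    show "(u x)\<^sup>2 \<le> (cmod (h x - complex_of_real (perturbed a S x)))\<^sup>2"
      unfolding cmod_power2 u_def by simp
  qed
  show ?thesis
  proof (cases "(\<integral>\<^sup>+x. ennreal ((u x)\<^sup>2) \<partial>lborel) < \<infinity>")
    case False
    then have "(\<integral>\<^sup>+x. ennreal ((u x)\<^sup>2) \<partial>lborel) = \<infinity>" by (simp add: less_top[symmetric])
    then show ?thesis using le by (simp add: top_unique)
  next
    case True
    then have u2: "integrable lborel (\<lambda>x. (u x)\<^sup>2)" by (intro integrableI_bounded) auto
    have wave_coef: "(LINT x|lborel. u x * wave (2 * real j) x) / wave_sq = wave_coef h j - (if j \<in> S then a else 0)" if j: "j \<in> J" for j
    proof -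
      have fS: "finite S" using S J(1) finite_subset by blast
      have "(LINT x|lborel. (Re (h x) - base_density x) * wave (2 * real j) x)
        = (LINT x|lborel. u x * wave (2 * real j) x + (\<Sum>k\<in>S. a * (wave (2 * real k) x * wave (2 * real j) x)))"
        by (intro Bochner_Integration.integral_cong refl)
          (simp add: u_def perturbed_def algebra_simps sum_distrib_left sum_distrib_right)
      also have "\<dots> = (LINT x|lborel. u x * wave (2 * real j) x) + (LINT x|lborel. (\<Sum>k\<in>S. a * (wave (2 * real k) x * wave (2 * real j) x)))"
        by (intro Bochner_Integration.integral_add integrable_mult_wave u2 Bochner_Integration.integrable_sum integrable_mult_right integrable_wave_mult) simp
      also have "(LINT x|lborel. (\<Sum>k\<in>S. a * (wave (2 * real k) x * wave (2 * real j) x)))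
        = (\<Sum>k\<in>S. LINT x|lborel. a * (wave (2 * real k) x * wave (2 * real j) x))"
        by (intro Bochner_Integration.integral_sum integrable_mult_right integrable_wave_mult)
      also have "\<dots> = (\<Sum>k\<in>S. if k = j then a * wave_sq else 0)"
      proof (intro sum.cong refl)
        fix k assume "k \<in> S"
        then have "1 \<le> k" "1 \<le> j" using J(2) j S by auto
        then show "(LINT x|lborel. a * (wave (2 * real k) x * wave (2 * real j) x)) = (if k = j then a * wave_sq else 0)"
          by (simp add: integral_wave_mult)
      qed
      also have "\<dots> = (if j \<in> S then a else 0) * wave_sq" using fS by simp
      finally have "wave_coef h j = (LINT x|lborel. u x * wave (2 * real j) x) / wave_sq + (if j \<in> S then a else 0)"
        unfolding wave_coef_def using wave_sq_pos by (simp add: add_divide_distrib)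
      then show ?thesis by simp
    qed
    have "wave_sq * (\<Sum>j\<in>J. ?t j)
      = wave_sq * (\<Sum>j\<in>J. ((LINT x|lborel. u x * wave (2 * real j) x) / wave_sq)\<^sup>2)"
      by (intro arg_cong[where f="(*) wave_sq"] sum.cong refl) (simp only: wave_coef)
    also have "\<dots> \<le> (LINT x|lborel. (u x)\<^sup>2)" by (rule bessel_wave[OF _ u2 J]) simp
    finally have "ennreal (wave_sq * (\<Sum>j\<in>J. ?t j)) \<le> ennreal (LINT x|lborel. (u x)\<^sup>2)"
      by (rule ennreal_leI)
    also have "\<dots> = (\<integral>\<^sup>+x. ennreal ((u x)\<^sup>2) \<partial>lborel)"
      by (rule nn_integral_eq_integral[OF u2, symmetric]) simp
    finally show ?thesis using le by (rule order_trans)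
  qed
qed

text \<open>The counting step of Assouad's lemma: for each bit \<open>j\<close>, pair every set without \<open>j\<close> with the set that has
  \<open>j\<close> added.\<close>

lemma assouad_sum:
  fixes L :: "'a \<Rightarrow> 'a set \<Rightarrow> ennreal"
  assumes J: "finite J" and L: "\<And>j S. j \<in> J \<Longrightarrow> S \<subseteq> J - {j} \<Longrightarrow> B \<le> L j S + L j (insert j S)"
  shows "of_nat (card J) * (2 ^ (card J - 1) * B) \<le> (\<Sum>S\<in>Pow J. \<Sum>j\<in>J. L j S)"
proof -
  have one: "2 ^ (card J - 1) * B \<le> (\<Sum>S\<in>Pow J. L j S)" if j: "j \<in> J" for j
  proof -
    let ?J = "J - {j}"
    have P: "Pow J = Pow ?J \<union> insert j ` Pow ?J"
      using Pow_insert[of j ?J] j by (simp add: insert_absorb)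
    have "2 ^ (card J - 1) * B = (\<Sum>S\<in>Pow ?J. B)"
      using J j by (simp add: card_Pow card_Diff_singleton)
    also have "\<dots> \<le> (\<Sum>S\<in>Pow ?J. L j S + L j (insert j S))"
      by (intro sum_mono L[OF j]) auto
    also have "\<dots> = (\<Sum>S\<in>Pow ?J. L j S) + (\<Sum>S\<in>insert j ` Pow ?J. L j S)"
    proof -
      have "inj_on (insert j) (Pow ?J)" by (auto simp: inj_on_def)
      then show ?thesis by (simp add: sum.distrib sum.reindex)
    qed
    also have "\<dots> = (\<Sum>S\<in>Pow J. L j S)"
      unfolding P using J by (intro sum.union_disjoint[symmetric]) auto
    finally show ?thesis .
  qed
  have "of_nat (card J) * (2 ^ (card J - 1) * B) = (\<Sum>j\<in>J. 2 ^ (card J - 1) * B)" by simp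
  also have "\<dots> \<le> (\<Sum>j\<in>J. \<Sum>S\<in>Pow J. L j S)" by (intro sum_mono one)
  also have "\<dots> = (\<Sum>S\<in>Pow J. \<Sum>j\<in>J. L j S)" by (rule sum.swap)
  finally show ?thesis .
qed

section \<open>Minimax lower bound\<close>

lemma estimator_section:
  assumes "g \<in> estimators n" "y \<in> space (Pi\<^sub>M {1..n} (\<lambda>_. borel))"
  shows "g y \<in> borel_measurable borel"
  using measurable_compose[OF measurable_Pair1'[OF assms(2), of borel], of "case_prod g" borel] assms(1)
  by (simp add: estimators_def)

lemma coef_measurable:
  assumes g: "g \<in> estimators n"
  shows "(\<lambda>y. wave_coef (g y) j) \<in> borel_measurable (Pi\<^sub>M {1..n} (\<lambda>_. borel))"
proof -
  have "case_prod g \<in> borel_measurable (Pi\<^sub>M {1..n} (\<lambda>_. borel) \<Otimes>\<^sub>M lborel)"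
    using g by (simp add: estimators_def cong: measurable_cong_sets)
  then have "(\<lambda>z. g (fst z) (snd z)) \<in> borel_measurable (Pi\<^sub>M {1..n} (\<lambda>_. borel) \<Otimes>\<^sub>M lborel)"
    by (simp only: split_beta')
  then have "(\<lambda>(y, x). (Re (g y x) - base_density x) * wave (2 * real j) x) \<in> borel_measurable (Pi\<^sub>M {1..n} (\<lambda>_. borel) \<Otimes>\<^sub>M lborel)"
    unfolding split_beta' by measurable
  from lborel.borel_measurable_lebesgue_integral[OF this] show ?thesis
    unfolding wave_coef_def by measurable
qed

lemma risk_ge_coef:
  assumes g: "g \<in> estimators n" and pd: "prob_density (perturbed a S)" and e: "\<And>l. prob_density (e l)"
    and J: "finite J" "\<And>j. j \<in> J \<Longrightarrow> 1 \<le> j" and S: "S \<subseteq> J"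
  shows "ennreal wave_sq * (\<Sum>j\<in>J. \<integral>\<^sup>+y. ennreal ((wave_coef (g y) j - (if j \<in> S then a else 0))\<^sup>2)
      \<partial>(\<Pi>\<^sub>M l\<in>{1..n}. density lborel (perturbed a S) \<star> density lborel (e l)))
    \<le> risk n e (perturbed a S) g"
proof -
  let ?P = "\<Pi>\<^sub>M l\<in>{1..n}. density lborel (perturbed a S) \<star> density lborel (e l)"
  let ?t = "\<lambda>y j. (wave_coef (g y) j - (if j \<in> S then a else 0))\<^sup>2"
  have sP: "sets ?P = sets (Pi\<^sub>M {1..n} (\<lambda>_. borel))" by (intro sets_PiM_cong) auto
  have tm: "(\<lambda>y. ennreal (?t y j)) \<in> borel_measurable (Pi\<^sub>M {1..n} (\<lambda>_. borel))" for j
    using coef_measurable[OF g, of j] by measurable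
  have tmP: "(\<lambda>y. ennreal (?t y j)) \<in> borel_measurable ?P" for j
    using tm[of j] by (subst measurable_cong_sets[OF sP refl])
  have split: "ennreal (wave_sq * (\<Sum>j\<in>J. ?t y j)) = ennreal wave_sq * (\<Sum>j\<in>J. ennreal (?t y j))" for y
    using wave_sq_pos by (simp add: ennreal_mult sum_nonneg less_imp_le)
  have "ennreal wave_sq * (\<Sum>j\<in>J. \<integral>\<^sup>+y. ennreal (?t y j) \<partial>?P) = (\<integral>\<^sup>+y. ennreal (wave_sq * (\<Sum>j\<in>J. ?t y j)) \<partial>?P)"
    unfolding split by (simp only: nn_integral_cmult nn_integral_sum tmP borel_measurable_sum)
  also have "\<dots> = (\<integral>\<^sup>+s. ennreal (wave_sq * (\<Sum>j\<in>J. ?t (obs n s) j)) \<partial>model n e (perturbed a S))"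
    by (rule nn_integral_obs[OF pd e, symmetric])
      (simp only: split, intro borel_measurable_times_ennreal borel_measurable_const borel_measurable_sum tm)
  also have "\<dots> \<le> risk n e (perturbed a S) g"
    unfolding risk_def
  proof (rule nn_integral_mono)
    fix s assume "s \<in> space (model n e (perturbed a S))"
    then have "obs n s \<in> space (Pi\<^sub>M {1..n} (\<lambda>_. borel))"
      by (rule measurable_space[OF obs_measurable[OF pd e]])
    from loss_ge_coef[OF estimator_section[OF g this] J S]
    show "ennreal (wave_sq * (\<Sum>j\<in>J. ?t (obs n s) j))
      \<le> (\<integral>\<^sup>+x. ennreal ((cmod (g (obs n s) x - complex_of_real (perturbed a S x)))\<^sup>2) \<partial>lborel)" .
  qed
  finally show ?thesis .
qed

lemma conv_perturbed_insert:
  assumes e: "prob_density e" and S: "finite S" "j \<notin> S" and a: "0 \<le> a" "a * real (card S) \<le> 1 / 4"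
  shows "conv (perturbed a (insert j S)) e y = conv (perturbed a S) e y + a * conv (wave (2 * real j)) e y"
proof -
  have i1: "integrable lborel (\<lambda>u. perturbed a S (y - u) * e u)"
    by (rule integrable_conv[OF e _ perturbed_bounds(2)[OF a]]) simp
  have i2: "integrable lborel (\<lambda>u. wave (2 * real j) (y - u) * e u)"
    by (rule integrable_conv[OF e _ order_trans[OF abs_wave_le fejer_le_4]]) simp
  have "conv (perturbed a (insert j S)) e y
    = (LINT u|lborel. perturbed a S (y - u) * e u + a * (wave (2 * real j) (y - u) * e u))"
    unfolding conv_def by (intro Bochner_Integration.integral_cong refl)
      (simp add: perturbed_def S algebra_simps)
  also have "\<dots> = conv (perturbed a S) e y + a * conv (wave (2 * real j)) e y"
    unfolding conv_def
    by (simp only: Bochner_Integration.integral_add[OF i1 integrable_mult_right[OF i2]] integral_mult_right_zero)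
  finally show ?thesis .
qed

text \<open>Assouad's bound for one sample size and a free cut-off \<open>K\<close>. The number \<open>3 * C2 / (16 * \<kappa>)\<close> bounds the total
  chi-square distance between neighbouring hypotheses: \<open>3\<close> comes from \<open>band_energy\<close>, \<open>1 / 16\<close> from \<open>a\<^sup>2\<close>, and \<open>\<kappa>\<close>
  is the constant in the lower bound for the densities of the observations.\<close>

lemma minimax_lower_bound:
  fixes \<beta> \<alpha> C0 C2 C :: real and e :: "nat \<Rightarrow> real \<Rightarrow> real"
  assumes \<beta>: "1 / 2 < \<beta>" and C: "4 * 2 powr \<beta> + 17 powr \<beta> \<le> C" and g: "g \<in> estimators n"
    and e: "\<And>l. prob_density (e l)" and C0: "0 < C0" and K: "1 \<le> K" and C2: "0 \<le> C2"
    and mass: "\<And>l. C0 \<le> measure (density lborel (e l)) {u. \<bar>u\<bar> \<le> \<alpha>}"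
    and d: "\<And>l t. 2 * real K - 1 \<le> t \<Longrightarrow> ft (e l) differentiable (at t)"
    "\<And>l t. 2 * real K - 1 \<le> t \<Longrightarrow> cmod (vector_derivative (ft (e l)) (at t)) \<le> \<phi> l"
    and b: "\<And>l t. 2 * real K - 1 \<le> t \<Longrightarrow> cmod (ft (e l) t) \<le> \<phi> l"
    and energy: "(\<Sum>l=1..n. (\<phi> l)\<^sup>2) \<le> C2 * real K powr (1 + 2 * \<beta>)"
  defines "\<kappa> \<equiv> 1 / (72 * pi) * C0 / (2 + 2 * \<alpha>\<^sup>2)"
  shows "ennreal (wave_sq / (32 * (1 + exp (3 * C2 / (16 * \<kappa>)))) * real K powr (- 2 * \<beta>))
    \<le> (SUP f\<in>density_class \<beta> C. risk n e f g)"
proof -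
  define J where "J = {K..<2 * K}"
  define a where "a = real K powr (- \<beta> - 1 / 2) / 4"
  define X where "X = 3 * C2 / (16 * \<kappa>)"
  have Kr: "1 \<le> real K" using K by simp
  have J: "finite J" "card J = K" "\<And>j. j \<in> J \<Longrightarrow> 1 \<le> j" using K by (auto simp: J_def)
  have "0 < 2 + 2 * \<alpha>\<^sup>2" by (simp add: add_pos_nonneg)
  then have \<kappa>: "0 < \<kappa>" unfolding \<kappa>_def using C0 by (intro divide_pos_pos mult_pos_pos) auto
  note a0 = amplitude_nonneg[OF K \<beta> a_def] and a2 = amplitude_sq[OF K \<beta> a_def] and acard = amplitude_card[OF K \<beta> a_def, folded J_def]
  have pd: "prob_density (perturbed a S)" if "S \<subseteq> J" for S
    using that J(3) by (intro prob_density_perturbed[OF a0 acard[OF that]]) auto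
  have cls: "perturbed a S \<in> density_class \<beta> C" if "S \<subseteq> J" for S
    by (rule perturbed_in_density_class[OF K that[unfolded J_def] \<beta> a_def C])
  define P where "P S = (\<Pi>\<^sub>M l\<in>{1..n}. density lborel (perturbed a S) \<star> density lborel (e l))" for S
  define L where "L j S = (\<integral>\<^sup>+y. ennreal ((wave_coef (g y) j - (if j \<in> S then a else 0))\<^sup>2) \<partial>P S)" for j S
  let ?B = "ennreal (a\<^sup>2 / (1 + exp X))"
  have P_eq: "P S = (\<Pi>\<^sub>M l\<in>{1..n}. density lborel (conv (perturbed a S) (e l)))" if "S \<subseteq> J" for S
    unfolding P_def
    by (intro PiM_cong refl convolution_eq_density_conv[OF pd[OF that] e perturbed_bounds(2)[OF a0 acard[OF that]]])
  have two: "?B \<le> L j S + L j (insert j S)" if j: "j \<in> J" and S: "S \<subseteq> J - {j}" for j S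
  proof -
    have S1: "S \<subseteq> J" "insert j S \<subseteq> J" "j \<notin> S" "finite S" using j S J(1) finite_subset by auto
    let ?p = "\<lambda>l. conv (perturbed a S) (e l)" and ?q = "\<lambda>l. conv (perturbed a (insert j S)) (e l)"
    let ?x = "\<lambda>l. a\<^sup>2 * (3 * (\<phi> l)\<^sup>2) / \<kappa>"
    have low: "\<kappa> * inverse (1 + y\<^sup>2) \<le> ?p l y" for l y
      unfolding \<kappa>_def
      by (rule conv_lower[OF e perturbed_measurable perturbed_bounds(2)[OF a0 acard[OF S1(1)]]
            perturbed_bounds(4)[OF a0 acard[OF S1(1)]] _ mass]) simp
    have ppos: "0 < ?p l y" for l y
    proof -
      have "0 < 1 + y\<^sup>2" by (simp add: add_pos_nonneg)
      then have "0 < \<kappa> * inverse (1 + y\<^sup>2)" using \<kappa> by simp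
      then show ?thesis using low[of y l] by linarith
    qed
    have pdp: "prob_density (?p l)" and pdq: "prob_density (?q l)" for l
      by (rule prob_density_conv[OF pd[OF S1(1)] e perturbed_bounds(2)[OF a0 acard[OF S1(1)]]],
          rule prob_density_conv[OF pd[OF S1(2)] e perturbed_bounds(2)[OF a0 acard[OF S1(2)]]])
    have jK: "2 * real K - 1 \<le> 2 * real j - 1" using j by (auto simp: J_def)
    have chi: "(\<integral>\<^sup>+y. ennreal ((?q l y)\<^sup>2 / ?p l y) \<partial>lborel) \<le> ennreal (1 + ?x l)" for l
    proof (rule chi_square_le[OF pdp pdq _ conv_perturbed_insert[OF e S1(4,3) a0 acard[OF S1(1)]] low \<kappa>])
      show "conv (wave (2 * real j)) (e l) \<in> borel_measurable borel"
        using prob_densityD(1)[OF e] by simp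
      show "(\<integral>\<^sup>+y. ennreal ((1 + y\<^sup>2) * (conv (wave (2 * real j)) (e l) y)\<^sup>2) \<partial>lborel) \<le> ennreal (3 * (\<phi> l)\<^sup>2)"
        by (rule band_energy[OF e]) (use jK in \<open>auto intro!: d b\<close>)
    qed simp
    have sumx: "(\<Sum>l\<in>{1..n}. ?x l) \<le> X"
    proof -
      have "(\<Sum>l\<in>{1..n}. ?x l) = a\<^sup>2 * 3 / \<kappa> * (\<Sum>l=1..n. (\<phi> l)\<^sup>2)"
        unfolding sum_distrib_left by (intro sum.cong refl) simp
      also have "\<dots> \<le> a\<^sup>2 * 3 / \<kappa> * (C2 * real K powr (1 + 2 * \<beta>))"
        using \<kappa> by (intro mult_left_mono energy) auto
      also have "\<dots> = 3 * C2 / (16 * \<kappa>) * (real K powr (- 2 * \<beta> - 1) * real K powr (1 + 2 * \<beta>))"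
        by (simp add: a2)
      also have "real K powr (- 2 * \<beta> - 1) * real K powr (1 + 2 * \<beta>) = 1"
        using Kr by (simp only: powr_add[symmetric]) simp
      finally show ?thesis by (simp add: X_def)
    qed
    have "?B \<le> (\<integral>\<^sup>+y. ennreal ((wave_coef (g y) j)\<^sup>2) \<partial>(\<Pi>\<^sub>M l\<in>{1..n}. density lborel (?p l)))
      + (\<integral>\<^sup>+y. ennreal ((wave_coef (g y) j - a)\<^sup>2) \<partial>(\<Pi>\<^sub>M l\<in>{1..n}. density lborel (?q l)))"
      by (rule product_two_point_bound[OF _ pdp pdq ppos chi _ sumx coef_measurable[OF g]]) (use \<kappa> in auto)
    then show ?thesis
      unfolding L_def P_eq[OF S1(1)] P_eq[OF S1(2)] using S1(3) by simp
  qed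
  let ?sup = "SUP f\<in>density_class \<beta> C. risk n e f g"
  have "ennreal wave_sq * (of_nat K * (2 ^ (K - 1) * ?B)) \<le> ennreal wave_sq * (\<Sum>S\<in>Pow J. \<Sum>j\<in>J. L j S)"
    using assouad_sum[where L=L and B="?B", OF J(1) two] by (intro mult_left_mono) (simp_all add: J(2))
  also have "\<dots> = (\<Sum>S\<in>Pow J. ennreal wave_sq * (\<Sum>j\<in>J. L j S))" by (rule sum_distrib_left)
  also have "\<dots> \<le> (\<Sum>S\<in>Pow J. ?sup)"
  proof (rule sum_mono)
    fix S assume "S \<in> Pow J"
    then have S: "S \<subseteq> J" by simp
    have "ennreal wave_sq * (\<Sum>j\<in>J. L j S) \<le> risk n e (perturbed a S) g"
      unfolding L_def P_def by (rule risk_ge_coef[OF g pd[OF S] e J(1,3) S])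
    also have "\<dots> \<le> ?sup" by (rule SUP_upper[OF cls[OF S]])
    finally show "ennreal wave_sq * (\<Sum>j\<in>J. L j S) \<le> ?sup" .
  qed
  also have "\<dots> = ennreal (2 ^ K) * ?sup"
    using J(1,2) by (simp add: card_Pow flip: ennreal_power)
  also have "ennreal wave_sq * (of_nat K * (2 ^ (K - 1) * ?B)) = ennreal (2 ^ K) * ennreal (wave_sq / (32 * (1 + exp X)) * real K powr (- 2 * \<beta>))"
  proof -
    have q: "0 < 1 + exp X" by (simp add: add_pos_pos)
    have p2: "(2::real) ^ K = 2 * 2 ^ (K - 1)" using K by (cases K) auto
    have pK: "real K * a\<^sup>2 = real K powr (- 2 * \<beta>) / 16"
    proof -
      have "real K powr 1 * real K powr (- 2 * \<beta> - 1) = real K powr (- 2 * \<beta>)"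
        by (simp only: powr_add[symmetric]) simp
      then show ?thesis using Kr by (simp add: a2)
    qed
    have "(2::ennreal) ^ (K - 1) = ennreal (2 ^ (K - 1))" by (simp flip: ennreal_power)
    then have "ennreal wave_sq * (of_nat K * (2 ^ (K - 1) * ?B))
      = ennreal wave_sq * (ennreal (real K) * (ennreal (2 ^ (K - 1)) * ?B))"
      by (simp only: ennreal_of_nat_eq_real_of_nat)
    also have "\<dots> = ennreal (wave_sq * (real K * (2 ^ (K - 1) * (a\<^sup>2 / (1 + exp X)))))"
      by (simp only: ennreal_mult' less_imp_le[OF wave_sq_pos] of_nat_0_le_iff zero_le_power zero_le_numeral)
    also have "wave_sq * (real K * (2 ^ (K - 1) * (a\<^sup>2 / (1 + exp X)))) = wave_sq * (2 ^ (K - 1) * ((real K * a\<^sup>2) / (1 + exp X)))"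
      by simp
    also have "\<dots> = 2 ^ K * (wave_sq / (32 * (1 + exp X)) * real K powr (- 2 * \<beta>))"
      unfolding pK p2 using q by (simp add: field_simps)
    also have "ennreal \<dots> = ennreal (2 ^ K) * ennreal (wave_sq / (32 * (1 + exp X)) * real K powr (- 2 * \<beta>))"
      using wave_sq_pos q by (intro ennreal_mult mult_nonneg_nonneg divide_nonneg_nonneg) (auto simp: less_imp_le)
    finally show ?thesis .
  qed
  finally have "ennreal (2 ^ K) * ennreal (wave_sq / (32 * (1 + exp X)) * real K powr (- 2 * \<beta>)) \<le> ennreal (2 ^ K) * ?sup" .
  then show ?thesis unfolding X_def by (subst (asm) ennreal_mult_le_mult_iff) auto
qed

text \<open>Part (b). Choosing \<open>K\<close> as the least integer not below \<open>max (m n) (T + 1)\<close> puts all bands beyond both \<open>m n\<close> and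
  \<open>T\<close>. As \<open>m n \<ge> m 1 > 0\<close>, this \<open>K\<close> is at most a constant multiple of \<open>m n\<close> for every \<open>n \<ge> 1\<close>, which
  covers the small sample sizes as well.\<close>

lemma minimax_rate:
  fixes fe :: "nat \<Rightarrow> nat \<Rightarrow> real \<Rightarrow> real" and m :: "nat \<Rightarrow> real"
  assumes err: "\<And>n j. n \<ge> 1 \<Longrightarrow> j \<in> {1..n} \<Longrightarrow> prob_density (fe n j)"
    and beta: "\<beta> > 1/2"
    and condC: "condition_C fe \<alpha> C0 T c1 c2 \<phi>u \<phi>l"
    and m_pos: "\<And>n. n \<ge> 1 \<Longrightarrow> m n > 0"
    and m_mono: "mono_on {1..} m"
    and C2: "0 \<le> C2"
    and m_bound: "\<And>n. n \<ge> 1 \<Longrightarrow> (\<Sum>j=1..n. \<bar>\<phi>u n j (m n)\<bar>\<^sup>2) \<le> C2 * m n powr (1 + 2*\<beta>)"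
  shows "\<exists>C'>0. \<forall>C\<ge>C'. \<exists>c>0. \<forall>n\<ge>1. \<forall>g\<in>estimators n.
              (SUP f\<in>density_class \<beta> C. risk n (fe n) f g) \<ge> ennreal (c * m n powr (-2*\<beta>))"
proof -
  define \<kappa> where "\<kappa> = 1 / (72 * pi) * C0 / (2 + 2 * \<alpha>\<^sup>2)"
  \<comment> \<open>\<open>D * m n\<close> bounds the ceiling of \<open>max (m n) (T + 1)\<close> since \<open>m 1 \<le> m n\<close>\<close>
  define D where "D = 1 + (T + 2) / m 1"
  define c where "c = wave_sq / (32 * (1 + exp (3 * C2 / (16 * \<kappa>)))) * D powr (- 2 * \<beta>)"
  have T: "0 \<le> T" and C0: "0 < C0" using condC by (auto simp: condition_C_def)
  have m1: "0 < m 1" using m_pos by simp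
  have Dpos: "0 < D" using T m1 by (simp add: D_def add_pos_nonneg)
  have cpos: "0 < c" using Dpos wave_sq_pos by (simp add: c_def add_pos_pos)
  have main: "ennreal (c * m n powr (-2*\<beta>)) \<le> (SUP f\<in>density_class \<beta> C. risk n (fe n) f g)"
    if C: "4 * 2 powr \<beta> + 17 powr \<beta> \<le> C" and n: "1 \<le> n" and g: "g \<in> estimators n" for C n g
  proof -
    have mn: "0 < m n" by (rule m_pos[OF n])
    have m1n: "m 1 \<le> m n" using monotone_onD[OF m_mono, of 1 n] n by simp
    define K where "K = nat \<lceil>max (m n) (T + 1)\<rceil>"
    have Kge: "m n \<le> real K" "T + 1 \<le> real K"
      unfolding K_def using real_nat_ceiling_ge[of "max (m n) (T + 1)"] by auto
    then have K1: "1 \<le> K" using T by linarith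
    have Kle: "real K \<le> D * m n"
    proof -
      have "real K = of_int \<lceil>max (m n) (T + 1)\<rceil>"
        unfolding K_def using mn by (intro of_nat_nat) simp
      also have "\<dots> \<le> max (m n) (T + 1) + 1" by linarith
      also have "\<dots> \<le> m n + (T + 2) * 1" using mn T by simp
      also have "\<dots> \<le> m n + (T + 2) * (m n / m 1)"
        using m1 m1n T by (intro add_left_mono mult_left_mono) auto
      also have "\<dots> = D * m n" by (simp add: D_def distrib_right)
      finally show ?thesis .
    qed
    \<comment> \<open>error densities for all indices, with the properties of those in \<open>{1..n}\<close>\<close>
    define ix where "ix l = (if l \<in> {1..n} then l else 1)" for l
    have ix: "ix l \<in> {1..n}" for l using n by (simp add: ix_def)
    have Cl: "C0 \<le> measure (density lborel (fe n (ix l))) {u. \<bar>u\<bar> \<le> \<alpha>}"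
      "\<And>t. T < t \<Longrightarrow> cmod (ft (fe n (ix l)) t) \<le> \<phi>u n (ix l) t"
      "\<And>t. T < t \<Longrightarrow> ft (fe n (ix l)) differentiable (at t)"
      "\<And>t. T < t \<Longrightarrow> cmod (vector_derivative (ft (fe n (ix l))) (at t)) \<le> \<phi>u n (ix l) t"
      "antimono_on {0<..} (\<phi>u n (ix l))" for l
      using condC n ix[of l] by (auto simp: condition_C_def)
    have mono: "\<phi>u n (ix l) t \<le> \<phi>u n (ix l) (m n)" if "2 * real K - 1 \<le> t" for l t
      using monotone_onD[OF Cl(5)[of l], of "m n" t] that Kge mn K1 by simp
    have beyond: "T < t" if "2 * real K - 1 \<le> t" for t using that Kge K1 by linarith
    have "ennreal (c * m n powr (-2*\<beta>)) \<le> ennreal (wave_sq / (32 * (1 + exp (3 * C2 / (16 * \<kappa>)))) * real K powr (- 2 * \<beta>))"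
    proof (rule ennreal_leI)
      have "D powr (- 2 * \<beta>) * m n powr (- 2 * \<beta>) = (D * m n) powr (- 2 * \<beta>)"
        using Dpos mn by (simp add: powr_mult)
      also have "\<dots> \<le> real K powr (- 2 * \<beta>)"
        using Kle K1 beta by (intro powr_mono2') auto
      finally have "wave_sq / (32 * (1 + exp (3 * C2 / (16 * \<kappa>)))) * (D powr (- 2 * \<beta>) * m n powr (- 2 * \<beta>))
        \<le> wave_sq / (32 * (1 + exp (3 * C2 / (16 * \<kappa>)))) * real K powr (- 2 * \<beta>)"
        using wave_sq_pos by (intro mult_left_mono divide_nonneg_nonneg) (auto simp: add_nonneg_nonneg less_imp_le)
      then show "c * m n powr (-2*\<beta>) \<le> wave_sq / (32 * (1 + exp (3 * C2 / (16 * \<kappa>)))) * real K powr (- 2 * \<beta>)"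
        unfolding c_def by (simp only: mult.assoc)
    qed
    also have "\<dots> \<le> (SUP f\<in>density_class \<beta> C. risk n (\<lambda>l. fe n (ix l)) f g)"
      unfolding \<kappa>_def
    proof (rule minimax_lower_bound[OF beta C g _ C0 K1 C2, where \<phi>="\<lambda>l. \<phi>u n (ix l) (m n)"])
      show "prob_density (fe n (ix l))" for l by (rule err[OF n ix])
      show "C0 \<le> measure (density lborel (fe n (ix l))) {u. \<bar>u\<bar> \<le> \<alpha>}" for l by (rule Cl(1))
      show "ft (fe n (ix l)) differentiable (at t)" if "2 * real K - 1 \<le> t" for l t
        by (rule Cl(3)[OF beyond[OF that]])
      show "cmod (vector_derivative (ft (fe n (ix l))) (at t)) \<le> \<phi>u n (ix l) (m n)" if "2 * real K - 1 \<le> t" for l t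
        by (rule order_trans[OF Cl(4)[OF beyond[OF that]] mono[OF that]])
      show "cmod (ft (fe n (ix l)) t) \<le> \<phi>u n (ix l) (m n)" if "2 * real K - 1 \<le> t" for l t
        by (rule order_trans[OF Cl(2)[OF beyond[OF that]] mono[OF that]])
      have "(\<Sum>l=1..n. (\<phi>u n (ix l) (m n))\<^sup>2) = (\<Sum>l=1..n. \<bar>\<phi>u n l (m n)\<bar>\<^sup>2)"
        by (intro sum.cong refl) (simp add: ix_def)
      also have "\<dots> \<le> C2 * m n powr (1 + 2*\<beta>)" by (rule m_bound[OF n])
      also have "\<dots> \<le> C2 * real K powr (1 + 2*\<beta>)"
        using Kge mn beta C2 by (intro mult_left_mono powr_mono2) auto
      finally show "(\<Sum>l=1..n. (\<phi>u n (ix l) (m n))\<^sup>2) \<le> C2 * real K powr (1 + 2*\<beta>)" .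
    qed
    also have "\<dots> = (SUP f\<in>density_class \<beta> C. risk n (fe n) f g)"
      by (intro SUP_cong refl risk_cong) (simp add: ix_def)
    finally show ?thesis .
  qed
  have "0 < 4 * 2 powr \<beta> + 17 powr \<beta>" by (simp add: add_pos_pos)
  then show ?thesis using main cpos by blast
qed

section \<open>The rate of convergence and its optimality\<close>

theorem theorem2p1:
  fixes fe :: "nat \<Rightarrow> nat \<Rightarrow> real \<Rightarrow> real"
    and K :: "real \<Rightarrow> real" and Kft :: "real \<Rightarrow> complex"
    and w m :: "nat \<Rightarrow> real"
    and \<phi>u \<phi>l :: "nat \<Rightarrow> nat \<Rightarrow> real \<Rightarrow> real"
    and \<beta> \<alpha> C0 T c1 c2 C1 C2 :: real
  assumes err: "\<And>n j. n \<ge> 1 \<Longrightarrow> j \<in> {1..n} \<Longrightarrow> prob_density (fe n j)"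
    and kernel: "L2_ft K Kft"
    and w_pos: "\<And>n. n \<ge> 1 \<Longrightarrow> w n > 0"
    and beta: "\<beta> > 1/2"
    and condA: "condition_A fe Kft w"
    and condB: "condition_B \<beta> Kft"
    and condC: "condition_C fe \<alpha> C0 T c1 c2 \<phi>u \<phi>l"
    and m_pos: "\<And>n. n \<ge> 1 \<Longrightarrow> m n > 0"
    and m_mono: "mono_on {1..} m"
    and m_lim: "filterlim m at_top sequentially"
    and C12: "C2 \<ge> C1" "C1 > 0"
    and m_bounds: "\<And>n. n \<ge> 1 \<Longrightarrow>
          C1 * m n powr (1 + 2*\<beta>) \<le> (\<Sum>j=1..n. \<bar>\<phi>u n j (m n)\<bar>\<^sup>2) \<and>
          (\<Sum>j=1..n. \<bar>\<phi>u n j (m n)\<bar>\<^sup>2) \<le> C2 * m n powr (1 + 2*\<beta>)"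
  shows "((\<forall>n\<ge>1. w n = inverse c2 * m n) \<longrightarrow>
           (\<forall>C>0. \<exists>M::real. \<forall>\<^sub>F n in sequentially.
              (SUP f\<in>density_class \<beta> C. risk n (fe n) f (fhat n (fe n) Kft (w n)))
                \<le> ennreal (M * m n powr (-2*\<beta>))))
       \<and> (\<exists>C'>0. \<forall>C\<ge>C'. \<exists>c>0. \<forall>n\<ge>1. \<forall>g\<in>estimators n.
              (SUP f\<in>density_class \<beta> C. risk n (fe n) f g)
                \<ge> ennreal (c * m n powr (-2*\<beta>)))"
proof (intro conjI impI allI)
  fix C :: real
  assume w: "\<forall>n\<ge>1. w n = inverse c2 * m n" and C: "C > 0"
  have "Kft 0 = 1" using condA by (simp add: condition_A_def)
  then show "\<exists>M::real. \<forall>\<^sub>F n in sequentially.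
              (SUP f\<in>density_class \<beta> C. risk n (fe n) f (fhat n (fe n) Kft (w n)))
                \<le> ennreal (M * m n powr (-2*\<beta>))"
    using fhat_rate[OF err kernel _ beta condB condC m_pos m_lim C12(2) _ _ C] m_bounds w by blast
next
  show "\<exists>C'>0. \<forall>C\<ge>C'. \<exists>c>0. \<forall>n\<ge>1. \<forall>g\<in>estimators n.
              (SUP f\<in>density_class \<beta> C. risk n (fe n) f g)
                \<ge> ennreal (c * m n powr (-2*\<beta>))"
    using minimax_rate[OF err beta condC m_pos m_mono _ , of C2] m_bounds C12 by fastforce
qed

end
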